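(* Let $M>0$. There exist constants $C,C_1>0$ depending only on $M$ such that the following holds for all positive integers $n,p$ and every $\epsilon\in[0,1/5)$. Let $\hat\Gamma$ be any maximizer of the empirical matrix depth $\mathcal{D}(\Gamma,\{X_i\}_{i=1}^n)$ over all positive semi-definite $\Gamma\in\mathbb{R}^{p\times p}$, and let $\hat\Sigma=\hat\Gamma/\beta$. Then for any $\delta\in(0,1/2)$ satisfying $C_1\frac{p+\log(1/\delta)}{n}<1$, $$\|\hat\Sigma-\Sigma\|_{\rm op}^2\le C\left(\left(\frac pn\vee\epsilon^2\right)+\frac{\log(1/\delta)}{n}\right)$$ with $\mathbb{P}_{(\epsilon,\Sigma,Q)}$-probability at least $1-2\delta$, uniformly over all probability distributions $Q$ on $\mathbb{R}^p$ and all $\Sigma\in\mathcal{F}(M)$.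
   Context: Contamination model: for $\epsilon\in[0,1]$, a covariance matrix $\Sigma\in\mathbb{R}^{p\times p}$ (throughout assumed nonzero) and an arbitrary probability distribution $Q$ on $\mathbb{R}^p$, $\mathbb{P}_{(\epsilon,\Sigma,Q)}=(1-\epsilon)N(0,\Sigma)+\epsilon Q$; $X_1,\dots,X_n$ are i.i.d. from $\mathbb{P}_{(\epsilon,\Sigma,Q)}$, and the same symbol denotes their joint law. Class: $\mathcal{F}(M)=\{\Sigma=\Sigma^T\in\mathbb{R}^{p\times p}:\Sigma\succeq0,\ s_{\max}(\Sigma)\le M\}$, where $s_{\max}$ is the largest singular value; $M$ does not scale with $p$ or $n$. Empirical matrix depth: with $S^{p-1}$ the Euclidean unit sphere of $\mathbb{R}^p$, $$\mathcal{D}(\Gamma,\{X_i\}_{i=1}^n)=\min_{u\in S^{p-1}}\min\left\{\frac1n\sum_{i=1}^n\mathbb{I}\{|u^TX_i|^2\le u^T\Gamma u\},\ \frac1n\sum_{i=1}^n\mathbb{I}\{|u^TX_i|^2\ge u^T\Gamma u\}\right\}.$$ It takes finitely many values, so maximizers exist. The constant $\beta$ is defined by $\Phi(\sqrt\beta)=3/4$, with $\Phi$ the standard normal cumulative distribution function. $\|\cdot\|_{\rm op}$ is the operator norm and $a\vee b=\max(a,b)$. *)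

theory Defs
  imports "HOL-Probability.Probability" "Jordan_Normal_Form.Char_Poly"
begin

unbundle no inner_syntax
unbundle no vec_syntax

text \<open>
  The constants in the theorem must not depend on the dimension \<open>p\<close>, so \<open>p\<close> has to be bound inside
  the formula. Vectors and matrices are therefore those of the entry Jordan-Normal-Form, with
  \<open>carrier_vec p\<close> and \<open>carrier_mat p p\<close> in the roles of \<open>\<real>\<^sup>p\<close> and the real \<open>p \<times> p\<close> matrices.
\<close>

subsection \<open>Euclidean vectors and matrices\<close>

definition vec_norm2 :: "real Matrix.vec \<Rightarrow> real" where
  "vec_norm2 v = sqrt (v \<bullet> v)"

definition unit_sphere :: "nat \<Rightarrow> real Matrix.vec set" where
  "unit_sphere p = {u \<in> carrier_vec p. vec_norm2 u = 1}"

definition op_norm :: "real mat \<Rightarrow> real" where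
  "op_norm A = (SUP u\<in>unit_sphere (dim_col A). vec_norm2 (A *\<^sub>v u))"

definition psd_mat :: "nat \<Rightarrow> real mat \<Rightarrow> bool" where
  "psd_mat p A \<longleftrightarrow> A \<in> carrier_mat p p \<and> transpose_mat A = A
     \<and> (\<forall>u\<in>carrier_vec p. 0 \<le> u \<bullet> (A *\<^sub>v u))"

definition singular_values :: "real mat \<Rightarrow> real set" where
  "singular_values A = {sqrt k | k. eigenvalue (transpose_mat A * A) k}"

definition s_max :: "real mat \<Rightarrow> real" where
  "s_max A = Max (singular_values A)"

definition cov_class :: "nat \<Rightarrow> real \<Rightarrow> real mat set" where
  "cov_class p M = {S. psd_mat p S \<and> s_max S \<le> M}"

subsection \<open>The contamination model\<close>

text \<open>Only the space and the \<open>\<sigma>\<close>-algebra of \<open>borel_vec p\<close> matter: it is the Borel \<open>\<sigma>\<close>-algebra of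
  \<open>\<real>\<^sup>p\<close>, generated by the coordinates. The measure it carries is irrelevant.\<close>

definition borel_vec :: "nat \<Rightarrow> real Matrix.vec measure" where
  "borel_vec p = vimage_algebra (carrier_vec p) (\<lambda>v. \<lambda>i\<in>{..<p}. v $ i) (\<Pi>\<^sub>M i\<in>{..<p}. borel)"

text \<open>\<open>N(0, S)\<close>, possibly degenerate, as the law of \<open>A Z\<close>, where \<open>A A\<^sup>T = S\<close> and \<open>Z\<close> has
  independent standard normal coordinates. This law does not depend on the chosen \<open>A\<close>.\<close>

definition cov_factor :: "nat \<Rightarrow> real mat \<Rightarrow> real mat" where
  "cov_factor p S = (SOME A. A \<in> carrier_mat p p \<and> A * transpose_mat A = S)"

definition centered_normal :: "nat \<Rightarrow> real mat \<Rightarrow> real Matrix.vec measure" where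
  "centered_normal p S =
     distr (\<Pi>\<^sub>M i\<in>{..<p}. std_normal_distribution) (borel_vec p)
       (\<lambda>z. cov_factor p S *\<^sub>v Matrix.vec p z)"

definition mixture :: "real \<Rightarrow> 'a measure \<Rightarrow> 'a measure \<Rightarrow> 'a measure" where
  "mixture \<epsilon> \<mu> \<nu> = measure_of (space \<mu>) (sets \<mu>)
     (\<lambda>A. ennreal (1 - \<epsilon>) * emeasure \<mu> A + ennreal \<epsilon> * emeasure \<nu> A)"

lemma sets_mixture [simp]: "sets (mixture \<epsilon> \<mu> \<nu>) = sets \<mu>"
  by (simp add: mixture_def)

lemma space_mixture [simp]: "space (mixture \<epsilon> \<mu> \<nu>) = space \<mu>"
  by (simp add: mixture_def)

lemma emeasure_mixture:
  assumes "sets \<nu> = sets \<mu>" "A \<in> sets \<mu>"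
  shows "emeasure (mixture \<epsilon> \<mu> \<nu>) A = ennreal (1 - \<epsilon>) * emeasure \<mu> A + ennreal \<epsilon> * emeasure \<nu> A"
  unfolding mixture_def
proof (rule emeasure_measure_of_sigma)
  show "sigma_algebra (space \<mu>) (sets \<mu>)" by (rule sets.sigma_algebra_axioms)
  show "positive (sets \<mu>) (\<lambda>A. ennreal (1 - \<epsilon>) * emeasure \<mu> A + ennreal \<epsilon> * emeasure \<nu> A)"
    by (simp add: positive_def)
  show "countably_additive (sets \<mu>)
      (\<lambda>A. ennreal (1 - \<epsilon>) * emeasure \<mu> A + ennreal \<epsilon> * emeasure \<nu> A)"
  proof (rule countably_additiveI)
    fix B :: "nat \<Rightarrow> 'a set"
    assume B: "range B \<subseteq> sets \<mu>" "disjoint_family B" "\<Union> (range B) \<in> sets \<mu>"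
    have "(\<Sum>i. emeasure \<mu> (B i)) = emeasure \<mu> (\<Union> (range B))"
      "(\<Sum>i. emeasure \<nu> (B i)) = emeasure \<nu> (\<Union> (range B))"
      using B assms(1) by (auto intro!: suminf_emeasure)
    then show "(\<Sum>i. ennreal (1 - \<epsilon>) * emeasure \<mu> (B i) + ennreal \<epsilon> * emeasure \<nu> (B i))
        = ennreal (1 - \<epsilon>) * emeasure \<mu> (\<Union> (range B)) + ennreal \<epsilon> * emeasure \<nu> (\<Union> (range B))"
      by (simp add: suminf_add[symmetric])
  qed
qed (rule assms)

definition contaminated :: "nat \<Rightarrow> real \<Rightarrow> real mat \<Rightarrow> real Matrix.vec measure \<Rightarrow> real Matrix.vec measure"
  where "contaminated p \<epsilon> S Q = mixture \<epsilon> (centered_normal p S) Q"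

definition sample_law ::
  "nat \<Rightarrow> nat \<Rightarrow> real \<Rightarrow> real mat \<Rightarrow> real Matrix.vec measure \<Rightarrow> (nat \<Rightarrow> real Matrix.vec) measure"
  where "sample_law n p \<epsilon> S Q = (\<Pi>\<^sub>M i\<in>{..<n}. contaminated p \<epsilon> S Q)"

subsection \<open>Matrix depth\<close>

text \<open>The minimum over the sphere is attained, since all values are of the form \<open>k / n\<close> with
  \<open>k \<le> n\<close>; in particular \<open>MIN\<close> is applied to a finite set.\<close>

definition matrix_depth :: "nat \<Rightarrow> nat \<Rightarrow> real mat \<Rightarrow> (nat \<Rightarrow> real Matrix.vec) \<Rightarrow> real" where
  "matrix_depth n p G X = (MIN u\<in>unit_sphere p.
     min ((1 / real n) * (\<Sum>i<n. of_bool (\<bar>u \<bullet> X i\<bar>\<^sup>2 \<le> u \<bullet> (G *\<^sub>v u))))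
         ((1 / real n) * (\<Sum>i<n. of_bool (\<bar>u \<bullet> X i\<bar>\<^sup>2 \<ge> u \<bullet> (G *\<^sub>v u)))))"

definition depth_beta :: real where
  "depth_beta = (THE b. b \<ge> 0 \<and> cdf std_normal_distribution (sqrt b) = 3 / 4)"

end

theory Submission
  imports Defs
begin

text \<open>
  The depth of a matrix \<open>G\<close> only looks at the empirical masses of the slabs \<open>{x. |u \<bullet> x| \<le> r}\<close> and of
  their open versions, with \<open>r\<^sup>2 = u \<bullet> G u\<close>. Suppose that all these empirical masses differ from the true
  masses under the contaminated law by at most \<open>\<Delta>\<close>.

  In a direction \<open>u\<close> with \<open>q = u \<bullet> S u > 0\<close> the projection of \<open>N(0, S)\<close> is \<open>sqrt q\<close> times a standard
  normal variable, so \<open>\<beta> S\<close> has depth at least \<open>1/2\<close> under \<open>N(0, S)\<close>, hence at least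
  \<open>(1 - \<epsilon>) / 2 - \<Delta>\<close> for the sample. The maximizer is at least as deep. Read back at the level of
  \<open>N(0, S)\<close>, its slabs have Gaussian mass within \<open>\<eta> = (5/4) (\<epsilon> + 2 \<Delta>)\<close> of \<open>1/2\<close>; because \<open>\<epsilon> < 1/5\<close>,
  \<open>\<eta>\<close> stays below \<open>3/8\<close> once \<open>\<Delta> \<le> 1/20\<close>. The standard normal distribution function has derivative
  bounded away from zero on bounded sets, so the quantile moves by \<open>O(\<eta>)\<close> only, and the two quadratic forms
  differ by \<open>O(M \<eta>)\<close> on the sphere (\<open>depth_maximizer_quadratic_form\<close>). For symmetric matrices this
  controls the operator norm (\<open>op_norm_le_quadratic_form_bound\<close>). A direction with \<open>q = 0\<close> carries a point mass
  at zero, and there the depth condition forces the quadratic form of the maximizer to vanish as well.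

  What remains is \<open>\<Delta>\<^sup>2 \<le> const * (p + ln (1 / \<delta>)) / n\<close> with probability at least \<open>1 - 2 \<delta>\<close>, for an arbitrary
  law of the observations (\<open>slab_deviation\<close>). There is no factor \<open>ln n\<close>, so a union bound over all traces of slabs
  on the sample is not enough, and the proof goes through chaining. Slabs are built from two half-spaces, so
  their traces on \<open>m\<close> points are few (\<open>trace_growth_slabs\<close>, from \<open>card_le_card_shattered\<close>). Few traces
  imply small packing numbers at every scale (\<open>card_separated_le\<close>). Chaining over these scales bounds
  random signed sums over all traces at once (\<open>chaining_tail_bound\<close>), and symmetrization with a ghost
  sample transfers the bound to empirical masses (\<open>ghost_deviation_tail\<close>,
  \<open>finite_class_deviation_tail\<close>). Finite classes are passed to countable ones by continuity of measure, and to
  all slabs by pointwise approximation with rational slabs.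
\<close>


section \<open>Traces of half-spaces and packing numbers\<close>

definition traces :: "'a set set \<Rightarrow> (nat \<Rightarrow> 'a) \<Rightarrow> nat \<Rightarrow> nat set set" where
  "traces F x m = (\<lambda>A. {i. i < m \<and> x i \<in> A}) ` F"

text \<open>
  The bound \<open>(1 / y) ^ D * exp (2 * y * m)\<close> for all \<open>y \<in> (0, 1]\<close> is polynomial growth of degree \<open>D\<close>
  in disguise: \<open>y = D / (2 * m)\<close> gives \<open>(2 * e * m / D) ^ D\<close>. The free parameter avoids a case
  distinction for small \<open>m\<close> and can be tuned to absorb a term that is linear in \<open>m\<close>. The parameter
  \<open>\<Omega>\<close> restricts the points on which traces are taken.
\<close>

definition trace_growth :: "'a set \<Rightarrow> nat \<Rightarrow> 'a set set \<Rightarrow> bool" where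
  "trace_growth \<Omega> D F \<longleftrightarrow> (\<forall>m x y. (\<forall>i<m. x i \<in> \<Omega>) \<longrightarrow> 0 < y \<longrightarrow> y \<le> 1 \<longrightarrow>
     real (card (traces F x m)) \<le> (1 / y) ^ D * exp (2 * y * real m))"

lemma traces_subset: "traces F x m \<subseteq> Pow {..<m}"
  by (auto simp: traces_def)

lemma finite_traces [simp]: "finite (traces F x m)"
  by (rule finite_subset[OF traces_subset]) simp

text \<open>
  Pajor's form of the Sauer-Shelah lemma: the sets \<open>S\<close> on the right are those shattered by \<open>F\<close>. To
  remove a point \<open>a\<close>, split \<open>F\<close> into the members that avoid \<open>a\<close> and those that contain it. A set
  shattered by both halves yields two sets shattered by \<open>F\<close>, with and without \<open>a\<close>, which is what
  inclusion-exclusion requires.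
\<close>

lemma card_le_card_shattered:
  assumes "finite X" "F \<subseteq> Pow X"
  shows "card F \<le> card {S. S \<subseteq> X \<and> Pow S \<subseteq> (\<inter>) S ` F}"
  using assms
proof (induction X arbitrary: F rule: finite_induct)
  case empty
  show ?case
  proof (cases "F = {}")
    case False
    with empty have F: "F = {{}}" by auto
    have "{S. S \<subseteq> {} \<and> Pow S \<subseteq> (\<inter>) S ` F} = {{}::'a set}"
      unfolding F by auto
    then show ?thesis using F by simp
  qed simp
next
  case (insert a X)
  define sh where "sh G = {S. S \<subseteq> X \<and> Pow S \<subseteq> (\<inter>) S ` G}" for G
  define F0 where "F0 = {A \<in> F. a \<notin> A}"
  define F1 where "F1 = (\<lambda>A. A - {a}) ` {A \<in> F. a \<in> A}"
  have fin: "finite F" using insert.prems insert.hyps by (meson finite.insertI finite_Pow_iff finite_subset)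
  have sub: "F0 \<subseteq> Pow X" "F1 \<subseteq> Pow X" using insert.prems by (auto simp: F0_def F1_def)
  have finsh: "finite (sh G)" for G
    by (rule finite_subset[of _ "Pow X"]) (auto simp: sh_def insert.hyps)
  have "card F1 = card {A \<in> F. a \<in> A}"
    unfolding F1_def by (rule card_image) (auto simp: inj_on_def)
  moreover have "card F = card F0 + card {A \<in> F. a \<in> A}"
    unfolding F0_def using fin by (subst card_Un_disjoint[symmetric]) (auto intro!: arg_cong[of _ _ card])
  ultimately have "card F \<le> card (sh F0) + card (sh F1)"
    using insert.IH[OF sub(1)] insert.IH[OF sub(2)] by (simp add: sh_def)
  also have "\<dots> = card (sh F0 \<union> sh F1) + card (sh F0 \<inter> sh F1)"
    by (rule card_Un_Int) (auto simp: finsh)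
  also have "card (sh F0 \<inter> sh F1) = card (insert a ` (sh F0 \<inter> sh F1))"
  proof (rule card_image[symmetric], rule inj_onI)
    fix A B assume AB: "A \<in> sh F0 \<inter> sh F1" "B \<in> sh F0 \<inter> sh F1" "insert a A = insert a B"
    then have "a \<notin> A" "a \<notin> B" using insert.hyps(2) by (auto simp: sh_def)
    with AB(3) show "A = B" by (metis insert_ident)
  qed
  also have "card (sh F0 \<union> sh F1) + card (insert a ` (sh F0 \<inter> sh F1))
      = card ((sh F0 \<union> sh F1) \<union> insert a ` (sh F0 \<inter> sh F1))"
    using insert.hyps(2)
    by (intro card_Un_disjoint[symmetric]) (auto simp: finsh, auto simp: sh_def)
  also have "\<dots> \<le> card {S. S \<subseteq> insert a X \<and> Pow S \<subseteq> (\<inter>) S ` F}"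
  proof (rule card_mono)
    show "finite {S. S \<subseteq> insert a X \<and> Pow S \<subseteq> (\<inter>) S ` F}"
      by (rule finite_subset[of _ "Pow (insert a X)"]) (auto simp: insert.hyps)
    have 0: "Pow S \<subseteq> (\<inter>) S ` F" if "S \<in> sh F0" for S
      proof -
      have "Pow S \<subseteq> (\<inter>) S ` F0" using that by (simp add: sh_def)
      also have "\<dots> \<subseteq> (\<inter>) S ` F" by (rule image_mono) (auto simp: F0_def)
      finally show ?thesis .
    qed
    have 1: "Pow S \<subseteq> (\<inter>) S ` F" if "S \<in> sh F1" for S
    proof
      fix B assume "B \<in> Pow S"
      then have "B \<in> (\<inter>) S ` F1" using that unfolding sh_def by blast
      then obtain A where A: "A \<in> F" "B = S \<inter> (A - {a})" unfolding F1_def by blast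
      moreover have "a \<notin> S" using that insert.hyps by (auto simp: sh_def)
      ultimately have "B = S \<inter> A" by auto
      with A show "B \<in> (\<inter>) S ` F" by blast
    qed
    have 2: "Pow (insert a S) \<subseteq> (\<inter>) (insert a S) ` F" if "S \<in> sh F0" "S \<in> sh F1" for S
    proof
      fix B assume B: "B \<in> Pow (insert a S)"
      have aS: "a \<notin> S" using that insert.hyps by (auto simp: sh_def)
      have BS: "B - {a} \<in> Pow S" using B by auto
      show "B \<in> (\<inter>) (insert a S) ` F"
      proof (cases "a \<in> B")
        case True
        from BS that(2) have "B - {a} \<in> (\<inter>) S ` F1" unfolding sh_def by blast
        then obtain A where "A \<in> F" "a \<in> A" "B - {a} = S \<inter> (A - {a})"
          unfolding F1_def by blast
        with True aS have "B = insert a S \<inter> A" by auto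
        with \<open>A \<in> F\<close> show ?thesis by blast
      next
        case False
        from BS that(1) have "B - {a} \<in> (\<inter>) S ` F0" unfolding sh_def by blast
        then obtain A where "A \<in> F" "a \<notin> A" "B - {a} = S \<inter> A"
          unfolding F0_def by blast
        with False have "B = insert a S \<inter> A" by auto
        with \<open>A \<in> F\<close> show ?thesis by blast
      qed
    qed
    show "sh F0 \<union> sh F1 \<union> insert a ` (sh F0 \<inter> sh F1)
        \<subseteq> {S. S \<subseteq> insert a X \<and> Pow S \<subseteq> (\<inter>) S ` F}"
    proof
      fix U assume "U \<in> sh F0 \<union> sh F1 \<union> insert a ` (sh F0 \<inter> sh F1)"
      then consider "U \<in> sh F0" | "U \<in> sh F1" | S where "U = insert a S" "S \<in> sh F0" "S \<in> sh F1"
        by blast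
      then have "Pow U \<subseteq> (\<inter>) U ` F \<and> U \<subseteq> insert a X"
      proof cases
        case 3
        then show ?thesis using 2[of S] unfolding sh_def by blast
      qed (use 0 1 in \<open>auto simp: sh_def simp del: Pow_iff\<close>)
      then show "U \<in> {S. S \<subseteq> insert a X \<and> Pow S \<subseteq> (\<inter>) S ` F}" by simp
    qed
  qed
  finally show ?case .
qed

text \<open>
  Weight each set \<open>S\<close> by \<open>y ^ card S\<close>: the weights over all subsets sum to \<open>(1 + y) ^ card X\<close>, and
  every small set has weight at least \<open>y ^ d\<close>.
\<close>

lemma card_small_subsets_le:
  fixes y :: real
  assumes "finite X" "0 < y" "y \<le> 1"
  shows "real (card {S. S \<subseteq> X \<and> card S \<le> d}) \<le> (1 / y) ^ d * exp (y * real (card X))"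
proof -
  have fin: "finite {S. S \<subseteq> X \<and> card S \<le> d}"
    by (rule finite_subset[of _ "Pow X"]) (auto simp: assms)
  have "y ^ d * real (card {S. S \<subseteq> X \<and> card S \<le> d}) = (\<Sum>S\<in>{S. S \<subseteq> X \<and> card S \<le> d}. y ^ d)"
    by simp
  also have "\<dots> \<le> (\<Sum>S\<in>{S. S \<subseteq> X \<and> card S \<le> d}. y ^ card S)"
    using assms by (intro sum_mono power_decreasing) auto
  also have "\<dots> \<le> (\<Sum>S\<in>Pow X. y ^ card S)"
    using assms by (intro sum_mono2) auto
  also have "\<dots> = (\<Prod>x\<in>X. y + 1)"
    by (subst prod_add[OF assms(1)]) simp
  also have "\<dots> = (1 + y) ^ card X" by (simp add: add.commute)
  also have "\<dots> \<le> exp y ^ card X"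
    using assms by (intro power_mono exp_ge_add_one_self) auto
  also have "\<dots> = exp (y * real (card X))" by (simp add: exp_of_nat_mult[symmetric] mult.commute)
  finally show ?thesis using assms by (simp add: field_simps)
qed

text \<open>
  Gaussian elimination on the last coordinate.
\<close>

lemma linear_dependence_of_many_vectors:
  fixes \<phi> :: "'i \<Rightarrow> nat \<Rightarrow> real"
  assumes "finite S" "d < card S"
  shows "\<exists>c. (\<exists>i\<in>S. c i \<noteq> 0) \<and> (\<forall>j<d. (\<Sum>i\<in>S. c i * \<phi> i j) = 0)"
  using assms
proof (induction d arbitrary: S \<phi>)
  case 0
  then have "S \<noteq> {}" by auto
  then show ?case by (intro exI[of _ "\<lambda>_. 1"]) auto
next
  case (Suc d)
  show ?case
  proof (cases "\<forall>i\<in>S. \<phi> i d = 0")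
    case True
    from Suc.IH[of S \<phi>] Suc.prems obtain c where
      "\<exists>i\<in>S. c i \<noteq> 0" "\<forall>j<d. (\<Sum>i\<in>S. c i * \<phi> i j) = 0" by auto
    with True show ?thesis by (intro exI[of _ c]) (auto simp: less_Suc_eq)
  next
    case False
    then obtain k where k: "k \<in> S" "\<phi> k d \<noteq> 0" by blast
    define S' where "S' = S - {k}"
    define \<psi> where "\<psi> i j = \<phi> i j - \<phi> i d / \<phi> k d * \<phi> k j" for i j
    have "finite S'" "d < card S'" using Suc.prems k by (auto simp: S'_def)
    from Suc.IH[OF this, of \<psi>] obtain c where
      c: "\<exists>i\<in>S'. c i \<noteq> 0" "\<And>j. j < d \<Longrightarrow> (\<Sum>i\<in>S'. c i * \<psi> i j) = 0" by blast
    define c' where "c' = c(k := - (\<Sum>i\<in>S'. c i * \<phi> i d) / \<phi> k d)"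
    have S: "S = insert k S'" "k \<notin> S'" using k by (auto simp: S'_def)
    have sum: "(\<Sum>i\<in>S. c' i * \<phi> i j) = (\<Sum>i\<in>S'. c i * \<psi> i j)" for j
    proof -
      have "(\<Sum>i\<in>S. c' i * \<phi> i j) = c' k * \<phi> k j + (\<Sum>i\<in>S'. c' i * \<phi> i j)"
        unfolding S(1) using S(2) \<open>finite S'\<close> by simp
      also have "(\<Sum>i\<in>S'. c' i * \<phi> i j) = (\<Sum>i\<in>S'. c i * \<phi> i j)"
        using S(2) by (intro sum.cong) (auto simp: c'_def)
      also have "c' k * \<phi> k j = - (\<Sum>i\<in>S'. c i * (\<phi> i d / \<phi> k d * \<phi> k j))"
        by (simp add: c'_def sum_distrib_right sum_distrib_left sum_divide_distrib mult_ac)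
      finally show ?thesis
        by (simp add: \<psi>_def right_diff_distrib sum_subtractf)
    qed
    have "\<psi> i d = 0" for i using k by (simp add: \<psi>_def)
    then have "\<forall>j<Suc d. (\<Sum>i\<in>S. c' i * \<phi> i j) = 0"
      using c(2) by (auto simp: sum less_Suc_eq)
    moreover have "\<exists>i\<in>S. c' i \<noteq> 0" using c(1) S by (auto simp: c'_def)
    ultimately show ?thesis by blast
  qed
qed

text \<open>
  A set of more than \<open>d\<close> points is not shattered by homogeneous half-spaces in \<open>d\<close> features. In a
  linear dependence among the features, some coefficient may be assumed positive; a half-space
  that contains exactly the points with positive coefficient would make the combination positive,
  but it is zero.
\<close>

lemma card_halfspace_traces_le:
  fixes \<phi> :: "'i \<Rightarrow> nat \<Rightarrow> real" and y :: real
  assumes X: "finite X" and y: "0 < y" "y \<le> 1"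
    and F: "F \<subseteq> range (\<lambda>a. {i\<in>X. 0 < (\<Sum>j<d. a j * \<phi> i j)})"
  shows "real (card F) \<le> (1 / y) ^ d * exp (y * real (card X))"
proof -
  have "S \<subseteq> X \<and> card S \<le> d" if S: "S \<subseteq> X" "Pow S \<subseteq> (\<inter>) S ` F" for S
  proof (rule ccontr)
    assume "\<not> ?thesis"
    then have d: "d < card S" using S by simp
    have fS: "finite S" using S X finite_subset by blast
    have pos: False if c: "\<exists>i\<in>S. c i > 0" "\<forall>j<d. (\<Sum>i\<in>S. c i * \<phi> i j) = 0" for c
    proof -
      have "{i\<in>S. c i > 0} \<in> (\<inter>) S ` F" using S by auto
      then obtain A where A: "A \<in> F" "{i\<in>S. c i > 0} = S \<inter> A" by blast
      from F A obtain a where a: "A = {i\<in>X. 0 < (\<Sum>j<d. a j * \<phi> i j)}" by blast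
      have iff: "c i > 0 \<longleftrightarrow> 0 < (\<Sum>j<d. a j * \<phi> i j)" if "i \<in> S" for i
        using that A S a by auto
      from c obtain k where k: "k \<in> S" "c k > 0" by blast
      \<comment> \<open>No term is negative, because the two factors never have opposite signs, and the term at \<open>k\<close> is positive.\<close>
      have "0 < (\<Sum>i\<in>S. c i * (\<Sum>j<d. a j * \<phi> i j))"
      proof (rule sum_pos2)
        show "k \<in> S" "0 < c k * (\<Sum>j<d. a j * \<phi> k j)" using iff k by auto
      next
        fix i assume "i \<in> S"
        then show "0 \<le> c i * (\<Sum>j<d. a j * \<phi> i j)" using iff[of i]
          by (cases "c i > 0") (auto simp: not_less intro: mult_nonpos_nonpos)
      qed (rule fS)
      also have "(\<Sum>i\<in>S. c i * (\<Sum>j<d. a j * \<phi> i j)) = (\<Sum>j<d. a j * (\<Sum>i\<in>S. c i * \<phi> i j))"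
        by (simp add: sum_distrib_left, subst sum.swap) (simp add: mult_ac)
      also have "\<dots> = 0" using c by simp
      finally show False by simp
    qed
    from linear_dependence_of_many_vectors[OF fS d, of \<phi>] obtain c where
      c: "\<exists>i\<in>S. c i \<noteq> 0" "\<forall>j<d. (\<Sum>i\<in>S. c i * \<phi> i j) = 0" by blast
    show False
    proof (cases "\<exists>i\<in>S. c i > 0")
      case True with pos[of c] c show False by blast
    next
      case False
      with c(1) have "\<exists>i\<in>S. - c i > 0" by (metis linorder_neqE_linordered_idom neg_0_less_iff_less)
      with pos[of "\<lambda>i. - c i"] c(2) show False by (simp add: sum_negf)
    qed
  qed
  then have sub: "{S. S \<subseteq> X \<and> Pow S \<subseteq> (\<inter>) S ` F} \<subseteq> {S. S \<subseteq> X \<and> card S \<le> d}" by blast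
  have "card F \<le> card {S. S \<subseteq> X \<and> Pow S \<subseteq> (\<inter>) S ` F}"
    using F by (intro card_le_card_shattered X) auto
  also have "\<dots> \<le> card {S. S \<subseteq> X \<and> card S \<le> d}"
    by (rule card_mono[OF _ sub], rule finite_subset[of _ "Pow X"]) (auto simp: X)
  finally show ?thesis
    using card_small_subsets_le[OF X y, of d] by linarith
qed

text \<open>
  Dudley's packing argument. If the members of \<open>P\<close> are pairwise far apart, a short random sample of
  indices already distinguishes all of them, so \<open>P\<close> is no larger than the number of traces on
  that sample. The sample has length \<open>m\<close> about \<open>2 * ln (card P) / \<epsilon>\<close>, and the choice \<open>y = \<epsilon> / 8\<close> makes the
  term linear in \<open>m\<close> at most half of \<open>ln (card P)\<close> up to a constant, which can be moved to the left.
\<close>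

lemma card_separated_le:
  fixes \<epsilon> :: real
  assumes n: "n > 0" and D: "D > 0" and eps: "0 < \<epsilon>" "\<epsilon> \<le> 1"
    and T: "T \<subseteq> Pow {..<n}" "trace_growth {..<n} D T"
    and P: "P \<subseteq> T"
    and sep: "\<And>A B. A \<in> P \<Longrightarrow> B \<in> P \<Longrightarrow> A \<noteq> B \<Longrightarrow> \<epsilon> * real n \<le> real (card (sym_diff A B))"
  shows "real (card P) \<le> exp (2 * real D * ln (8 / \<epsilon>) + 1)"
proof (cases "P = {}")
  case False
  have finT: "finite T" using T(1) by (rule finite_subset) simp
  have finP: "finite P" using P finT finite_subset by blast
  define N where "N = real (card P)"
  have N: "N \<ge> 1" using False finP by (simp add: N_def Suc_le_eq card_gt_0_iff)
  define m where "m = nat \<lceil>2 * ln N / \<epsilon>\<rceil>"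
  have lnN: "ln N \<ge> 0" using N by simp
  have m_lower: "2 * ln N \<le> \<epsilon> * m"
  proof -
    have "2 * ln N / \<epsilon> \<le> real m" unfolding m_def by linarith
    with eps show ?thesis by (simp add: field_simps)
  qed
  have m_upper: "\<epsilon> * m \<le> 2 * ln N + \<epsilon>"
  proof -
    have "real m \<le> 2 * ln N / \<epsilon> + 1" unfolding m_def using lnN eps
      by (simp add: of_nat_nat)
    from mult_left_mono[OF this, of \<epsilon>] eps have "\<epsilon> * m \<le> \<epsilon> * (2 * ln N / \<epsilon> + 1)" by simp
    also have "\<dots> = 2 * ln N + \<epsilon>" using eps by (simp add: distrib_left)
    finally show ?thesis .
  qed
  define Gm where "Gm = PiE {..<m} (\<lambda>_. {..<n})"
  have cardG: "real (card Gm) = real n ^ m" by (simp add: Gm_def card_PiE)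
  define bad where "bad A B = PiE {..<m} (\<lambda>_. {..<n} - sym_diff A B)" for A B :: "nat set"
  define OD where "OD = P \<times> P - Id"
  \<comment> \<open>A pair is missed by one random index with probability at most \<open>1 - \<epsilon>\<close>, so the
    length \<open>m\<close> is just large enough to beat the number of ordered pairs, which is below \<open>N\<^sup>2\<close>.\<close>
  have contraction: "(1 - \<epsilon>) ^ m \<le> 1 / N\<^sup>2"
  proof -
    have "(1 - \<epsilon>) ^ m \<le> exp (- \<epsilon>) ^ m"
      using eps exp_ge_add_one_self[of "-\<epsilon>"] by (intro power_mono) auto
    also have "\<dots> = exp (- (\<epsilon> * m))" by (simp add: exp_of_nat_mult[symmetric] mult.commute)
    also have "\<dots> \<le> exp (- (2 * ln N))" using m_lower by simp
    also have "\<dots> = 1 / N\<^sup>2"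
    proof -
      have "exp (2 * ln N) = N\<^sup>2" using N by (simp add: exp_double)
      then show ?thesis by (simp add: exp_minus inverse_eq_divide)
    qed
    finally show ?thesis .
  qed
  have bad_card: "real (card (bad A B)) \<le> real n ^ m / N\<^sup>2"
    if "(A, B) \<in> OD" for A B
  proof -
    have AB: "A \<in> P" "B \<in> P" "A \<noteq> B" using that by (auto simp: OD_def)
    have sub: "sym_diff A B \<subseteq> {..<n}" using AB P T(1) by blast
    have "real (card (bad A B)) = real (card ({..<n} - sym_diff A B)) ^ m"
      by (simp add: bad_def card_PiE)
    also have "card ({..<n} - sym_diff A B) = n - card (sym_diff A B)"
      using sub by (subst card_Diff_subset) (auto intro: finite_subset)
    also have "real (n - card (sym_diff A B)) = real n - real (card (sym_diff A B))"
      using card_mono[OF _ sub] by (simp add: of_nat_diff)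
    also have "(real n - real (card (sym_diff A B))) ^ m \<le> (real n * (1 - \<epsilon>)) ^ m"
      using sep[OF AB] card_mono[OF _ sub] by (intro power_mono) (auto simp: algebra_simps)
    also have "\<dots> = real n ^ m * (1 - \<epsilon>) ^ m" by (simp add: power_mult_distrib)
    also have "\<dots> \<le> real n ^ m * (1 / N\<^sup>2)"
      by (rule mult_left_mono[OF contraction]) simp
    finally show ?thesis by simp
  qed
  have finOD: "finite OD" using finP by (simp add: OD_def)
  have "P \<times> P \<inter> Id \<noteq> {}" using False by auto
  then have "card OD < card (P \<times> P)"
    unfolding OD_def using finP by (intro psubset_card_mono) auto
  then have cOD: "real (card OD) < N\<^sup>2"
    by (simp add: N_def card_cartesian_product power2_eq_square flip: of_nat_mult)
  have "real (card (\<Union>(A, B)\<in>OD. bad A B)) \<le> (\<Sum>(A, B)\<in>OD. real (card (bad A B)))"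
    using card_UN_le[OF finOD, of "\<lambda>(A, B). bad A B"]
    by (simp add: split_def flip: of_nat_sum)
  also have "\<dots> \<le> (\<Sum>(A, B)\<in>OD. real n ^ m / N\<^sup>2)"
    by (rule sum_mono) (use bad_card in auto)
  also have "\<dots> = real (card OD) * (real n ^ m / N\<^sup>2)" by simp
  also have "\<dots> < N\<^sup>2 * (real n ^ m / N\<^sup>2)"
    using cOD n N by (intro mult_strict_right_mono) auto
  also have "\<dots> = real (card Gm)" using N cardG by simp
  finally have "card (\<Union>(A, B)\<in>OD. bad A B) < card Gm" by simp
  moreover have "finite (\<Union>(A, B)\<in>OD. bad A B)"
    using finOD by (auto simp: bad_def intro!: finite_PiE)
  ultimately have "\<not> Gm \<subseteq> (\<Union>(A, B)\<in>OD. bad A B)"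
    using card_mono by (metis not_less)
  then obtain g where g: "g \<in> Gm" "\<And>A B. (A, B) \<in> OD \<Longrightarrow> g \<notin> bad A B" by blast
  have gi: "g i < n" if "i < m" for i using g(1) that by (auto simp: Gm_def)
  have inj: "inj_on (\<lambda>A. {i. i < m \<and> g i \<in> A}) P"
  proof (rule inj_onI, rule ccontr)
    fix A B assume AB: "A \<in> P" "B \<in> P" "{i. i < m \<and> g i \<in> A} = {i. i < m \<and> g i \<in> B}" "A \<noteq> B"
    have "g \<in> bad A B"
      unfolding bad_def using AB g(1) gi by (auto simp: Gm_def PiE_def)
    with g(2)[of A B] AB show False by (auto simp: OD_def)
  qed
  define y where "y = \<epsilon> / 8"
  have y: "0 < y" "y \<le> 1" using eps by (auto simp: y_def)
  have "card P = card ((\<lambda>A. {i. i < m \<and> g i \<in> A}) ` P)" by (rule card_image[OF inj, symmetric])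
  also have "\<dots> \<le> card (traces T g m)"
    unfolding traces_def by (intro card_mono image_mono P finite_imageI finT)
  finally have "N \<le> real (card (traces T g m))" by (simp add: N_def)
  also have "\<dots> \<le> (1 / y) ^ D * exp (2 * y * real m)"
    using T(2) gi y unfolding trace_growth_def by blast
  also have "\<dots> = exp (real D * ln (8 / \<epsilon>) + 2 * y * real m)"
    using eps by (simp add: exp_add y_def exp_of_nat_mult)
  finally have "exp (ln N) \<le> exp (real D * ln (8 / \<epsilon>) + 2 * y * real m)"
    using N by simp
  then have "ln N \<le> real D * ln (8 / \<epsilon>) + 2 * y * real m"
    by (simp only: exp_le_cancel_iff)
  moreover have "2 * y * real m \<le> (2 * ln N + \<epsilon>) / 4" using m_upper by (simp add: y_def)
  ultimately have "ln N \<le> 2 * (real D * ln (8 / \<epsilon>)) + 1" using eps(2) by argo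
  then have "ln N \<le> 2 * real D * ln (8 / \<epsilon>) + 1" by (simp only: mult.assoc)
  then have "exp (ln N) \<le> exp (2 * real D * ln (8 / \<epsilon>) + 1)" by (simp only: exp_le_cancel_iff)
  moreover have "exp (ln N) = real (card P)" using N by (simp add: N_def)
  ultimately show ?thesis by (simp only:)
qed simp

section \<open>Chaining for random signs\<close>

definition signs :: "nat \<Rightarrow> (nat \<Rightarrow> real) set" where
  "signs n = PiE {..<n} (\<lambda>_. {-1, 1})"

lemma finite_signs [simp]: "finite (signs n)"
  by (auto simp: signs_def intro!: finite_PiE)

lemma card_signs: "card (signs n) = 2 ^ n"
  by (simp add: signs_def card_PiE numeral_2_eq_2)

lemma two_power_fact_le_fact_double: "2 ^ n * fact n \<le> (fact (2 * n) :: real)"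
proof (induction n)
  case (Suc n)
  have "2 ^ Suc n * fact (Suc n) = (2 * real (Suc n)) * (2 ^ n * fact n :: real)" by simp
  also have "\<dots> \<le> (2 * real (Suc n)) * fact (2 * n)"
    by (rule mult_left_mono[OF Suc.IH]) simp
  also have "\<dots> \<le> (2 * real (Suc n)) * (real (2 * n + 1) * fact (2 * n))"
    by (intro mult_left_mono) auto
  also have "\<dots> = fact (2 * Suc n)" by (simp add: algebra_simps)
  finally show ?case .
qed simp

text \<open>
  Termwise comparison of the two power series.
\<close>

lemma cosh_le_exp_half_square: "cosh x \<le> exp (x\<^sup>2 / 2)" for x :: real
proof -
  let ?f = "\<lambda>n. if even n then x ^ n /\<^sub>R fact n else 0"
  have "strict_mono (\<lambda>n::nat. 2 * n)" by (rule strict_monoI) simp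
  then have "(\<lambda>n. ?f (2 * n)) sums cosh x \<longleftrightarrow> ?f sums cosh x"
    by (rule sums_mono_reindex) (auto elim!: evenE)
  then have cosh: "(\<lambda>n. ?f (2 * n)) sums cosh x" using cosh_converges by blast
  have exp: "(\<lambda>n. (x\<^sup>2 / 2) ^ n /\<^sub>R fact n) sums exp (x\<^sup>2 / 2)" by (rule exp_converges)
  have le: "?f (2 * n) \<le> (x\<^sup>2 / 2) ^ n /\<^sub>R fact n" for n
  proof -
    have "?f (2 * n) = (x\<^sup>2) ^ n / fact (2 * n)" by (simp add: power_mult divide_inverse del: power_even_eq)
    also have "\<dots> \<le> (x\<^sup>2) ^ n / (2 ^ n * fact n)"
      by (rule divide_left_mono[OF two_power_fact_le_fact_double]) auto
    also have "\<dots> = (x\<^sup>2 / 2) ^ n /\<^sub>R fact n" by (simp add: power_divide field_simps)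
    finally show ?thesis .
  qed
  show ?thesis by (rule sums_le[OF le cosh exp])
qed

text \<open>
  Hoeffding's inequality for uniformly random signs, stated as a count: Chernoff's method
  with the exponent \<open>t / v\<close>.
\<close>

lemma card_sign_sums_ge_le:
  assumes v: "v > 0" "(\<Sum>i<n. (c i)\<^sup>2) \<le> v" and t: "t \<ge> 0"
  shows "real (card {\<sigma> \<in> signs n. t \<le> (\<Sum>i<n. \<sigma> i * c i)}) \<le> 2 ^ n * exp (- t\<^sup>2 / (2 * v))"
proof -
  define l where "l = t / v"
  define A where "A = {\<sigma> \<in> signs n. t \<le> (\<Sum>i<n. \<sigma> i * c i)}"
  have l: "l \<ge> 0" using v t by (simp add: l_def)
  have "real (card A) * exp (l * t) = (\<Sum>\<sigma>\<in>A. exp (l * t))" by simp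
  also have "\<dots> \<le> (\<Sum>\<sigma>\<in>A. exp (l * (\<Sum>i<n. \<sigma> i * c i)))"
    using l by (intro sum_mono) (auto simp: A_def intro: mult_left_mono)
  also have "\<dots> \<le> (\<Sum>\<sigma>\<in>signs n. exp (l * (\<Sum>i<n. \<sigma> i * c i)))"
    by (intro sum_mono2) (auto simp: A_def)
  also have "\<dots> = (\<Sum>\<sigma>\<in>signs n. \<Prod>i<n. exp (l * (\<sigma> i * c i)))"
    by (simp add: sum_distrib_left exp_sum)
  also have "\<dots> = (\<Prod>i<n. \<Sum>s\<in>{-1, 1}. exp (l * (s * c i)))"
    unfolding signs_def by (rule prod_sum_PiE[symmetric]) auto
  also have "\<dots> = (\<Prod>i<n. 2 * cosh (l * c i))"
    by (intro prod.cong) (auto simp: cosh_def)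
  also have "\<dots> \<le> (\<Prod>i<n. 2 * exp ((l * c i)\<^sup>2 / 2))"
    by (intro prod_mono) (auto intro!: mult_left_mono cosh_le_exp_half_square)
  also have "\<dots> = 2 ^ n * exp (l\<^sup>2 / 2 * (\<Sum>i<n. (c i)\<^sup>2))"
    by (simp add: prod.distrib exp_sum[symmetric] sum_distrib_left power_mult_distrib mult_ac
        del: exp_sum)
  also have "\<dots> \<le> 2 ^ n * exp (l\<^sup>2 / 2 * v)"
    using v by (intro mult_left_mono) (auto intro!: mult_left_mono)
  finally have "real (card A) * exp (l * t) \<le> 2 ^ n * exp (l\<^sup>2 / 2 * v)" .
  then have "real (card A) \<le> 2 ^ n * (exp (l\<^sup>2 / 2 * v) / exp (l * t))"
    by (simp add: field_simps)
  also have "exp (l\<^sup>2 / 2 * v) / exp (l * t) = exp (l\<^sup>2 / 2 * v - l * t)" by (simp add: exp_diff)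
  also have "l\<^sup>2 / 2 * v - l * t = - t\<^sup>2 / (2 * v)"
    using v by (simp add: l_def power2_eq_square field_simps)
  finally show ?thesis by (simp add: A_def)
qed

lemma card_abs_sign_sums_ge_le:
  assumes v: "v > 0" "(\<Sum>i<n. (c i)\<^sup>2) \<le> v" and t: "t \<ge> 0"
  shows "real (card {\<sigma> \<in> signs n. t \<le> \<bar>\<Sum>i<n. \<sigma> i * c i\<bar>}) \<le> 2 ^ n * (2 * exp (- t\<^sup>2 / (2 * v)))"
proof -
  have "{\<sigma> \<in> signs n. t \<le> \<bar>\<Sum>i<n. \<sigma> i * c i\<bar>}
      \<subseteq> {\<sigma> \<in> signs n. t \<le> (\<Sum>i<n. \<sigma> i * c i)} \<union> {\<sigma> \<in> signs n. t \<le> (\<Sum>i<n. \<sigma> i * - c i)}"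
    by (auto simp: sum_negf)
  then have "card {\<sigma> \<in> signs n. t \<le> \<bar>\<Sum>i<n. \<sigma> i * c i\<bar>}
      \<le> card ({\<sigma> \<in> signs n. t \<le> (\<Sum>i<n. \<sigma> i * c i)} \<union> {\<sigma> \<in> signs n. t \<le> (\<Sum>i<n. \<sigma> i * - c i)})"
    by (intro card_mono) auto
  also have "\<dots> \<le> card {\<sigma> \<in> signs n. t \<le> (\<Sum>i<n. \<sigma> i * c i)}
      + card {\<sigma> \<in> signs n. t \<le> (\<Sum>i<n. \<sigma> i * - c i)}" by (rule card_Un_le)
  finally have "real (card {\<sigma> \<in> signs n. t \<le> \<bar>\<Sum>i<n. \<sigma> i * c i\<bar>}) \<le>
    real (card {\<sigma> \<in> signs n. t \<le> (\<Sum>i<n. \<sigma> i * c i)})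
      + real (card {\<sigma> \<in> signs n. t \<le> (\<Sum>i<n. \<sigma> i * - c i)})" by linarith
  with card_sign_sums_ge_le[OF v t] card_sign_sums_ge_le[where c = "\<lambda>i. - c i" and n = n, OF v(1) _ t] v(2)
  show ?thesis by simp
qed

lemma sum_diff_eq_sum_indicators:
  fixes \<sigma> :: "nat \<Rightarrow> real"
  assumes "A \<subseteq> {..<n}" "B \<subseteq> {..<n}"
  shows "sum \<sigma> A - sum \<sigma> B = (\<Sum>i<n. \<sigma> i * (of_bool (i \<in> A) - of_bool (i \<in> B)))"
proof -
  have ind: "sum \<sigma> A = (\<Sum>i<n. \<sigma> i * of_bool (i \<in> A))" if "A \<subseteq> {..<n}" for A
    using that by (intro sum.mono_neutral_cong_left) auto
  show ?thesis
    unfolding right_diff_distrib sum_subtractf ind[OF assms(1)] ind[OF assms(2)] ..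
qed

lemma card_sign_difference_ge_le:
  assumes AB: "A \<subseteq> {..<n}" "B \<subseteq> {..<n}" and v: "v > 0" "real (card (sym_diff A B)) \<le> v"
    and t: "t \<ge> 0"
  shows "real (card {\<sigma> \<in> signs n. t \<le> \<bar>sum \<sigma> A - sum \<sigma> B\<bar>}) \<le> 2 ^ n * (2 * exp (- t\<^sup>2 / (2 * v)))"
proof -
  have "(\<Sum>i<n. (of_bool (i \<in> A) - of_bool (i \<in> B) :: real)\<^sup>2) = (\<Sum>i\<in>sym_diff A B. 1)"
    using AB by (intro sum.mono_neutral_cong_right) auto
  then have "(\<Sum>i<n. (of_bool (i \<in> A) - of_bool (i \<in> B) :: real)\<^sup>2) \<le> v" using v by simp
  from card_abs_sign_sums_ge_le[OF v(1) this t] show ?thesis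
    by (simp add: sum_diff_eq_sum_indicators[OF AB])
qed

text \<open>
  A maximal separated subfamily is a net.
\<close>

lemma exists_separated_net:
  fixes r :: real and n :: nat
  assumes T: "T \<subseteq> Pow {..<n}" and r: "r > 0"
  shows "\<exists>P\<subseteq>T. (\<forall>A\<in>P. \<forall>B\<in>P. A \<noteq> B \<longrightarrow> r \<le> real (card (sym_diff A B)))
    \<and> (\<forall>A\<in>T. \<exists>B\<in>P. real (card (sym_diff A B)) < r)"
proof -
  define Ps where "Ps = {P. P \<subseteq> T \<and> (\<forall>A\<in>P. \<forall>B\<in>P. A \<noteq> B \<longrightarrow> r \<le> real (card (sym_diff A B)))}"
  have finT: "finite T" using T by (rule finite_subset) simp
  have "finite Ps" by (rule finite_subset[of _ "Pow T"]) (auto simp: Ps_def finT)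
  moreover have "Ps \<noteq> {}" by (auto simp: Ps_def)
  ultimately have "\<exists>P\<in>Ps. \<forall>P'\<in>Ps. P \<subseteq> P' \<longrightarrow> P = P'" by (rule finite_has_maximal)
  then obtain P where P: "P \<in> Ps" "\<And>P'. P' \<in> Ps \<Longrightarrow> P \<subseteq> P' \<Longrightarrow> P = P'"
    by blast
  have cover: "\<forall>A\<in>T. \<exists>B\<in>P. real (card (sym_diff A B)) < r"
  proof (rule ballI, rule ccontr)
    fix A assume A: "A \<in> T" and far: "\<not> (\<exists>B\<in>P. real (card (sym_diff A B)) < r)"
    then have "A \<notin> P" using r by force
    have "insert A P \<in> Ps"
      using P(1) A far unfolding Ps_def by (auto simp: not_less Un_commute)
    with P(2)[of "insert A P"] \<open>A \<notin> P\<close> show False by blast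
  qed
  have sep: "P \<subseteq> T" "\<forall>A\<in>P. \<forall>B\<in>P. A \<noteq> B \<longrightarrow> r \<le> real (card (sym_diff A B))"
    using P(1) by (simp_all add: Ps_def)
  show ?thesis by (rule exI[of _ P], rule conjI[OF sep(1) conjI[OF sep(2) cover]])
qed

lemma card_Union_le_mult:
  fixes b :: real
  assumes "finite I" "\<And>i. i \<in> I \<Longrightarrow> real (card (B i)) \<le> b" "real (card I) \<le> c" "b \<ge> 0"
  shows "real (card (\<Union>i\<in>I. B i)) \<le> c * b"
proof -
  have "real (card (\<Union>i\<in>I. B i)) \<le> (\<Sum>i\<in>I. real (card (B i)))"
    using card_UN_le[OF assms(1), of B] by (simp flip: of_nat_sum)
  also have "\<dots> \<le> real (card I) * b" using sum_mono[of I "\<lambda>i. real (card (B i))" "\<lambda>_. b"] assms(2) by simp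
  also have "\<dots> \<le> c * b" using assms by (intro mult_right_mono) auto
  finally show ?thesis .
qed

text \<open>
  In the chaining argument, the left side bounds the logarithm of the number of links at level \<open>k\<close> plus the
  exponent of the tail bound for one link. The cardinality grows linearly in \<open>k\<close>, the exponent
  geometrically, and Bernoulli's inequality turns \<open>8 * (9/8) ^ k\<close> into at least \<open>k + 1\<close>.
\<close>

lemma level_exponent_le:
  fixes D x :: real
  assumes "D \<ge> 1" "x > 0"
  shows "2 * D * (2 * real k + 7) + 2 - 8 * (9/8) ^ k * (18 * D + x) \<le> real (Suc k) * - x"
proof -
  define q :: real where "q = (9/8) ^ k"
  have "1 + real k * (1/8) \<le> (1 + 1/8) ^ k" by (rule Bernoulli_inequality) simp
  also have "(1 + 1/8 :: real) = 9/8" by simp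
  finally have "real (Suc k) \<le> 8 * q" by (simp add: q_def)
  then have "real (Suc k) * (18 * D + x) \<le> 8 * q * (18 * D + x)"
    using assms by (intro mult_right_mono) auto
  moreover have "2 * D * (2 * real k + 7) + 2 \<le> real (Suc k) * (18 * D)"
  proof -
    have "0 \<le> D * real k" using assms by simp
    moreover have "real (Suc k) * (18 * D) - (2 * D * (2 * real k + 7) + 2) = 14 * (D * real k) + (4 * D - 2)"
      by (simp add: algebra_simps)
    ultimately show ?thesis using assms(1) by linarith
  qed
  moreover have "real (Suc k) * (18 * D + x) = real (Suc k) * (18 * D) + real (Suc k) * x"
    by (rule distrib_left)
  ultimately show ?thesis unfolding q_def[symmetric] by linarith
qed

lemma sum_powers_le_twice:
  fixes q :: real
  assumes "0 \<le> q" "q \<le> 1/2"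
  shows "(\<Sum>k<K. q ^ Suc k) \<le> 2 * q"
proof -
  have "(\<Sum>k<K. q ^ Suc k) + 2 * q ^ Suc K \<le> 2 * q"
  proof (induction K)
    case (Suc K)
    have "q ^ Suc (Suc K) \<le> 1/2 * q ^ Suc K"
      unfolding power_Suc[of q "Suc K"] using assms by (intro mult_right_mono) auto
    with Suc.IH show ?case unfolding sum.lessThan_Suc by linarith
  qed simp
  moreover have "0 \<le> q ^ Suc K" using assms by simp
  ultimately show ?thesis by linarith
qed

text \<open>
  At level \<open>k\<close> each trace \<open>A\<close> is replaced by a point \<open>\<pi> k A\<close> of a net of mesh \<open>(1/2) ^ k * n\<close>, and the signed
  sum over \<open>A\<close> is telescoped along \<open>\<pi> 0 A, \<pi> 1 A, \<dots>, \<pi> n A = A\<close>. A link at level \<open>k\<close> has variance at most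
  \<open>2 * (1/2) ^ k * n\<close>, and it is allowed to be as large as \<open>(3/4) ^ k * R\<close>. These thresholds sum to
  at most \<open>4 * R\<close>, while their squares shrink by the factor \<open>9/16\<close> per level, more slowly than the
  variances. The surplus \<open>(9/8) ^ k\<close> in the exponent pays for the union bound over all links.
\<close>

lemma chaining_tail_bound:
  fixes x :: real
  assumes n: "n > 0" and D: "D > 0" and x: "x \<ge> ln 2"
    and T: "T \<subseteq> Pow {..<n}" "trace_growth {..<n} D T"
  defines "W \<equiv> 18 * real D + x"
  defines "R \<equiv> sqrt (32 * real n * W)"
  shows "real (card {\<sigma> \<in> signs n. \<exists>A\<in>T. 5 * R < \<bar>sum \<sigma> A\<bar>}) \<le> 2 ^ n * (6 * exp (- x))"
proof -
  have x0: "x > 0" using x ln_gt_zero[of "2::real"] by linarith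
  have W: "W > 0" using x0 by (simp add: W_def add_nonneg_pos)
  have R2: "R\<^sup>2 = 32 * real n * W" using W by (simp add: R_def)
  have R: "R \<ge> 0" using W by (simp add: R_def)
  have finT: "finite T" using T(1) by (rule finite_subset) simp
  define r where "r k = (1/2) ^ k * real n" for k :: nat
  have r: "r k > 0" for k using n by (simp add: r_def)
  have "\<forall>k. \<exists>P\<subseteq>T. (\<forall>A\<in>P. \<forall>B\<in>P. A \<noteq> B \<longrightarrow> r k \<le> real (card (sym_diff A B)))
    \<and> (\<forall>A\<in>T. \<exists>B\<in>P. real (card (sym_diff A B)) < r k)"
    using exists_separated_net[OF T(1) r] by blast
  then obtain N where N: "\<And>k. N k \<subseteq> T"
      "\<And>k A B. A \<in> N k \<Longrightarrow> B \<in> N k \<Longrightarrow> A \<noteq> B \<Longrightarrow> r k \<le> real (card (sym_diff A B))"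
      "\<And>k A. A \<in> T \<Longrightarrow> \<exists>B\<in>N k. real (card (sym_diff A B)) < r k"
    by metis
  define \<pi> where "\<pi> k A = (SOME B. B \<in> N k \<and> real (card (sym_diff A B)) < r k)" for k A
  have "\<pi> k A \<in> N k \<and> real (card (sym_diff A (\<pi> k A))) < r k" if "A \<in> T" for k A
    unfolding \<pi>_def by (rule someI_ex) (use N(3)[OF that] in blast)
  then have \<pi>: "\<And>k A. A \<in> T \<Longrightarrow> \<pi> k A \<in> N k"
      "\<And>k A. A \<in> T \<Longrightarrow> real (card (sym_diff A (\<pi> k A))) < r k"
    by blast+
  have finN: "finite (N k)" for k using N(1) finT finite_subset by blast
  have cardN: "real (card (N k)) \<le> exp (2 * real D * (real k + 3) + 1)" for k
  proof -
    have "real (card (N k)) \<le> exp (2 * real D * ln (8 / (1/2) ^ k) + 1)"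
      using N(2)[of _ k] by (intro card_separated_le[OF n D _ _ T N(1)]) (auto simp: r_def power_le_one)
    also have "ln (8 / (1/2) ^ k :: real) = ln (2 ^ (k + 3))"
      by (simp add: power_add power_one_over)
    also have "\<dots> = (real k + 3) * ln 2" by (simp add: ln_realpow)
    also have "exp (2 * real D * ((real k + 3) * ln 2) + 1) \<le> exp (2 * real D * ((real k + 3) * 1) + 1)"
      using ln_2_less_1 by (intro exp_le_cancel_iff[THEN iffD2] add_mono mult_left_mono) auto
    finally show ?thesis by simp
  qed
  \<comment> \<open>Failure events: for the starting points of the chains, and for the links at level \<open>k\<close>.\<close>
  define B0 where "B0 = (\<Union>A\<in>N 0. {\<sigma> \<in> signs n. R \<le> \<bar>sum \<sigma> A - sum \<sigma> {}\<bar>})"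
  define E where "E k = {(A, B) \<in> N (Suc k) \<times> N k. real (card (sym_diff A B)) \<le> 2 * r k}" for k
  define Bk where "Bk k = (\<Union>p\<in>E k. {\<sigma> \<in> signs n. (3/4) ^ k * R \<le> \<bar>sum \<sigma> (fst p) - sum \<sigma> (snd p)\<bar>})" for k
  have cardB0: "real (card B0) \<le> 2 ^ n * (2 * exp (- x))"
  proof -
    have "real (card B0) \<le> exp (2 * real D * (real 0 + 3) + 1) * (2 ^ n * (2 * exp (- R\<^sup>2 / (2 * real n))))"
      unfolding B0_def
    proof (rule card_Union_le_mult[OF finN _ cardN])
      fix A assume "A \<in> N 0"
      then have A: "A \<subseteq> {..<n}" using N(1) T(1) by blast
      then show "real (card {\<sigma> \<in> signs n. R \<le> \<bar>sum \<sigma> A - sum \<sigma> {}\<bar>})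
          \<le> 2 ^ n * (2 * exp (- R\<^sup>2 / (2 * real n)))"
        using n R card_mono[OF _ A] by (intro card_sign_difference_ge_le) auto
    qed simp
    also have "\<dots> = 2 ^ n * 2 * exp (6 * real D + 1 - 16 * W)"
      using n by (simp add: R2 exp_add exp_diff exp_minus field_simps)
    also have "\<dots> \<le> 2 ^ n * 2 * exp (- x)"
      using D x0 by (intro mult_left_mono exp_le_cancel_iff[THEN iffD2]) (auto simp: W_def)
    finally show ?thesis by simp
  qed
  have cardBk: "real (card (Bk k)) \<le> 2 ^ n * (2 * exp (- x) ^ Suc k)" for k
  proof -
    define b where "b = 2 ^ n * (2 * exp (- ((3/4) ^ k * R)\<^sup>2 / (2 * (2 * r k))))"
    have finE: "finite (E k)"
      by (rule finite_subset[of _ "N (Suc k) \<times> N k"]) (auto simp: E_def finN)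
    have "card (E k) \<le> card (N (Suc k) \<times> N k)"
      by (rule card_mono) (auto simp: E_def finN)
    then have "real (card (E k)) \<le> real (card (N (Suc k))) * real (card (N k))"
      by (simp add: card_cartesian_product flip: of_nat_mult)
    also have "\<dots> \<le> exp (2 * real D * (real (Suc k) + 3) + 1) * exp (2 * real D * (real k + 3) + 1)"
      by (intro mult_mono cardN) auto
    also have "\<dots> = exp (2 * real D * (2 * real k + 7) + 2)"
      by (simp add: algebra_simps flip: exp_add)
    finally have cE: "real (card (E k)) \<le> exp (2 * real D * (2 * real k + 7) + 2)" .
    have "real (card (Bk k)) \<le> exp (2 * real D * (2 * real k + 7) + 2) * b"
      unfolding Bk_def
    proof (rule card_Union_le_mult[OF finE _ cE])
      fix p assume "p \<in> E k"
      then have "fst p \<in> N (Suc k)" "snd p \<in> N k"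
        and p3: "real (card (sym_diff (fst p) (snd p))) \<le> 2 * r k"
        by (auto simp: E_def)
      with N(1) T(1) have p: "fst p \<subseteq> {..<n}" "snd p \<subseteq> {..<n}" by blast+
      then show "real (card {\<sigma> \<in> signs n. (3/4) ^ k * R \<le> \<bar>sum \<sigma> (fst p) - sum \<sigma> (snd p)\<bar>}) \<le> b"
        unfolding b_def using R r[of k] by (intro card_sign_difference_ge_le p p3) auto
    qed (simp add: b_def)
    also have "b = 2 ^ n * (2 * exp (- (8 * (9/8) ^ k * W)))"
    proof -
      have "((3/4::real) ^ k)\<^sup>2 = (9/8) ^ k * (1/2) ^ k"
        unfolding power2_eq_square power_mult_distrib[symmetric] by simp
      then have "((3/4) ^ k * R)\<^sup>2 = (9/8) ^ k * (1/2) ^ k * (32 * real n * W)"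
        by (simp only: power_mult_distrib R2)
      also have "\<dots> = 8 * (9/8) ^ k * W * (2 * (2 * r k))"
      proof -
        have "a * b * (32 * c * w) = 8 * a * w * (2 * (2 * (b * c)))" for a b c w :: real
          by simp
        then show ?thesis unfolding r_def .
      qed
      finally show ?thesis using r[of k] by (simp add: b_def)
    qed
    also have "exp (2 * real D * (2 * real k + 7) + 2) * (2 ^ n * (2 * exp (- (8 * (9/8) ^ k * W))))
       = 2 ^ n * (2 * exp (2 * real D * (2 * real k + 7) + 2 - 8 * (9/8) ^ k * W))"
    proof -
      have "exp u * (2 ^ n * (2 * exp (- v))) = 2 ^ n * (2 * exp (u - v))" for u v :: real
        by (simp add: exp_diff exp_minus divide_inverse mult_ac)
      then show ?thesis .
    qed
    also have "\<dots> \<le> 2 ^ n * (2 * exp (real (Suc k) * - x))"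
      using level_exponent_le[of "real D" x k] D x0 by (simp add: W_def)
    also have "exp (real (Suc k) * - x) = exp (- x) ^ Suc k" by (rule exp_of_nat_mult)
    finally show ?thesis .
  qed
  have geo: "(\<Sum>k<K. exp (- x) ^ Suc k) \<le> 2 * exp (- x)" for K
  proof (rule sum_powers_le_twice)
    have "exp (ln 2) \<le> exp x" by (simp only: exp_le_cancel_iff x)
    then show "exp (- x) \<le> 1/2" by (simp add: exp_minus inverse_eq_divide)
  qed simp
  have sub: "{\<sigma> \<in> signs n. \<exists>A\<in>T. 5 * R < \<bar>sum \<sigma> A\<bar>} \<subseteq> B0 \<union> (\<Union>k<n. Bk k)"
  proof (rule subsetI, rule ccontr)
    fix \<sigma> assume \<sigma>: "\<sigma> \<in> {\<sigma> \<in> signs n. \<exists>A\<in>T. 5 * R < \<bar>sum \<sigma> A\<bar>}" "\<sigma> \<notin> B0 \<union> (\<Union>k<n. Bk k)"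
    then obtain A where A: "A \<in> T" "5 * R < \<bar>sum \<sigma> A\<bar>" by blast
    define s where "s k = sum \<sigma> (\<pi> k A)" for k
    have finA: "finite A" if "A \<in> T" for A
      using that T(1) finite_subset[of A "{..<n}"] by auto
    have finpi: "finite (\<pi> k A)" for k
      using finA \<pi>(1)[OF A(1)] N(1) by blast
    have s0: "\<bar>s 0\<bar> \<le> R" 
      using \<sigma> \<pi>(1)[OF A(1), of 0] unfolding B0_def s_def
      by (auto simp: not_le intro: less_imp_le)
    have sk: "\<bar>s (Suc k) - s k\<bar> \<le> (3/4) ^ k * R" if "k < n" for k
    proof -
      have fin: "finite A" "finite (\<pi> k A)" "finite (\<pi> (Suc k) A)"
        using finA[OF A(1)] finpi by blast+
      have "sym_diff (\<pi> (Suc k) A) (\<pi> k A) \<subseteq> sym_diff A (\<pi> (Suc k) A) \<union> sym_diff A (\<pi> k A)" by blast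
      then have "card (sym_diff (\<pi> (Suc k) A) (\<pi> k A))
          \<le> card (sym_diff A (\<pi> (Suc k) A) \<union> sym_diff A (\<pi> k A))"
        using fin by (intro card_mono) auto
      also have "\<dots> \<le> card (sym_diff A (\<pi> (Suc k) A)) + card (sym_diff A (\<pi> k A))" by (rule card_Un_le)
      finally have "real (card (sym_diff (\<pi> (Suc k) A) (\<pi> k A))) \<le> r (Suc k) + r k"
        using \<pi>(2)[OF A(1), of k] \<pi>(2)[OF A(1), of "Suc k"] by linarith
      also have "\<dots> \<le> 2 * r k" by (simp add: r_def)
      finally have "(\<pi> (Suc k) A, \<pi> k A) \<in> E k" using \<pi>(1)[OF A(1)] by (simp add: E_def)
      moreover have "\<sigma> \<notin> Bk k" using \<sigma>(2) that by blast
      ultimately have "\<not> (3/4) ^ k * R \<le> \<bar>sum \<sigma> (\<pi> (Suc k) A) - sum \<sigma> (\<pi> k A)\<bar>"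
        using \<sigma>(1) unfolding Bk_def by auto
      then show ?thesis by (simp add: s_def)
    qed
    have "(\<Sum>k<m. (3/4::real) ^ k) + 4 * (3/4) ^ m \<le> 4" for m
      by (induction m) auto
    from this[of n] have g: "(\<Sum>k<n. (3/4::real) ^ k) \<le> 4"
      by (rule order_trans[rotated]) simp
    have "\<pi> n A = A"
    proof -
      \<comment> \<open>At level \<open>n\<close> the mesh is at most one, so the symmetric difference is empty.\<close>
      have "real n \<le> 2 ^ n" using of_nat_less_two_power[of n, where 'a = real] by simp
      then have "r n \<le> 1" by (simp add: r_def field_simps)
      with \<pi>(2)[OF A(1), of n] have "card (sym_diff A (\<pi> n A)) = 0" by linarith
      moreover have "finite (sym_diff A (\<pi> n A))"
        using finA[OF A(1)] finpi by blast
      ultimately show ?thesis by auto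
    qed
    then have "sum \<sigma> A = s n" by (simp add: s_def)
    also have "s n = s 0 + (\<Sum>k<n. s (Suc k) - s k)"
      unfolding sum_lessThan_telescope by simp
    finally have "\<bar>sum \<sigma> A\<bar> \<le> \<bar>s 0\<bar> + \<bar>\<Sum>k<n. s (Suc k) - s k\<bar>"
      by (simp only: abs_triangle_ineq)
    also have "\<dots> \<le> \<bar>s 0\<bar> + (\<Sum>k<n. \<bar>s (Suc k) - s k\<bar>)"
      by (intro add_left_mono sum_abs)
    also have "\<dots> \<le> R + (\<Sum>k<n. (3/4) ^ k * R)"
      using s0 sk by (intro add_mono sum_mono) auto
    also have "\<dots> = R + (\<Sum>k<n. (3/4) ^ k) * R" by (simp only: sum_distrib_right)
    also have "\<dots> \<le> R + 4 * R" by (intro add_left_mono mult_right_mono g R)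
    finally show False using A(2) by simp
  qed
  have "finite (B0 \<union> (\<Union>k<n. Bk k))"
    by (rule finite_subset[of _ "signs n"]) (auto simp: B0_def Bk_def)
  then have "card {\<sigma> \<in> signs n. \<exists>A\<in>T. 5 * R < \<bar>sum \<sigma> A\<bar>} \<le> card (B0 \<union> (\<Union>k<n. Bk k))"
    using sub by (intro card_mono)
  also have "\<dots> \<le> card B0 + card (\<Union>k<n. Bk k)" by (rule card_Un_le)
  also have "\<dots> \<le> card B0 + (\<Sum>k<n. card (Bk k))" by (intro add_left_mono card_UN_le) simp
  finally have "real (card {\<sigma> \<in> signs n. \<exists>A\<in>T. 5 * R < \<bar>sum \<sigma> A\<bar>})
      \<le> real (card B0) + (\<Sum>k<n. real (card (Bk k)))"
    by (simp flip: of_nat_sum of_nat_add)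
  also have "\<dots> \<le> 2 ^ n * (2 * exp (- x)) + (\<Sum>k<n. 2 ^ n * (2 * exp (- x) ^ Suc k))"
    by (intro add_mono cardB0 sum_mono cardBk)
  also have "\<dots> = 2 ^ n * (2 * exp (- x)) + 2 ^ n * 2 * (\<Sum>k<n. exp (- x) ^ Suc k)"
    by (simp only: sum_distrib_left mult.assoc)
  also have "\<dots> \<le> 2 ^ n * (2 * exp (- x)) + 2 ^ n * 2 * (2 * exp (- x))"
    by (intro add_left_mono mult_left_mono geo) auto
  finally show ?thesis by (simp add: mult_ac)
qed

section \<open>Symmetrization\<close>

text \<open>
  The signed sums only depend on the traces of \<open>F\<close> on the points, and traces of traces are traces.
\<close>

lemma card_rademacher_traces_le:
  fixes F :: "'a set set" and x :: real
  assumes n: "n > 0" and D: "D > 0" and x: "x \<ge> ln 2"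
    and F: "trace_growth \<Omega> D F" and z: "\<And>i. i < n \<Longrightarrow> z i \<in> \<Omega>"
  shows "real (card {\<sigma> \<in> signs n. \<exists>A\<in>F. 5 * sqrt (32 * real n * (18 * real D + x))
      < \<bar>\<Sum>i<n. \<sigma> i * indicator A (z i)\<bar>}) \<le> 2 ^ n * (6 * exp (- x))"
proof -
  define T where "T = traces F z n"
  have "trace_growth {..<n} D T"
    unfolding trace_growth_def
  proof (intro allI impI)
    fix m :: nat and g :: "nat \<Rightarrow> nat" and y :: real
    assume g: "\<forall>i<m. g i \<in> {..<n}" and y: "0 < y" "y \<le> 1"
    have "traces T g m = traces F (z \<circ> g) m"
      using g unfolding T_def traces_def image_image
      by (intro image_cong Collect_cong) auto
    then show "real (card (traces T g m)) \<le> (1 / y) ^ D * exp (2 * y * real m)"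
      using F g y z unfolding trace_growth_def by simp
  qed
  moreover have "T \<subseteq> Pow {..<n}" unfolding T_def by (rule traces_subset)
  ultimately have "real (card {\<sigma> \<in> signs n. \<exists>A\<in>T. 5 * sqrt (32 * real n * (18 * real D + x)) < \<bar>sum \<sigma> A\<bar>})
      \<le> 2 ^ n * (6 * exp (- x))"
    by (intro chaining_tail_bound n D x)
  moreover have "(\<Sum>i<n. \<sigma> i * indicator A (z i)) = sum \<sigma> {i. i < n \<and> z i \<in> A}" for A and \<sigma> :: "nat \<Rightarrow> real"
    by (rule sum.mono_neutral_cong_right) auto
  ultimately show ?thesis by (simp add: T_def traces_def)
qed

context prob_space
begin

lemma PiM_hoeffding_count:
  fixes c :: real
  assumes J: "finite J" "J \<noteq> {}" and A: "A \<in> events" and c: "c \<ge> 0"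
  shows "measure (PiM J (\<lambda>_. M)) {Y \<in> space (PiM J (\<lambda>_. M)).
      c \<le> \<bar>(\<Sum>j\<in>J. indicator A (Y j)) - real (card J) * prob A\<bar>}
    \<le> 2 * exp (- 2 * c\<^sup>2 / real (card J))"
proof -
  let ?P = "PiM J (\<lambda>_. M)"
  interpret P: prob_space ?P by (intro prob_space_PiM prob_space_axioms)
  have comp: "distr ?P M (\<lambda>Y. Y j) = M" if "j \<in> J" for j
    using that by (intro distr_PiM_component prob_space_axioms)
  have "distr ?P ?P (\<lambda>Y. \<lambda>j\<in>J. Y j) = distr ?P ?P (\<lambda>Y. Y)"
    by (rule distr_cong) (auto simp: space_PiM)
  also have "\<dots> = (\<Pi>\<^sub>M j\<in>J. distr ?P M (\<lambda>Y. Y j))"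
    by (simp add: distr_id comp cong: PiM_cong)
  finally have "P.indep_vars (\<lambda>_. M) (\<lambda>j Y. Y j) J"
    by (subst P.indep_vars_iff_distr_eq_PiM'[OF J(2)]) (auto intro: measurable_component_singleton)
  then have indep: "P.indep_vars (\<lambda>_. borel) (\<lambda>j Y. indicator A (Y j) :: real) J"
    by (rule P.indep_vars_compose2) (use A in auto)
  have ex: "P.expectation (\<lambda>Y. indicator A (Y j) :: real) = prob A" if "j \<in> J" for j
  proof -
    have "P.expectation (\<lambda>Y. indicator A (Y j) :: real) = integral\<^sup>L (distr ?P M (\<lambda>Y. Y j)) (indicator A)"
      using that A by (subst integral_distr) auto
    then show ?thesis using A by (simp add: comp[OF that])
  qed
  interpret H: Hoeffding_ineq ?P J "\<lambda>j Y. indicator A (Y j) :: real" "\<lambda>_. 0" "\<lambda>_. 1" "real (card J) * prob A"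
  proof unfold_locales
    show "real (card J) * prob A \<equiv> \<Sum>i\<in>J. P.expectation (\<lambda>Y. indicator A (Y i))"
      by (simp add: ex)
    show "P.indep_vars (\<lambda>_. borel) (\<lambda>j Y. indicator A (Y j) :: real) J" by (rule indep)
  qed (auto simp: J indicator_def)
  show ?thesis using H.Hoeffding_ineq_abs_ge[OF c] J by (simp add: card_gt_0_iff)
qed

text \<open>
  The double sample consists of the sample (indices below \<open>n\<close>) and the ghost sample (indices from
  \<open>n\<close> on). A sign pattern exchanges the two observations at the positions with sign \<open>-1\<close>; this
  permutes independent identically distributed coordinates.
\<close>

lemma PiM_swap_invariant:
  assumes \<sigma>: "\<sigma> \<in> signs n"
  defines "f \<equiv> \<lambda>i. if i < n then (if \<sigma> i = 1 then i else n + i) else (if \<sigma> (i - n) = 1 then i else i - n)"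
  shows "distr (PiM {..<2*n} (\<lambda>_. M)) (PiM {..<2*n} (\<lambda>_. M)) (\<lambda>\<omega>. \<lambda>i\<in>{..<2*n}. \<omega> (f i)) = PiM {..<2*n} (\<lambda>_. M)"
proof (rule distr_PiM_reindex)
  show "inj_on f {..<2*n}"
  proof (rule inj_on_inverseI)
    fix i assume "i \<in> {..<2*n}"
    then show "f (f i) = i" by (auto simp: f_def)
  qed
  show "f \<in> {..<2*n} \<rightarrow> {..<2*n}" by (auto simp: f_def)
qed (rule prob_space_axioms)

text \<open>
  Exchanging sample and ghost observations according to \<open>\<sigma>\<close> multiplies the \<open>i\<close>-th difference by \<open>\<sigma> i\<close> and does not
  change the probability. Averaging over all \<open>\<sigma>\<close> puts the randomness into the signs, where for each
  fixed double sample the chaining bound applies to both halves, with threshold \<open>5 * R\<close> each.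
\<close>

lemma ghost_deviation_tail:
  fixes x :: real
  assumes n: "n > 0" and D: "D > 0" and x: "x \<ge> ln 2"
    and F: "finite F" "F \<subseteq> events" "trace_growth (space M) D F"
  defines "R \<equiv> sqrt (32 * real n * (18 * real D + x))"
  shows "measure (PiM {..<2*n} (\<lambda>_. M)) {\<omega> \<in> space (PiM {..<2*n} (\<lambda>_. M)).
      \<exists>A\<in>F. 10 * R < \<bar>(\<Sum>i<n. indicator A (\<omega> i)) - (\<Sum>i<n. indicator A (\<omega> (n + i)))\<bar>} \<le> 12 * exp (- x)"
proof -
  let ?P = "PiM {..<2*n} (\<lambda>_. M)"
  interpret P: prob_space ?P by (intro prob_space_PiM prob_space_axioms)
  have comp[measurable]: "(\<lambda>\<omega>. \<omega> i) \<in> measurable ?P M" if "i < 2 * n" for i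
    using that by (intro measurable_component_singleton) auto
  have ind: "(\<lambda>\<omega>. indicator A (\<omega> i) :: real) \<in> borel_measurable ?P" if "i < 2 * n" "A \<in> F" for i A
    using F(2) that by (intro measurable_compose[OF comp[OF that(1)]] borel_measurable_indicator) auto
  define V where "V \<sigma> = {\<omega> \<in> space ?P. \<exists>A\<in>F. 10 * R <
      \<bar>\<Sum>i<n. \<sigma> i * (indicator A (\<omega> i) - indicator A (\<omega> (n + i)))\<bar>}" for \<sigma> :: "nat \<Rightarrow> real"
  have V_sets: "V \<sigma> \<in> sets ?P" for \<sigma>
  proof -
    have "V \<sigma> = (\<Union>A\<in>F. {\<omega> \<in> space ?P. 10 * R <
      \<bar>\<Sum>i<n. \<sigma> i * (indicator A (\<omega> i) - indicator A (\<omega> (n + i)))\<bar>})"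
      by (auto simp: V_def)
    also have "\<dots> \<in> sets ?P"
    proof (rule sets.finite_UN[OF F(1)])
      fix A assume A: "A \<in> F"
      have "(\<lambda>\<omega>. \<bar>\<Sum>i<n. \<sigma> i * (indicator A (\<omega> i) - indicator A (\<omega> (n + i)))\<bar>) \<in> borel_measurable ?P"
        using ind[OF _ A] by (intro borel_measurable_abs borel_measurable_sum borel_measurable_times borel_measurable_diff) auto
      then show "{\<omega> \<in> space ?P. 10 * R < \<bar>\<Sum>i<n. \<sigma> i * (indicator A (\<omega> i) - indicator A (\<omega> (n + i)))\<bar>} \<in> sets ?P"
        by measurable
    qed
    finally show ?thesis .
  qed
  have inv: "P.prob (V \<sigma>) = P.prob (V (\<lambda>_. 1))" if \<sigma>: "\<sigma> \<in> signs n" for \<sigma>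
  proof -
    define f where "f = (\<lambda>i. if i < n then (if \<sigma> i = 1 then i else n + i) else (if \<sigma> (i - n) = 1 then i else i - n))"
    define g where "g = (\<lambda>\<omega>::nat\<Rightarrow>'a. \<lambda>i\<in>{..<2*n}. \<omega> (f i))"
    have d: "distr ?P ?P g = ?P"
      using PiM_swap_invariant[OF \<sigma>] unfolding f_def g_def .
    have g[measurable]: "g \<in> measurable ?P ?P"
      unfolding g_def by (rule measurable_restrict) (auto intro!: comp simp: f_def)
    have eq: "(\<Sum>i<n. 1 * (indicator A (g \<omega> i) - indicator A (g \<omega> (n + i)))) =
        (\<Sum>i<n. \<sigma> i * (indicator A (\<omega> i) - indicator A (\<omega> (n + i))) :: real)" for A \<omega>
    proof (rule sum.cong[OF refl])
      fix i assume i: "i \<in> {..<n}"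
      then have "\<sigma> i = 1 \<or> \<sigma> i = -1" using \<sigma> by (auto simp: signs_def PiE_iff)
      then show "1 * (indicator A (g \<omega> i) - indicator A (g \<omega> (n + i))) =
        (\<sigma> i * (indicator A (\<omega> i) - indicator A (\<omega> (n + i))) :: real)"
        using i by (auto simp: g_def f_def)
    qed
    have "P.prob (V (\<lambda>_. 1)) = measure (distr ?P ?P g) (V (\<lambda>_. 1))" by (simp only: d)
    also have "\<dots> = P.prob (g -` V (\<lambda>_. 1) \<inter> space ?P)"
      by (rule measure_distr[OF g V_sets])
    also have "g -` V (\<lambda>_. 1) \<inter> space ?P = V \<sigma>"
      using measurable_space[OF g] unfolding V_def vimage_def by (auto simp only: eq mem_Collect_eq Int_iff)
    finally show ?thesis by simp
  qed
  have count: "(\<Sum>\<sigma>\<in>signs n. indicator (V \<sigma>) \<omega>) \<le> 2 ^ n * (12 * exp (- x))" if \<omega>: "\<omega> \<in> space ?P" for \<omega>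
  proof -
    define B where "B z = {\<sigma> \<in> signs n. \<exists>A\<in>F. 5 * R < \<bar>\<Sum>i<n. \<sigma> i * indicator A (z i :: 'a)\<bar>}" for z
    have B: "real (card (B z)) \<le> 2 ^ n * (6 * exp (- x))" if "\<And>i. i < n \<Longrightarrow> z i \<in> space M" for z
      unfolding B_def R_def using card_rademacher_traces_le[OF n D x F(3) that] .
    have \<omega>i: "\<omega> i \<in> space M" if "i < 2 * n" for i
      using \<omega> that by (auto simp: space_PiM)
    have sub: "{\<sigma> \<in> signs n. \<omega> \<in> V \<sigma>} \<subseteq> B \<omega> \<union> B (\<lambda>i. \<omega> (n + i))"
    proof
      fix \<sigma> assume "\<sigma> \<in> {\<sigma> \<in> signs n. \<omega> \<in> V \<sigma>}"
      then obtain A where \<sigma>: "\<sigma> \<in> signs n" and A: "A \<in> F"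
        "10 * R < \<bar>\<Sum>i<n. \<sigma> i * (indicator A (\<omega> i) - indicator A (\<omega> (n + i)))\<bar>"
        by (auto simp: V_def)
      have "(\<Sum>i<n. \<sigma> i * (indicator A (\<omega> i) - indicator A (\<omega> (n + i)))) =
        (\<Sum>i<n. \<sigma> i * indicator A (\<omega> i)) - (\<Sum>i<n. \<sigma> i * indicator A (\<omega> (n + i)))"
        by (simp add: right_diff_distrib sum_subtractf)
      with A(2) have "5 * R < \<bar>\<Sum>i<n. \<sigma> i * indicator A (\<omega> i)\<bar>
          \<or> 5 * R < \<bar>\<Sum>i<n. \<sigma> i * indicator A (\<omega> (n + i))\<bar>" by linarith
      with \<sigma> A(1) show "\<sigma> \<in> B \<omega> \<union> B (\<lambda>i. \<omega> (n + i))" unfolding B_def by blast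
    qed
    have "(\<Sum>\<sigma>\<in>signs n. indicator (V \<sigma>) \<omega> :: real) = (\<Sum>\<sigma>\<in>{\<sigma> \<in> signs n. \<omega> \<in> V \<sigma>}. 1)"
      by (rule sum.mono_neutral_cong_right) auto
    also have "\<dots> = real (card {\<sigma> \<in> signs n. \<omega> \<in> V \<sigma>})" by simp
    also have "\<dots> \<le> real (card (B \<omega> \<union> B (\<lambda>i. \<omega> (n + i))))"
      using sub by (simp add: B_def card_mono)
    also have "\<dots> \<le> real (card (B \<omega>)) + real (card (B (\<lambda>i. \<omega> (n + i))))"
      using card_Un_le[of "B \<omega>" "B (\<lambda>i. \<omega> (n + i))"] by linarith
    also have "\<dots> \<le> 2 ^ n * (6 * exp (- x)) + 2 ^ n * (6 * exp (- x))"
      by (intro add_mono B \<omega>i) auto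
    finally show ?thesis by (simp add: mult_ac)
  qed
  have "2 ^ n * P.prob (V (\<lambda>_. 1)) = (\<Sum>\<sigma>\<in>signs n. P.prob (V \<sigma>))"
    using inv by (simp add: card_signs)
  also have "\<dots> = (\<Sum>\<sigma>\<in>signs n. P.expectation (indicator (V \<sigma>)))"
    using V_sets by simp
  also have "\<dots> = P.expectation (\<lambda>\<omega>. \<Sum>\<sigma>\<in>signs n. indicator (V \<sigma>) \<omega>)"
    using V_sets by (intro Bochner_Integration.integral_sum[symmetric]) (simp add: P.emeasure_eq_measure)
  also have "\<dots> \<le> P.expectation (\<lambda>_. 2 ^ n * (12 * exp (- x)))"
    using V_sets count by (intro integral_mono Bochner_Integration.integrable_sum) (simp_all add: P.emeasure_eq_measure)
  also have "\<dots> = 2 ^ n * (12 * exp (- x))" by (simp add: P.prob_space)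
  finally have "P.prob (V (\<lambda>_. 1)) \<le> 12 * exp (- x)" by simp
  moreover have "V (\<lambda>_. 1) = {\<omega> \<in> space ?P. \<exists>A\<in>F. 10 * R <
      \<bar>(\<Sum>i<n. indicator A (\<omega> i)) - (\<Sum>i<n. indicator A (\<omega> (n + i)))\<bar>}"
    by (simp add: V_def sum_subtractf)
  ultimately show ?thesis by simp
qed

text \<open>
  If the sample deviates by more than \<open>20 * R\<close> on some \<open>A\<close>, then the ghost sample, being independent of it, stays
  within \<open>10 * R\<close> on this \<open>A\<close> with probability at least \<open>1/2\<close> by Hoeffding's inequality, and then the
  two samples differ by more than \<open>10 * R\<close>. This costs a factor two in the probability.
\<close>

lemma finite_class_deviation_tail:
  fixes x :: real
  assumes n: "n > 0" and D: "D > 0" and x: "x \<ge> ln 2"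
    and F: "finite F" "F \<subseteq> events" "trace_growth (space M) D F"
  defines "R \<equiv> sqrt (32 * real n * (18 * real D + x))"
  shows "measure (PiM {..<n} (\<lambda>_. M)) {X \<in> space (PiM {..<n} (\<lambda>_. M)).
      \<exists>A\<in>F. 20 * R < \<bar>(\<Sum>i<n. indicator A (X i)) - real n * prob A\<bar>} \<le> 24 * exp (- x)"
proof -
  let ?I = "{..<n}" and ?J = "{n..<2*n}"
  let ?PI = "PiM ?I (\<lambda>_. M)" and ?PJ = "PiM ?J (\<lambda>_. M)" and ?P = "PiM {..<2*n} (\<lambda>_. M)"
  interpret I: prob_space ?PI by (intro prob_space_PiM prob_space_axioms)
  interpret J: prob_space ?PJ by (intro prob_space_PiM prob_space_axioms)
  interpret P: prob_space ?P by (intro prob_space_PiM prob_space_axioms)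
  interpret product_sigma_finite "\<lambda>_::nat. M" ..
  have IJ: "?I \<inter> ?J = {}" "finite ?I" "finite ?J" and UN: "?I \<union> ?J = {..<2*n}" by auto
  have x0: "x > 0" using x ln_gt_zero[of "2::real"] by linarith
  have R: "R \<ge> 0" "R\<^sup>2 = 32 * real n * (18 * real D + x)" using x0 by (auto simp: R_def)
  define U where "U = {X \<in> space ?PI. \<exists>A\<in>F. 20 * R < \<bar>(\<Sum>i<n. indicator A (X i)) - real n * prob A\<bar>}"
  define V where "V = {\<omega> \<in> space ?P.
      \<exists>A\<in>F. 10 * R < \<bar>(\<Sum>i<n. indicator A (\<omega> i)) - (\<Sum>i<n. indicator A (\<omega> (n + i)))\<bar>}"
  have ind: "(\<lambda>\<omega>. indicator A (\<omega> i) :: real) \<in> borel_measurable (PiM K (\<lambda>_. M))"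
    if "i \<in> K" "A \<in> F" for i A and K :: "nat set"
    using F(2) that by (intro measurable_compose[OF measurable_component_singleton[OF that(1)]] borel_measurable_indicator) auto
  have U_sets: "U \<in> sets ?PI"
  proof -
    have "U = (\<Union>A\<in>F. {X \<in> space ?PI. 20 * R < \<bar>(\<Sum>i<n. indicator A (X i)) - real n * prob A\<bar>})"
      by (auto simp: U_def)
    also have "\<dots> \<in> sets ?PI"
    proof (rule sets.finite_UN[OF F(1)])
      fix A assume A: "A \<in> F"
      have "(\<lambda>X. \<bar>(\<Sum>i<n. indicator A (X i)) - real n * prob A\<bar>) \<in> borel_measurable ?PI"
        using ind[OF _ A] by (intro borel_measurable_abs borel_measurable_sum borel_measurable_diff) auto
      then show "{X \<in> space ?PI. 20 * R < \<bar>(\<Sum>i<n. indicator A (X i)) - real n * prob A\<bar>} \<in> sets ?PI"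
        by measurable
    qed
    finally show ?thesis .
  qed
  have V_sets: "V \<in> sets ?P"
  proof -
    have "V = (\<Union>A\<in>F. {\<omega> \<in> space ?P. 10 * R < \<bar>(\<Sum>i<n. indicator A (\<omega> i)) - (\<Sum>i<n. indicator A (\<omega> (n + i)))\<bar>})"
      by (auto simp: V_def)
    also have "\<dots> \<in> sets ?P"
    proof (rule sets.finite_UN[OF F(1)])
      fix A assume A: "A \<in> F"
      have "(\<lambda>\<omega>. \<bar>(\<Sum>i<n. indicator A (\<omega> i)) - (\<Sum>i<n. indicator A (\<omega> (n + i)))\<bar> :: real) \<in> borel_measurable ?P"
        using ind[OF _ A] by (intro borel_measurable_abs borel_measurable_sum borel_measurable_diff) auto
      then show "{\<omega> \<in> space ?P. 10 * R < \<bar>(\<Sum>i<n. indicator A (\<omega> i)) - (\<Sum>i<n. indicator A (\<omega> (n + i)))\<bar>} \<in> sets ?P"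
        by measurable
    qed
    finally show ?thesis .
  qed
  have slice: "ennreal (1/2) * indicator U X \<le> (\<integral>\<^sup>+Y. indicator V (merge ?I ?J (X, Y)) \<partial>?PJ)" if X: "X \<in> space ?PI" for X
  proof (cases "X \<in> U")
    case True
    then obtain A where A: "A \<in> F" "20 * R < \<bar>(\<Sum>i<n. indicator A (X i)) - real n * prob A\<bar>"
      by (auto simp: U_def)
    define B where "B = {Y \<in> space ?PJ. 10 * R \<le> \<bar>(\<Sum>j\<in>?J. indicator A (Y j)) - real (card ?J) * prob A\<bar>}"
    have B_sets: "B \<in> sets ?PJ"
    proof -
      have "(\<lambda>Y. \<bar>(\<Sum>j\<in>?J. indicator A (Y j)) - real (card ?J) * prob A\<bar>) \<in> borel_measurable ?PJ"
        using ind[OF _ A(1)] by (intro borel_measurable_abs borel_measurable_sum borel_measurable_diff) auto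
      then show ?thesis unfolding B_def by measurable
    qed
    have "J.prob B \<le> 2 * exp (- 2 * (10 * R)\<^sup>2 / real (card ?J))"
      unfolding B_def using F(2) A(1) n R by (intro PiM_hoeffding_count) auto
    also have "\<dots> = 2 * exp (- (6400 * (18 * real D + x)))"
      using n by (simp add: power_mult_distrib R(2))
    also have "\<dots> \<le> 2 * exp (- (2 * ln 2))"
    proof -
      have "2 * ln 2 \<le> 6400 * (18 * real D + x)" using x0 ln_2_less_1 D by auto
      then show ?thesis by simp
    qed
    also have "\<dots> = 1/2" by (simp add: exp_minus exp_double)
    finally have "J.prob B \<le> 1/2" .
    then have "1/2 \<le> J.prob (space ?PJ - B)" using B_sets by (simp add: J.prob_compl)
    then have "ennreal (1/2) \<le> emeasure ?PJ (space ?PJ - B)"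
      unfolding J.emeasure_eq_measure by (rule ennreal_leI)
    also have "\<dots> = (\<integral>\<^sup>+Y. indicator (space ?PJ - B) Y \<partial>?PJ)"
      using B_sets by simp
    also have "\<dots> \<le> (\<integral>\<^sup>+Y. indicator V (merge ?I ?J (X, Y)) \<partial>?PJ)"
    proof (rule nn_integral_mono)
      fix Y assume Y: "Y \<in> space ?PJ"
      show "indicator (space ?PJ - B) Y \<le> (indicator V (merge ?I ?J (X, Y)) :: ennreal)"
      proof (cases "Y \<in> B")
        case False
        let ?\<omega> = "merge ?I ?J (X, Y)"
        have "?\<omega> \<in> space (PiM (?I \<union> ?J) (\<lambda>_. M))"
          using measurable_space[OF measurable_merge, of "(X, Y)" ?I "\<lambda>_. M" ?J] X Y
          by (simp add: space_pair_measure)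
        then have sp: "?\<omega> \<in> space ?P" unfolding UN .
        have 1: "(\<Sum>i<n. indicator A (?\<omega> i) :: real) = (\<Sum>i<n. indicator A (X i))"
          by (intro sum.cong) (auto simp: merge_def)
        have 2: "(\<Sum>i<n. indicator A (?\<omega> (n + i)) :: real) = (\<Sum>j\<in>?J. indicator A (Y j))"
          by (rule sum.reindex_bij_witness[of _ "\<lambda>j. j - n" "\<lambda>i. n + i"]) (auto simp: merge_def)
        have "\<bar>(\<Sum>j\<in>?J. indicator A (Y j)) - real n * prob A\<bar> < 10 * R"
          using False Y by (simp add: B_def)
        with A(2) have "10 * R < \<bar>(\<Sum>i<n. indicator A (X i)) - (\<Sum>j\<in>?J. indicator A (Y j))\<bar>"
          by linarith
        then have "10 * R < \<bar>(\<Sum>i<n. indicator A (?\<omega> i)) - (\<Sum>i<n. indicator A (?\<omega> (n + i)))\<bar>"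
          unfolding 1 2 .
        then have "?\<omega> \<in> V" unfolding V_def using sp A(1) by blast
        then show ?thesis by (simp add: indicator_def)
      qed (simp add: indicator_def)
    qed
    finally show ?thesis using True by (simp only: indicator_simps mult_1_right)
  qed simp
  have "ennreal (1/2 * I.prob U) = ennreal (1/2) * emeasure ?PI U"
    unfolding I.emeasure_eq_measure by (rule ennreal_mult) auto
  also have "\<dots> = (\<integral>\<^sup>+X. ennreal (1/2) * indicator U X \<partial>?PI)"
    using U_sets by (rule nn_integral_cmult_indicator[symmetric])
  also have "\<dots> \<le> (\<integral>\<^sup>+X. (\<integral>\<^sup>+Y. indicator V (merge ?I ?J (X, Y)) \<partial>?PJ) \<partial>?PI)"
    by (rule nn_integral_mono) (rule slice)
  also have "\<dots> = integral\<^sup>N (PiM (?I \<union> ?J) (\<lambda>_. M)) (indicator V)"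
    using V_sets unfolding UN[symmetric] by (subst product_nn_integral_fold[OF IJ]) auto
  also have "\<dots> = emeasure ?P V" unfolding UN using V_sets by simp
  finally have "ennreal (1/2 * I.prob U) \<le> ennreal (P.prob V)"
    by (simp only: P.emeasure_eq_measure)
  then have "I.prob U \<le> 2 * P.prob V" by (simp only: ennreal_le_iff[OF measure_nonneg])
  also have "P.prob V \<le> 12 * exp (- x)"
    unfolding V_def R_def by (rule ghost_deviation_tail[OF n D x F])
  finally show ?thesis by (simp add: U_def)
qed

end

section \<open>Uniform deviations over slabs\<close>

lemma trace_growth_subset:
  assumes "trace_growth \<Omega> D F" "F' \<subseteq> F"
  shows "trace_growth \<Omega> D F'"
proof -
  have "real (card (traces F' x m)) \<le> real (card (traces F x m))" for x m
    using assms(2) by (intro of_nat_mono card_mono finite_traces) (auto simp: traces_def)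
  then show ?thesis using assms(1) unfolding trace_growth_def by (meson order_trans)
qed

context prob_space
begin

text \<open>
  The bound for finite classes does not depend on their size, so it survives the increasing union.
\<close>

lemma countable_class_deviation_tail:
  fixes x :: real
  assumes n: "n > 0" and D: "D > 0" and x: "x \<ge> ln 2"
    and F: "countable F" "F \<subseteq> events" "trace_growth (space M) D F"
  defines "R \<equiv> sqrt (32 * real n * (18 * real D + x))"
  defines "E \<equiv> {X \<in> space (PiM {..<n} (\<lambda>_. M)).
      \<forall>A\<in>F. \<bar>(\<Sum>i<n. indicator A (X i)) - real n * prob A\<bar> \<le> 20 * R}"
  shows "E \<in> sets (PiM {..<n} (\<lambda>_. M))" "measure (PiM {..<n} (\<lambda>_. M)) E \<ge> 1 - 24 * exp (- x)"
proof -
  let ?P = "PiM {..<n} (\<lambda>_. M)"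
  interpret P: prob_space ?P by (intro prob_space_PiM prob_space_axioms)
  define bad where "bad A = {X \<in> space ?P. 20 * R < \<bar>(\<Sum>i<n. indicator A (X i)) - real n * prob A\<bar>}" for A
  have bad_sets: "bad A \<in> sets ?P" if "A \<in> F" for A
  proof -
    have "(\<lambda>X. indicator A (X i) :: real) \<in> borel_measurable ?P" if "i < n" for i
      using F(2) \<open>A \<in> F\<close> that
      by (intro measurable_compose[OF measurable_component_singleton borel_measurable_indicator]) auto
    then have "(\<lambda>X. \<bar>(\<Sum>i<n. indicator A (X i)) - real n * prob A\<bar>) \<in> borel_measurable ?P"
      by (intro borel_measurable_abs borel_measurable_sum borel_measurable_diff) auto
    then show ?thesis unfolding bad_def by measurable
  qed
  define U where "U = (\<Union>A\<in>F. bad A)"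
  have U_sets: "U \<in> sets ?P" unfolding U_def by (rule sets.countable_UN''[OF F(1) bad_sets])
  have E: "E = space ?P - U" unfolding E_def U_def bad_def by (auto simp: not_less)
  have U_le: "P.prob U \<le> 24 * exp (- x)"
  proof (cases "F = {}")
    case False
    define Fk where "Fk k = from_nat_into F ` {..k}" for k
    have Fk: "Fk k \<subseteq> F" for k using from_nat_into[OF False] by (auto simp: Fk_def)
    have UF: "(\<Union>k. Fk k) = F"
    proof
      show "F \<subseteq> (\<Union>k. Fk k)"
      proof
        fix A assume "A \<in> F"
        then obtain k where "from_nat_into F k = A" using from_nat_into_surj[OF F(1)] by blast
        then have "A \<in> Fk k" by (auto simp: Fk_def)
        then show "A \<in> (\<Union>k. Fk k)" by blast
      qed
    qed (use Fk in blast)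
    define Uk where "Uk k = (\<Union>A\<in>Fk k. bad A)" for k
    have Uk_sets: "Uk k \<in> sets ?P" for k
      unfolding Uk_def using Fk bad_sets by (intro sets.finite_UN) (auto simp: Fk_def)
    have "incseq Uk"
      unfolding incseq_def Uk_def Fk_def by (intro allI impI UN_mono image_mono) auto
    then have "(\<lambda>k. P.prob (Uk k)) \<longlonglongrightarrow> P.prob (\<Union>k. Uk k)"
      using Uk_sets by (intro P.finite_Lim_measure_incseq) auto
    moreover have "(\<Union>k. Uk k) = U"
    proof -
      have "(\<Union>k. Uk k) = (\<Union>A\<in>(\<Union>k. Fk k). bad A)" unfolding Uk_def by blast
      then show ?thesis by (simp only: UF U_def)
    qed
    moreover have "P.prob (Uk k) \<le> 24 * exp (- x)" for k
    proof -
      have "Uk k = {X \<in> space ?P. \<exists>A\<in>Fk k. 20 * R < \<bar>(\<Sum>i<n. indicator A (X i)) - real n * prob A\<bar>}"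
        by (auto simp: Uk_def bad_def)
      then show ?thesis
        using finite_class_deviation_tail[OF n D x, of "Fk k"] Fk[of k] F(2)
          trace_growth_subset[OF F(3) Fk] unfolding R_def by (auto simp: Fk_def)
    qed
    ultimately show ?thesis by (intro LIMSEQ_le_const2) auto
  qed (simp add: U_def)
  show "E \<in> sets ?P" unfolding E using U_sets by auto
  show "P.prob E \<ge> 1 - 24 * exp (- x)" unfolding E using U_sets U_le by (simp add: P.prob_compl)
qed

text \<open>
  Both the empirical counts and the probabilities pass to pointwise limits of sets; for the
  latter by dominated convergence.
\<close>

lemma deviation_le_limit:
  assumes A: "\<And>k. A k \<in> events" "B \<in> events"
    and conv: "\<And>v. v \<in> space M \<Longrightarrow> eventually (\<lambda>k. v \<in> A k \<longleftrightarrow> v \<in> B) sequentially"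
    and X: "\<And>i. i < n \<Longrightarrow> X i \<in> space M"
    and le: "\<And>k. \<bar>(\<Sum>i<n. indicator (A k) (X i)) - real n * prob (A k)\<bar> \<le> c"
  shows "\<bar>(\<Sum>i<n. indicator B (X i)) - real n * prob B\<bar> \<le> c"
proof -
  have ind: "(\<lambda>k. indicator (A k) v :: real) \<longlonglongrightarrow> indicator B v" if "v \<in> space M" for v
    using conv[OF that] by (intro tendsto_eventually) (auto elim!: eventually_mono simp: indicator_def)
  have "(\<lambda>k. expectation (indicator (A k))) \<longlonglongrightarrow> expectation (indicator B :: 'a \<Rightarrow> real)"
    by (rule integral_dominated_convergence[where w = "\<lambda>_. 1"]) (use A ind in \<open>auto simp: indicator_def\<close>)
  then have "(\<lambda>k. prob (A k)) \<longlonglongrightarrow> prob B" using A by simp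
  then have "(\<lambda>k. \<bar>(\<Sum>i<n. indicator (A k) (X i)) - real n * prob (A k)\<bar>)
      \<longlonglongrightarrow> \<bar>(\<Sum>i<n. indicator B (X i)) - real n * prob B\<bar>"
    using X ind by (intro tendsto_intros) auto
  then show ?thesis using le by (intro LIMSEQ_le_const2) auto
qed

end

definition slab :: "nat \<Rightarrow> real Matrix.vec \<Rightarrow> real \<Rightarrow> real Matrix.vec set" where
  "slab p u r = {v \<in> carrier_vec p. \<bar>u \<bullet> v\<bar> \<le> r}"

definition open_slab :: "nat \<Rightarrow> real Matrix.vec \<Rightarrow> real \<Rightarrow> real Matrix.vec set" where
  "open_slab p u r = {v \<in> carrier_vec p. \<bar>u \<bullet> v\<bar> < r}"

lemma scalar_prod_carrier:
  "v \<in> carrier_vec p \<Longrightarrow> u \<bullet> v = (\<Sum>i<p. u $ i * v $ i)" for u v :: "real Matrix.vec"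
  by (simp add: scalar_prod_def atLeast0LessThan)

lemma space_borel_vec [simp]: "space (borel_vec p) = carrier_vec p"
  by (simp add: borel_vec_def)

lemma measurable_vec_index [measurable]:
  "i < p \<Longrightarrow> (\<lambda>v. v $ i) \<in> borel_measurable (borel_vec p)"
proof -
  assume i: "i < p"
  have "(\<lambda>v. \<lambda>i\<in>{..<p}. v $ i) \<in> measurable (borel_vec p) (\<Pi>\<^sub>M i\<in>{..<p}. borel :: real measure)"
    unfolding borel_vec_def by (rule measurable_vimage_algebra1) (auto simp: space_PiM)
  from measurable_compose[OF this measurable_component_singleton[of i]] i
  show ?thesis by simp
qed

lemma measurable_scalar_prod [measurable]:
  "(\<lambda>v. u \<bullet> v) \<in> borel_measurable (borel_vec p)" for u :: "real Matrix.vec"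
proof -
  have "(\<lambda>v. \<Sum>i<p. u $ i * v $ i) \<in> borel_measurable (borel_vec p)"
    by (intro borel_measurable_sum borel_measurable_times) auto
  then show ?thesis
    by (rule measurable_cong[THEN iffD1, rotated]) (simp add: scalar_prod_carrier)
qed

lemma sets_slab [measurable]: "slab p u r \<in> sets (borel_vec p)" "open_slab p u r \<in> sets (borel_vec p)"
proof -
  have "{v \<in> space (borel_vec p). \<bar>u \<bullet> v\<bar> \<le> r} \<in> sets (borel_vec p)"
    "{v \<in> space (borel_vec p). \<bar>u \<bullet> v\<bar> < r} \<in> sets (borel_vec p)" by measurable
  then show "slab p u r \<in> sets (borel_vec p)" "open_slab p u r \<in> sets (borel_vec p)"
    by (simp_all add: slab_def open_slab_def)
qed

text \<open>
  The complement of a slab is the union of the half-spaces \<open>r < u \<bullet> x\<close> and \<open>r < - (u \<bullet> x)\<close>, which become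
  homogeneous after a constant coordinate is appended. Hence a trace of a slab is determined by two
  traces of half-spaces in dimension \<open>p + 1\<close>, and the bounds multiply.
\<close>

lemma trace_growth_slabs:
  "trace_growth (carrier_vec p) (2 * (p + 1)) {slab p u r | u r. u \<in> carrier_vec p}"
  unfolding trace_growth_def
proof (intro allI impI)
  fix m :: nat and z :: "nat \<Rightarrow> real Matrix.vec" and y :: real
  assume z: "\<forall>i<m. z i \<in> carrier_vec p" and y: "0 < y" "y \<le> 1"
  define \<phi> where "\<phi> i j = (if j < p then z i $ j else 1)" for i j
  define H where "H = range (\<lambda>a. {i\<in>{..<m}. 0 < (\<Sum>j<p+1. a j * \<phi> i j)})"
  have cH: "real (card H) \<le> (1 / y) ^ (p + 1) * exp (y * real m)"
    using card_halfspace_traces_le[where X = "{..<m}" and y = y and F = H and d = "p + 1" and \<phi> = \<phi>] y by (simp add: H_def)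
  have finH: "finite H" by (rule finite_subset[of _ "Pow {..<m}"]) (auto simp: H_def)
  have inH: "{i\<in>{..<m}. r < c * (u \<bullet> z i)} \<in> H" for u r c
    unfolding H_def
  proof (rule range_eqI)
    show "{i\<in>{..<m}. r < c * (u \<bullet> z i)} =
      {i\<in>{..<m}. 0 < (\<Sum>j<p+1. (if j < p then c * u $ j else - r) * \<phi> i j)}"
    proof (rule Collect_cong, rule conj_cong[OF refl])
      fix i assume "i \<in> {..<m}"
      then have "u \<bullet> z i = (\<Sum>j<p. u $ j * z i $ j)" using z by (simp add: scalar_prod_carrier)
      then have "(\<Sum>j<p+1. (if j < p then c * u $ j else - r) * \<phi> i j) = c * (u \<bullet> z i) - r"
        by (simp add: \<phi>_def sum_distrib_left mult.assoc)
      then show "r < c * (u \<bullet> z i) \<longleftrightarrow> 0 < (\<Sum>j<p+1. (if j < p then c * u $ j else - r) * \<phi> i j)"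
        by simp
    qed
  qed
  have sub: "traces {slab p u r | u r. u \<in> carrier_vec p} z m \<subseteq> (\<lambda>(A, B). {..<m} - (A \<union> B)) ` (H \<times> H)"
  proof
    fix T assume "T \<in> traces {slab p u r | u r. u \<in> carrier_vec p} z m"
    then obtain u r where T: "T = {i. i < m \<and> z i \<in> slab p u r}" by (auto simp: traces_def)
    have "T = {..<m} - ({i\<in>{..<m}. r < 1 * (u \<bullet> z i)} \<union> {i\<in>{..<m}. r < -1 * (u \<bullet> z i)})"
      unfolding T using z by (auto simp: slab_def)
    then show "T \<in> (\<lambda>(A, B). {..<m} - (A \<union> B)) ` (H \<times> H)"
      using inH[of r 1 u] inH[of r "-1" u] by blast
  qed
  have "card (traces {slab p u r | u r. u \<in> carrier_vec p} z m)
      \<le> card ((\<lambda>(A, B). {..<m} - (A \<union> B)) ` (H \<times> H))"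
    using finH sub by (intro card_mono finite_imageI finite_cartesian_product)
  also have "\<dots> \<le> card (H \<times> H)" using finH by (intro card_image_le finite_cartesian_product)
  also have "\<dots> = card H * card H" by (rule card_cartesian_product)
  finally have "real (card (traces {slab p u r | u r. u \<in> carrier_vec p} z m)) \<le> real (card H) * real (card H)"
    by (simp flip: of_nat_mult)
  also have "\<dots> \<le> ((1 / y) ^ (p + 1) * exp (y * real m)) * ((1 / y) ^ (p + 1) * exp (y * real m))"
    by (intro mult_mono cH) (use y in auto)
  also have "\<dots> = ((1 / y) ^ (p + 1) * (1 / y) ^ (p + 1)) * (exp (y * real m) * exp (y * real m))"
    by (simp only: mult_ac)
  also have "\<dots> = (1 / y) ^ (2 * (p + 1)) * exp (2 * y * real m)"
    by (simp only: mult_2 power_add exp_add[symmetric] distrib_right)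
  finally show "real (card (traces {slab p u r | u r. u \<in> carrier_vec p} z m))
      \<le> (1 / y) ^ (2 * (p + 1)) * exp (2 * y * real m)" .
qed

definition rational_slabs :: "nat \<Rightarrow> real Matrix.vec set set" where
  "rational_slabs p = (\<lambda>(u, r). slab p (Matrix.vec p u) r) ` (PiE {..<p} (\<lambda>_. \<rat>) \<times> \<rat>)"

lemma countable_rational_slabs: "countable (rational_slabs p)"
  unfolding rational_slabs_def
  by (intro countable_image countable_SIGMA countable_PiE) (auto intro: countable_rat)

text \<open>
  The normal vector is rounded to the grid of mesh \<open>(1/2) ^ k\<close>, which changes \<open>u \<bullet> v\<close> by at most
  \<open>S / 2 ^ k\<close> with \<open>S\<close> depending on \<open>v\<close>. Points on the boundary of the slab must not be lost in the limit, so
  the radius is enlarged by \<open>k / 2 ^ k\<close>: eventually more than any \<open>S / 2 ^ k\<close>, yet tending to zero.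
\<close>

lemma slab_limit_of_rational_slabs:
  assumes u: "u \<in> carrier_vec p"
  obtains A where "\<And>k. A k \<in> rational_slabs p"
    "\<And>v. v \<in> carrier_vec p \<Longrightarrow> eventually (\<lambda>k. v \<in> A k \<longleftrightarrow> v \<in> slab p u r) sequentially"
proof -
  define q where "q k s = of_int \<lfloor>s * 2 ^ k\<rfloor> / (2 ^ k :: real)" for k :: nat and s :: real
  have q: "\<bar>q k s - s\<bar> \<le> 1 / 2 ^ k" "q k s \<le> s" for k s
  proof -
    have "of_int \<lfloor>s * 2 ^ k\<rfloor> \<le> s * 2 ^ k" "s * 2 ^ k - 1 \<le> of_int \<lfloor>s * 2 ^ k\<rfloor>" by linarith+
    then have "q k s \<le> s" "s - 1 / 2 ^ k \<le> q k s"
      by (simp_all add: q_def pos_divide_le_eq pos_le_divide_eq left_diff_distrib)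
    then show "\<bar>q k s - s\<bar> \<le> 1 / 2 ^ k" "q k s \<le> s" by linarith+
  qed
  define uk where "uk k = (\<lambda>i\<in>{..<p}. q k (u $ i))" for k
  define rk where "rk k = q k r + real k / 2 ^ k" for k
  define A where "A k = slab p (Matrix.vec p (uk k)) (rk k)" for k
  show ?thesis
  proof (rule that[of A])
    show "A k \<in> rational_slabs p" for k
      unfolding A_def rational_slabs_def by (rule image_eqI[of _ _ "(uk k, rk k)"]) (auto simp: uk_def rk_def q_def)
  next
    fix v :: "real Matrix.vec" assume v: "v \<in> carrier_vec p"
    define S where "S = (\<Sum>i<p. \<bar>v $ i\<bar>)"
    have close: "\<bar>Matrix.vec p (uk k) \<bullet> v - u \<bullet> v\<bar> \<le> S / 2 ^ k" for k
    proof -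
      have "Matrix.vec p (uk k) \<bullet> v - u \<bullet> v = (\<Sum>i<p. (q k (u $ i) - u $ i) * v $ i)"
        using v by (simp add: scalar_prod_carrier uk_def left_diff_distrib sum_subtractf)
      also have "\<bar>\<dots>\<bar> \<le> (\<Sum>i<p. \<bar>(q k (u $ i) - u $ i) * v $ i\<bar>)" by (rule sum_abs)
      also have "\<dots> \<le> (\<Sum>i<p. 1 / 2 ^ k * \<bar>v $ i\<bar>)"
        unfolding abs_mult by (intro sum_mono mult_right_mono q) auto
      also have "\<dots> = S / 2 ^ k" by (simp add: S_def sum_divide_distrib)
      finally show ?thesis .
    qed
    show "eventually (\<lambda>k. v \<in> A k \<longleftrightarrow> v \<in> slab p u r) sequentially"
    proof (cases "\<bar>u \<bullet> v\<bar> \<le> r")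
      case True
      have "eventually (\<lambda>k. S + 1 \<le> real k) sequentially"
        by (rule eventually_sequentiallyI[of "nat \<lceil>S + 1\<rceil>"]) linarith
      then show ?thesis
      proof eventually_elim
        case (elim k)
        have "S / 2 ^ k \<le> (real k - 1) / 2 ^ k" using elim by (intro divide_right_mono) auto
        then have "S / 2 ^ k \<le> real k / 2 ^ k - 1 / 2 ^ k" by (simp only: diff_divide_distrib)
        then have "\<bar>Matrix.vec p (uk k) \<bullet> v\<bar> \<le> rk k"
          using close[of k] True q(1)[of k r] unfolding rk_def by linarith
        then show ?case using True v by (simp add: A_def slab_def)
      qed
    next
      case False
      have "(\<lambda>k. S / 2 ^ k + real k / 2 ^ k) \<longlonglongrightarrow> 0 + 0"
        by (intro tendsto_add lim_n_over_pown LIMSEQ_divide_realpow_zero) auto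
      then have "eventually (\<lambda>k. S / 2 ^ k + real k / 2 ^ k < \<bar>u \<bullet> v\<bar> - r) sequentially"
        by (rule order_tendstoD) (use False in simp)
      then show ?thesis
      proof eventually_elim
        case (elim k)
        then have "\<not> \<bar>Matrix.vec p (uk k) \<bullet> v\<bar> \<le> rk k"
          using close[of k] q(2)[of k r] unfolding rk_def by linarith
        then show ?case using False v by (simp add: A_def slab_def)
      qed
    qed
  qed
qed

lemma open_slab_limit_of_slabs:
  "eventually (\<lambda>k. v \<in> slab p u (r - 1 / real (Suc k)) \<longleftrightarrow> v \<in> open_slab p u r) sequentially"
proof (cases "\<bar>u \<bullet> v\<bar> < r")
  case True
  have "(\<lambda>k. 1 / real (Suc k)) \<longlonglongrightarrow> 0"
    using LIMSEQ_inverse_real_of_nat by (simp add: inverse_eq_divide)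
  then have "eventually (\<lambda>k. 1 / real (Suc k) < r - \<bar>u \<bullet> v\<bar>) sequentially"
    by (rule order_tendstoD) (use True in simp)
  then show ?thesis
  proof eventually_elim
    case (elim k)
    then have "\<bar>u \<bullet> v\<bar> \<le> r - 1 / real (Suc k)" by linarith
    with True show ?case by (simp add: slab_def open_slab_def)
  qed
next
  case False
  have "\<not> \<bar>u \<bullet> v\<bar> \<le> r - 1 / real (Suc k)" for k
  proof -
    have "0 < 1 / real (Suc k)" by simp
    with False show ?thesis by linarith
  qed
  with False show ?thesis by (simp add: slab_def open_slab_def)
qed

lemma slab_deviation:
  fixes x :: real
  assumes M: "prob_space M" "sets M = sets (borel_vec p)" and n: "n > 0" and x: "x \<ge> ln 2"
  defines "c \<equiv> 20 * sqrt (32 * real n * (18 * real (2 * (p + 1)) + x))"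
  shows "\<exists>E \<in> sets (PiM {..<n} (\<lambda>_. M)). measure (PiM {..<n} (\<lambda>_. M)) E \<ge> 1 - 24 * exp (- x) \<and>
    (\<forall>X\<in>E. \<forall>u\<in>carrier_vec p. \<forall>r.
       \<bar>(\<Sum>i<n. indicator (slab p u r) (X i)) - real n * measure M (slab p u r)\<bar> \<le> c \<and>
       \<bar>(\<Sum>i<n. indicator (open_slab p u r) (X i)) - real n * measure M (open_slab p u r)\<bar> \<le> c)"
proof -
  interpret prob_space M by fact
  have space: "space M = carrier_vec p" using sets_eq_imp_space_eq[OF M(2)] by simp
  let ?F = "rational_slabs p"
  define E where "E = {X \<in> space (PiM {..<n} (\<lambda>_. M)).
      \<forall>A\<in>?F. \<bar>(\<Sum>i<n. indicator A (X i)) - real n * prob A\<bar> \<le> c}"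
  have F: "?F \<subseteq> events"
    unfolding M(2) rational_slabs_def by (rule image_subsetI) (simp add: split_beta sets_slab)
  have "trace_growth (carrier_vec p) (2 * (p + 1)) ?F"
    by (rule trace_growth_subset[OF trace_growth_slabs]) (auto simp: rational_slabs_def)
  then have growth: "trace_growth (space M) (2 * (p + 1)) ?F" by (simp only: space)
  have D: "2 * (p + 1) > 0" by simp
  note tail = countable_class_deviation_tail[OF n D x countable_rational_slabs F growth,
      folded c_def, folded E_def]
  have dev: "\<bar>(\<Sum>i<n. indicator (slab p u r) (X i)) - real n * prob (slab p u r)\<bar> \<le> c"
    if X: "X \<in> E" and u: "u \<in> carrier_vec p" for X u r
  proof -
    obtain A where A: "\<And>k. A k \<in> ?F"
      "\<And>v. v \<in> carrier_vec p \<Longrightarrow> eventually (\<lambda>k. v \<in> A k \<longleftrightarrow> v \<in> slab p u r) sequentially"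
      using slab_limit_of_rational_slabs[OF u] by blast
    show ?thesis
    proof (rule deviation_le_limit[of A])
      show "X i \<in> space M" if "i < n" for i using X that by (auto simp: E_def space_PiM)
    qed (use A F X in \<open>auto simp: space M(2) E_def\<close>)
  qed
  have dev': "\<bar>(\<Sum>i<n. indicator (open_slab p u r) (X i)) - real n * prob (open_slab p u r)\<bar> \<le> c"
    if X: "X \<in> E" and u: "u \<in> carrier_vec p" for X u r
  proof (rule deviation_le_limit[of "\<lambda>k. slab p u (r - 1 / real (Suc k))"])
    show "X i \<in> space M" if "i < n" for i using X that by (auto simp: E_def space_PiM)
  qed (use open_slab_limit_of_slabs dev[OF X u] in \<open>auto simp: M(2) sets_slab\<close>)
  from tail dev dev' show ?thesis by blast
qed

section \<open>Quadratic forms and operator norm\<close>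

lemma quadratic_form_eq_sum:
  fixes A :: "real mat"
  assumes "A \<in> carrier_mat p p" "u \<in> carrier_vec p"
  shows "u \<bullet> (A *\<^sub>v u) = (\<Sum>i<p. \<Sum>j<p. u $ i * A $$ (i, j) * u $ j)"
  using assms
  by (simp add: scalar_prod_def mult_mat_vec_def atLeast0LessThan sum_distrib_left mult.assoc)

lemma scalar_prod_self_ge_0: "0 \<le> u \<bullet> u" for u :: "real Matrix.vec"
  by (simp add: scalar_prod_def sum_nonneg)

lemma scalar_prod_self_eq_0:
  "u \<in> carrier_vec p \<Longrightarrow> u \<bullet> u = 0 \<Longrightarrow> u = 0\<^sub>v p" for u :: "real Matrix.vec"
  by (intro eq_vecI) (auto simp: scalar_prod_def sum_nonneg_eq_0_iff)

lemma quadratic_form_shift: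
  fixes s :: "nat \<Rightarrow> nat \<Rightarrow> real"
  assumes sym: "\<And>i j. i < p \<Longrightarrow> j < p \<Longrightarrow> s i j = s j i" and k: "k < p"
  shows "(\<Sum>i<p. \<Sum>j<p. (u i + t * of_bool (i = k)) * s i j * (u j + t * of_bool (j = k)))
    = (\<Sum>i<p. \<Sum>j<p. u i * s i j * u j) + 2 * t * (\<Sum>i<p. s i k * u i) + t\<^sup>2 * s k k"
proof -
  have d: "(\<Sum>j<p. f j * of_bool (j = k)) = f k" for f :: "nat \<Rightarrow> real"
    using k by (subst sum.remove[of _ k]) auto
  have "(\<Sum>j<p. (u i + t * of_bool (i = k)) * s i j * (u j + t * of_bool (j = k)))
      = (\<Sum>j<p. u i * s i j * u j) + (\<Sum>j<p. t * s i j * u j) * of_bool (i = k)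
        + (\<Sum>j<p. (u i * s i j * t) * of_bool (j = k))
        + (\<Sum>j<p. (t * of_bool (i = k) * s i j * t) * of_bool (j = k))" for i
    by (simp add: sum.distrib[symmetric] sum_distrib_right algebra_simps)
  then have "(\<Sum>j<p. (u i + t * of_bool (i = k)) * s i j * (u j + t * of_bool (j = k)))
      = (\<Sum>j<p. u i * s i j * u j) + (\<Sum>j<p. t * s i j * u j) * of_bool (i = k)
        + u i * s i k * t + (t * s i k * t) * of_bool (i = k)" for i
    by (simp add: d)
  then have "(\<Sum>i<p. \<Sum>j<p. (u i + t * of_bool (i = k)) * s i j * (u j + t * of_bool (j = k)))
     = (\<Sum>i<p. \<Sum>j<p. u i * s i j * u j) + (\<Sum>j<p. t * s k j * u j)
       + (\<Sum>i<p. u i * s i k * t) + t * s k k * t"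
    by (simp only: sum.distrib d)
  moreover have "(\<Sum>j<p. t * s k j * u j) = t * (\<Sum>i<p. s i k * u i)"
    unfolding sum_distrib_left using sym k by (intro sum.cong) auto
  moreover have "(\<Sum>i<p. u i * s i k * t) = t * (\<Sum>i<p. s i k * u i)"
    unfolding sum_distrib_left by (intro sum.cong) auto
  ultimately show ?thesis by (simp add: power2_eq_square)
qed

text \<open>
  Cholesky elimination, with possibly vanishing pivots; \<open>k\<close> counts the rows that are already zero. A
  zero pivot forces the whole row to vanish, since otherwise the form would be negative
  somewhere in the plane of two coordinate directions. A positive pivot is eliminated by
  subtracting a square, and the form that remains at \<open>u\<close> is the old one at the point minimizing it on the
  line through \<open>u\<close> in the direction of coordinate \<open>k\<close>.
\<close>

lemma sum_of_squares_decomposition: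
  fixes s :: "nat \<Rightarrow> nat \<Rightarrow> real"
  assumes sym: "\<And>i j. i < p \<Longrightarrow> j < p \<Longrightarrow> s i j = s j i"
    and psd: "\<And>u. 0 \<le> (\<Sum>i<p. \<Sum>j<p. u i * s i j * u j)"
    and zero: "\<And>i j. i < k \<Longrightarrow> i < p \<Longrightarrow> j < p \<Longrightarrow> s i j = 0" and k: "k \<le> p"
  shows "\<exists>a. \<forall>i<p. \<forall>j<p. s i j = (\<Sum>l\<in>{k..<p}. a l i * a l j)"
  using assms
proof (induction "p - k" arbitrary: k s)
  case 0
  then show ?case by auto
next
  case (Suc m)
  have k: "k < p" using Suc.hyps(2) by simp
  note sym = Suc.prems(1) and psd = Suc.prems(2) and zero = Suc.prems(3)
  have split: "{k..<p} = insert k {Suc k..<p}" using k by auto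
  have shift: "0 \<le> (\<Sum>i<p. \<Sum>j<p. u i * s i j * u j) + 2 * t * (\<Sum>i<p. s i k * u i) + t\<^sup>2 * s k k" for u t
    using psd[of "\<lambda>i. u i + t * of_bool (i = k)"]
    by (simp only: quadratic_form_shift[where s = s, OF sym k])
  have d0: "0 \<le> s k k" using shift[of "\<lambda>_. 0" 1] by simp
  show ?case
  proof (cases "s k k = 0")
    case True
    have zero_k: "s j k = 0" if j: "j < p" for j
    proof (rule ccontr)
      assume ne: "s j k \<noteq> 0"
      have e: "(\<Sum>i<p. f i * of_bool (i = j)) = f j" for f :: "nat \<Rightarrow> real"
        using j by (subst sum.remove[of _ j]) auto
      have "(\<Sum>i<p. \<Sum>l<p. of_bool (i = j) * s i l * of_bool (l = j)) = (\<Sum>i<p. s i j * of_bool (i = j))"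
        by (intro sum.cong refl) (subst e, rule mult.commute)
      also have "\<dots> = s j j" by (rule e)
      finally have q: "(\<Sum>i<p. \<Sum>l<p. of_bool (i = j) * s i l * of_bool (l = j)) = s j j" .
      have "0 \<le> s j j + 2 * t * s j k" for t
        using shift[of "\<lambda>i. of_bool (i = j)" t] unfolding q by (simp only: e True mult_zero_right add_0_right)
      from this[of "- (s j j + 1) / (2 * s j k)"] ne show False by (simp add: field_simps)
    qed
    have "\<exists>a. \<forall>i<p. \<forall>j<p. s i j = (\<Sum>l\<in>{Suc k..<p}. a l i * a l j)"
    proof (rule Suc.hyps(1))
      show "s i j = 0" if "i < Suc k" "i < p" "j < p" for i j
        using that zero zero_k[of j] sym[of i j] by (cases "i = k") auto
    qed (use Suc.hyps(2) sym psd k in auto)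
    then obtain a where a: "\<And>i j. i < p \<Longrightarrow> j < p \<Longrightarrow> s i j = (\<Sum>l\<in>{Suc k..<p}. a l i * a l j)" by blast
    show ?thesis
    proof (intro exI[of _ "a(k := \<lambda>_. 0)"] allI impI)
      fix i j assume ij: "i < p" "j < p"
      have "(\<Sum>l\<in>{Suc k..<p}. (a(k := \<lambda>_. 0)) l i * (a(k := \<lambda>_. 0)) l j) = (\<Sum>l\<in>{Suc k..<p}. a l i * a l j)"
        by (intro sum.cong) auto
      then show "s i j = (\<Sum>l\<in>{k..<p}. (a(k := \<lambda>_. 0)) l i * (a(k := \<lambda>_. 0)) l j)"
        unfolding split using a[OF ij] by simp
    qed
  next
    case False
    with d0 have d: "s k k > 0" by simp
    define s' where "s' i j = s i j - s i k * s j k / s k k" for i j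
    have "\<exists>a. \<forall>i<p. \<forall>j<p. s' i j = (\<Sum>l\<in>{Suc k..<p}. a l i * a l j)"
    proof (rule Suc.hyps(1))
      show "s' i j = s' j i" if "i < p" "j < p" for i j
        using sym[OF that] by (simp add: s'_def)
      show "s' i j = 0" if "i < Suc k" "i < p" "j < p" for i j
      proof (cases "i = k")
        case True
        then show ?thesis using d sym[of k j] that k by (simp add: s'_def)
      next
        case False
        then show ?thesis using zero[of i] that k by (simp add: s'_def)
      qed
      show "0 \<le> (\<Sum>i<p. \<Sum>j<p. u i * s' i j * u j)" for u
      proof -
        define b where "b = (\<Sum>i<p. s i k * u i)"
        have "(\<Sum>i<p. \<Sum>j<p. u i * s' i j * u j) =
            (\<Sum>i<p. \<Sum>j<p. u i * s i j * u j) - (\<Sum>i<p. \<Sum>j<p. (s i k * u i) * (s j k * u j)) / s k k"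
          by (simp add: s'_def algebra_simps sum_subtractf sum_divide_distrib)
        also have "(\<Sum>i<p. \<Sum>j<p. (s i k * u i) * (s j k * u j)) = b * b"
          by (simp add: b_def sum_product)
        also have "(\<Sum>i<p. \<Sum>j<p. u i * s i j * u j) - b * b / s k k
            = (\<Sum>i<p. \<Sum>j<p. u i * s i j * u j) + 2 * (- b / s k k) * b + (- b / s k k)\<^sup>2 * s k k"
          using d by (simp add: power2_eq_square field_simps)
        finally show ?thesis using shift[of u "- b / s k k"] by (simp only: b_def)
      qed
    qed (use Suc.hyps(2) k in auto)
    then obtain a where a: "\<And>i j. i < p \<Longrightarrow> j < p \<Longrightarrow> s' i j = (\<Sum>l\<in>{Suc k..<p}. a l i * a l j)" by blast
    define a' where "a' = a(k := \<lambda>i. s i k / sqrt (s k k))"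
    have "s i j = (\<Sum>l\<in>{k..<p}. a' l i * a' l j)" if ij: "i < p" "j < p" for i j
    proof -
      have "(\<Sum>l\<in>{Suc k..<p}. a' l i * a' l j) = (\<Sum>l\<in>{Suc k..<p}. a l i * a l j)"
        by (intro sum.cong) (auto simp: a'_def)
      moreover have "a' k i * a' k j = s i k * s j k / s k k"
        using d by (simp add: a'_def field_simps)
      ultimately show ?thesis
        unfolding split using a[OF ij] by (simp add: s'_def)
    qed
    then show ?thesis by blast
  qed
qed

lemma psd_mat_symmetric:
  assumes "psd_mat p A" "i < p" "j < p"
  shows "A $$ (j, i) = A $$ (i, j)"
proof -
  have "A \<in> carrier_mat p p" "transpose_mat A = A" using assms by (auto simp: psd_mat_def)
  then show ?thesis using assms(2,3) by (metis carrier_matD index_transpose_mat(1))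
qed

lemma psd_mat_factor:
  assumes S: "psd_mat p S"
  shows "\<exists>A \<in> carrier_mat p p. A * transpose_mat A = S"
proof -
  have c: "S \<in> carrier_mat p p"
    and q: "\<And>u. u \<in> carrier_vec p \<Longrightarrow> 0 \<le> u \<bullet> (S *\<^sub>v u)" using S by (auto simp: psd_mat_def)
  have "\<exists>a. \<forall>i<p. \<forall>j<p. S $$ (i, j) = (\<Sum>l\<in>{0..<p}. a l i * a l j)"
  proof (rule sum_of_squares_decomposition)
    show "S $$ (i, j) = S $$ (j, i)" if "i < p" "j < p" for i j
      by (rule psd_mat_symmetric[OF S that(2,1)])
    show "0 \<le> (\<Sum>i<p. \<Sum>j<p. u i * S $$ (i, j) * u j)" for u
      using q[of "Matrix.vec p u"] quadratic_form_eq_sum[OF c, of "Matrix.vec p u"] by simp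
  qed auto
  then obtain a where a: "\<And>i j. i < p \<Longrightarrow> j < p \<Longrightarrow> S $$ (i, j) = (\<Sum>l\<in>{0..<p}. a l i * a l j)" by blast
  define A where "A = mat p p (\<lambda>(i, l). a l i)"
  have "A * transpose_mat A = S"
    using c by (intro eq_matI) (auto simp: A_def a scalar_prod_def)
  moreover have "A \<in> carrier_mat p p" by (simp add: A_def)
  ultimately show ?thesis by blast
qed

lemma quadratic_form_factor:
  fixes S :: "real mat"
  assumes A: "A \<in> carrier_mat p p" "A * transpose_mat A = S" and u: "u \<in> carrier_vec p"
  shows "u \<bullet> (S *\<^sub>v u) = (transpose_mat A *\<^sub>v u) \<bullet> (transpose_mat A *\<^sub>v u)"
proof -
  have "S *\<^sub>v u = A *\<^sub>v (transpose_mat A *\<^sub>v u)"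
    using A u by (simp flip: A(2))
  also have "u \<bullet> \<dots> = (transpose_mat A *\<^sub>v u) \<bullet> (transpose_mat A *\<^sub>v u)"
    using A u by (subst transpose_vec_mult_scalar) auto
  finally show ?thesis .
qed

lemma frobenius_bound:
  fixes v :: "real Matrix.vec"
  assumes A: "A \<in> carrier_mat nr nc" and v: "v \<in> carrier_vec nc"
  shows "(A *\<^sub>v v) \<bullet> (A *\<^sub>v v) \<le> (\<Sum>i<nr. \<Sum>j<nc. (A $$ (i, j))\<^sup>2) * (v \<bullet> v)"
proof -
  have "(A *\<^sub>v v) \<bullet> (A *\<^sub>v v) = (\<Sum>i<nr. (\<Sum>j<nc. A $$ (i, j) * v $ j)\<^sup>2)"
    using A v by (simp add: scalar_prod_def mult_mat_vec_def atLeast0LessThan power2_eq_square)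
  also have "\<dots> \<le> (\<Sum>i<nr. (\<Sum>j<nc. (A $$ (i, j))\<^sup>2) * (\<Sum>j<nc. (v $ j)\<^sup>2))"
    by (intro sum_mono Cauchy_Schwarz_ineq_sum)
  also have "\<dots> = (\<Sum>i<nr. \<Sum>j<nc. (A $$ (i, j))\<^sup>2) * (v \<bullet> v)"
    using v by (simp add: scalar_prod_def atLeast0LessThan power2_eq_square sum_distrib_right)
  finally show ?thesis .
qed

text \<open>
  With \<open>N = A A\<^sup>T\<close> the adjugate of \<open>N\<close> recovers \<open>det N * u\<close> linearly from \<open>A\<^sup>T u\<close>, so the norm of
  \<open>A\<^sup>T u\<close>, whose square is the quadratic form, cannot be small compared with that of \<open>u\<close>.
\<close>

lemma nonsingular_psd_mat_coercive:
  assumes N: "psd_mat p N" and det: "det N \<noteq> 0"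
  shows "\<exists>\<kappa>>0. \<forall>u\<in>carrier_vec p. \<kappa> * (u \<bullet> u) \<le> u \<bullet> (N *\<^sub>v u)"
proof -
  have c: "N \<in> carrier_mat p p" using N by (simp add: psd_mat_def)
  obtain A where A: "A \<in> carrier_mat p p" "A * transpose_mat A = N"
    using psd_mat_factor[OF N] by blast
  define W where "W = adj_mat N * A"
  have W: "W \<in> carrier_mat p p" using adj_mat(1)[OF c] A by (simp add: W_def)
  define K where "K = 1 + (\<Sum>i<p. \<Sum>j<p. (W $$ (i, j))\<^sup>2)"
  have K: "K > 0" unfolding K_def by (intro add_pos_nonneg sum_nonneg) auto
  have "(det N)\<^sup>2 / K * (u \<bullet> u) \<le> u \<bullet> (N *\<^sub>v u)" if u: "u \<in> carrier_vec p" for u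
  proof -
    let ?w = "transpose_mat A *\<^sub>v u"
    have w: "?w \<in> carrier_vec p" using A u by simp
    have "W *\<^sub>v ?w = adj_mat N *\<^sub>v (A *\<^sub>v ?w)"
      using adj_mat(1)[OF c] A w by (simp add: W_def)
    also have "A *\<^sub>v ?w = N *\<^sub>v u" using A u by (simp flip: A(2))
    also have "adj_mat N *\<^sub>v (N *\<^sub>v u) = (adj_mat N * N) *\<^sub>v u"
      using adj_mat(1)[OF c] c u by simp
    also have "\<dots> = det N \<cdot>\<^sub>v u"
      unfolding adj_mat(3)[OF c] using u by (intro eq_vecI) (auto simp: scalar_prod_def if_distrib if_distribR sum.delta cong: if_cong)
    finally have "(det N)\<^sup>2 * (u \<bullet> u) = (W *\<^sub>v ?w) \<bullet> (W *\<^sub>v ?w)"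
      using u by (simp add: power2_eq_square)
    also have "\<dots> \<le> (K - 1) * (?w \<bullet> ?w)" using frobenius_bound[OF W w] by (simp add: K_def)
    also have "\<dots> \<le> K * (?w \<bullet> ?w)" by (intro mult_right_mono scalar_prod_self_ge_0) auto
    also have "?w \<bullet> ?w = u \<bullet> (N *\<^sub>v u)" using quadratic_form_factor[OF A u] by simp
    finally show ?thesis using K by (simp add: field_simps)
  qed
  moreover have "(det N)\<^sup>2 / K > 0" using K det by simp
  ultimately show ?thesis by blast
qed

lemma quadratic_form_shifted_identity:
  fixes S :: "real mat"
  assumes "S \<in> carrier_mat p p" "u \<in> carrier_vec p"
  shows "u \<bullet> ((t \<cdot>\<^sub>m 1\<^sub>m p - S) *\<^sub>v u) = t * (u \<bullet> u) - u \<bullet> (S *\<^sub>v u)"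
proof -
  have "(t \<cdot>\<^sub>m 1\<^sub>m p) *\<^sub>v u = t \<cdot>\<^sub>v u"
    using assms by (intro eq_vecI) (auto simp: scalar_prod_def if_distrib if_distribR sum.delta cong: if_cong)
  moreover have "(t \<cdot>\<^sub>m 1\<^sub>m p - S) *\<^sub>v u = (t \<cdot>\<^sub>m 1\<^sub>m p) *\<^sub>v u - S *\<^sub>v u"
    using assms by (intro minus_mult_distrib_mat_vec[of _ p p]) auto
  ultimately show ?thesis
    using assms by (simp add: scalar_prod_minus_distrib[of _ p])
qed

text \<open>
  The Rayleigh bound, without compactness of the sphere. Let \<open>t\<close> be the smallest nonnegative number such that
  \<open>t * I - S\<close> is positive semidefinite. If \<open>t\<close> were positive and not an eigenvalue, this matrix would be
  nonsingular, hence coercive, and \<open>t\<close> could be decreased.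
\<close>

lemma quadratic_form_le_eigenvalue:
  assumes S: "psd_mat p S"
  shows "\<exists>t\<ge>0. (t = 0 \<or> eigenvalue S t) \<and> (\<forall>u\<in>carrier_vec p. u \<bullet> (S *\<^sub>v u) \<le> t * (u \<bullet> u))"
proof -
  have c: "S \<in> carrier_mat p p" using S by (simp add: psd_mat_def)
  define T where "T = {t. t \<ge> 0 \<and> (\<forall>u\<in>carrier_vec p. u \<bullet> (S *\<^sub>v u) \<le> t * (u \<bullet> u))}"
  define K where "K = (\<Sum>i<p. \<Sum>j<p. (S $$ (i, j))\<^sup>2)"
  have "1 + K \<in> T"
  proof -
    have "u \<bullet> (S *\<^sub>v u) \<le> (1 + K) * (u \<bullet> u)" if u: "u \<in> carrier_vec p" for u
    proof -
      let ?w = "S *\<^sub>v u"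
      have w: "?w \<in> carrier_vec p" using c u by simp
      have "2 * (u \<bullet> ?w) \<le> u \<bullet> u + ?w \<bullet> ?w"
        using scalar_prod_self_ge_0[of "u - ?w"] u w comm_scalar_prod[OF u w]
        by (simp add: scalar_prod_minus_distrib[of _ p] minus_scalar_prod_distrib[of _ p])
      also have "\<dots> \<le> (1 + K) * (u \<bullet> u)"
        using frobenius_bound[OF c u] by (simp add: K_def distrib_right)
      finally have "2 * (u \<bullet> ?w) \<le> (1 + K) * (u \<bullet> u)" .
      moreover have "0 \<le> u \<bullet> ?w" using S u by (simp add: psd_mat_def)
      ultimately show ?thesis by linarith
    qed
    moreover have "0 \<le> K" by (auto simp: K_def intro!: sum_nonneg)
    ultimately show ?thesis by (simp add: T_def)
  qed
  then have ne: "T \<noteq> {}" by blast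
  have bdd: "bdd_below T" by (rule bdd_belowI[of _ 0]) (simp add: T_def)
  define t where "t = Inf T"
  have t0: "t \<ge> 0" unfolding t_def by (rule cInf_greatest[OF ne]) (simp add: T_def)
  have tT: "u \<bullet> (S *\<^sub>v u) \<le> t * (u \<bullet> u)" if u: "u \<in> carrier_vec p" for u
  proof (cases "u \<bullet> u = 0")
    case True
    then have "u = 0\<^sub>v p" using scalar_prod_self_eq_0 u by blast
    then show ?thesis using c by simp
  next
    case False
    then have pos: "u \<bullet> u > 0" using scalar_prod_self_ge_0[of u] by simp
    have "(u \<bullet> (S *\<^sub>v u)) / (u \<bullet> u) \<le> t"
      unfolding t_def by (rule cInf_greatest[OF ne]) (use u pos in \<open>auto simp: T_def pos_divide_le_eq\<close>)
    then show ?thesis using pos by (simp add: pos_divide_le_eq)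
  qed
  have "t = 0 \<or> eigenvalue S t"
  proof (rule ccontr)
    assume neg: "\<not> ?thesis"
    define N where "N = t \<cdot>\<^sub>m 1\<^sub>m p - S"
    have N: "psd_mat p N"
      unfolding psd_mat_def
    proof (intro conjI ballI)
      show Nc: "N \<in> carrier_mat p p" using c unfolding N_def by (intro minus_carrier_mat)
      have "S $$ (j, i) = S $$ (i, j)" if "i < p" "j < p" for i j
        by (rule psd_mat_symmetric[OF S that])
      then show "transpose_mat N = N"
        using Nc c by (intro eq_matI) (auto simp: N_def)
      show "0 \<le> u \<bullet> (N *\<^sub>v u)" if "u \<in> carrier_vec p" for u
        using tT[OF that] quadratic_form_shifted_identity[OF c that, of t] by (simp add: N_def)
    qed
    have "char_matrix S t = (-1) \<cdot>\<^sub>m N"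
      using c by (intro eq_matI) (auto simp: char_matrix_def N_def)
    then have "det N \<noteq> 0"
      using neg c by (simp add: eigenvalue_det[OF c] det_smult)
    from nonsingular_psd_mat_coercive[OF N this] obtain \<kappa> where
      k: "\<kappa> > 0" "\<And>u. u \<in> carrier_vec p \<Longrightarrow> \<kappa> * (u \<bullet> u) \<le> u \<bullet> (N *\<^sub>v u)" by blast
    define t' where "t' = max 0 (t - \<kappa>)"
    have "u \<bullet> (S *\<^sub>v u) \<le> t' * (u \<bullet> u)" if u: "u \<in> carrier_vec p" for u
    proof -
      have "u \<bullet> (S *\<^sub>v u) \<le> (t - \<kappa>) * (u \<bullet> u)"
        using k(2)[OF u] quadratic_form_shifted_identity[OF c u, of t] by (simp add: N_def left_diff_distrib)
      also have "\<dots> \<le> t' * (u \<bullet> u)"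
        by (intro mult_right_mono scalar_prod_self_ge_0) (simp add: t'_def)
      finally show ?thesis .
    qed
    then have "t' \<in> T" by (simp add: T_def t'_def)
    then have "t \<le> t'" unfolding t_def by (rule cInf_lower[OF _ bdd])
    with k(1) t0 neg show False by (auto simp: t'_def max_def split: if_splits)
  qed
  with t0 tT show ?thesis by blast
qed

lemma cov_class_quadratic_form_le:
  assumes S: "S \<in> cov_class p M" and M: "M > 0" and u: "u \<in> carrier_vec p"
  shows "u \<bullet> (S *\<^sub>v u) \<le> M * (u \<bullet> u)"
proof -
  have psd: "psd_mat p S" and sM: "s_max S \<le> M" using S by (auto simp: cov_class_def)
  have c: "S \<in> carrier_mat p p" and tr: "transpose_mat S = S" using psd by (auto simp: psd_mat_def)
  obtain t where t: "t \<ge> 0" "t = 0 \<or> eigenvalue S t" "u \<bullet> (S *\<^sub>v u) \<le> t * (u \<bullet> u)"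
    using quadratic_form_le_eigenvalue[OF psd] u by blast
  have "t \<le> M"
    using t(2)
  proof
    assume "eigenvalue S t"
    then obtain v where v: "v \<in> carrier_vec p" "v \<noteq> 0\<^sub>v p" "S *\<^sub>v v = t \<cdot>\<^sub>v v"
      using c by (auto simp: eigenvalue_def eigenvector_def)
    have SS: "transpose_mat S * S \<in> carrier_mat p p" using c by simp
    have "(transpose_mat S * S) *\<^sub>v v = S *\<^sub>v (S *\<^sub>v v)" using c v tr by simp
    also have "\<dots> = (t * t) \<cdot>\<^sub>v v" using c v by (simp add: mult_mat_vec[of _ p p] smult_smult_assoc)
    finally have "eigenvalue (transpose_mat S * S) (t * t)"
      unfolding eigenvalue_def eigenvector_def using v SS c by (intro exI[of _ v]) auto
    then have "sqrt (t * t) \<in> singular_values S" unfolding singular_values_def by blast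
    then have tS: "t \<in> singular_values S" using t(1) by simp
    have "{k. eigenvalue (transpose_mat S * S) k} = {k. poly (char_poly (transpose_mat S * S)) k = 0}"
      using eigenvalue_root_char_poly[OF SS] by simp
    moreover have "char_poly (transpose_mat S * S) \<noteq> 0"
      using degree_monic_char_poly[OF SS] by auto
    ultimately have "finite {k. eigenvalue (transpose_mat S * S) k}"
      by (simp add: poly_roots_finite)
    moreover have "singular_values S = sqrt ` {k. eigenvalue (transpose_mat S * S) k}"
      by (auto simp: singular_values_def)
    ultimately have "finite (singular_values S)" by simp
    with tS have "t \<le> s_max S" unfolding s_max_def by (intro Max_ge)
    with sM show ?thesis by simp
  qed (use M in simp)
  then have "t * (u \<bullet> u) \<le> M * (u \<bullet> u)" by (intro mult_right_mono scalar_prod_self_ge_0)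
  with t(3) show ?thesis by linarith
qed

lemma unit_sphere_nonempty: "p > 0 \<Longrightarrow> unit_sphere p \<noteq> {}"
proof -
  assume p: "p > 0"
  have "vec_norm2 (unit_vec p 0) = 1" using p by (simp add: vec_norm2_def)
  then have "unit_vec p 0 \<in> unit_sphere p" by (simp add: unit_sphere_def)
  then show ?thesis by blast
qed

lemma unit_sphere_iff: "u \<in> unit_sphere p \<longleftrightarrow> u \<in> carrier_vec p \<and> u \<bullet> u = 1"
  by (simp add: unit_sphere_def vec_norm2_def)

text \<open>
  Polarization: with \<open>w = A u\<close> and \<open>s\<close> its norm, the forms at \<open>w + s u\<close> and \<open>w - s u\<close> differ by
  \<open>4 * s\<close> times the square of \<open>s\<close>, while by the parallelogram law the bound on both forms adds up to
  \<open>4 * c\<close> times the square of \<open>s\<close>.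
\<close>

lemma op_norm_le_quadratic_form_bound:
  assumes A: "A \<in> carrier_mat p p" "transpose_mat A = A" and p: "p > 0"
    and bound: "\<And>u. u \<in> unit_sphere p \<Longrightarrow> \<bar>u \<bullet> (A *\<^sub>v u)\<bar> \<le> c"
  shows "op_norm A \<le> c" "0 \<le> op_norm A"
proof -
  have c: "0 \<le> c"
    using unit_sphere_nonempty[OF p] bound by (meson abs_ge_zero equals0I order_trans)
  have hom: "\<bar>u \<bullet> (A *\<^sub>v u)\<bar> \<le> c * (u \<bullet> u)" if u: "u \<in> carrier_vec p" for u
  proof (cases "u \<bullet> u = 0")
    case True
    then have "u = 0\<^sub>v p" using scalar_prod_self_eq_0 u by blast
    then show ?thesis using A by simp
  next
    case False
    then have pos: "u \<bullet> u > 0" using scalar_prod_self_ge_0[of u] by simp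
    define a where "a = 1 / sqrt (u \<bullet> u)"
    have a2: "a * a = 1 / (u \<bullet> u)" using pos by (simp add: a_def field_simps)
    have au: "a \<cdot>\<^sub>v u \<in> unit_sphere p" using u pos a2 by (simp add: unit_sphere_iff mult.assoc[symmetric])
    have "(a \<cdot>\<^sub>v u) \<bullet> (A *\<^sub>v (a \<cdot>\<^sub>v u)) = a * a * (u \<bullet> (A *\<^sub>v u))"
      using A u by (simp add: mult_mat_vec[of _ p p] mult.assoc)
    with bound[OF au] have "\<bar>u \<bullet> (A *\<^sub>v u)\<bar> / (u \<bullet> u) \<le> c"
      using pos by (simp add: a2 abs_mult)
    then show ?thesis using pos by (simp add: pos_divide_le_eq)
  qed
  have le: "vec_norm2 (A *\<^sub>v u) \<le> c" if "u \<in> unit_sphere p" for u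
  proof -
    have u: "u \<in> carrier_vec p" "u \<bullet> u = 1" using that by (auto simp: unit_sphere_iff)
    define w where "w = A *\<^sub>v u"
    have w: "w \<in> carrier_vec p" using A u by (simp add: w_def)
    define s where "s = vec_norm2 w"
    have s: "s \<ge> 0" "w \<bullet> w = s\<^sup>2"
      using scalar_prod_self_ge_0[of w] by (auto simp: s_def vec_norm2_def)
    have sym: "u \<bullet> (A *\<^sub>v w) = w \<bullet> w"
      using transpose_vec_mult_scalar[OF A(1) w u(1)] A(2) by (simp add: w_def)
    have wAu: "w \<bullet> (A *\<^sub>v u) = w \<bullet> w" by (simp add: w_def)
    have expand: "(w + a \<cdot>\<^sub>v u) \<bullet> (A *\<^sub>v (w + a \<cdot>\<^sub>v u)) =
        w \<bullet> (A *\<^sub>v w) + 2 * a * (w \<bullet> w) + a * a * (u \<bullet> (A *\<^sub>v u))" for a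
    proof -
      have "A *\<^sub>v (w + a \<cdot>\<^sub>v u) = A *\<^sub>v w + a \<cdot>\<^sub>v (A *\<^sub>v u)"
        using A u w by (simp add: mult_add_distrib_mat_vec[of _ p p] mult_mat_vec[of _ p p])
      then show ?thesis using A u w sym wAu
        by (simp add: scalar_prod_add_distrib[of _ p] add_scalar_prod_distrib[of _ p] algebra_simps)
    qed
    have norm: "(w + a \<cdot>\<^sub>v u) \<bullet> (w + a \<cdot>\<^sub>v u) = s\<^sup>2 + 2 * a * (w \<bullet> u) + a * a" for a
      using u w s(2) comm_scalar_prod[OF u(1) w]
      by (simp add: scalar_prod_add_distrib[of _ p] add_scalar_prod_distrib[of _ p] algebra_simps)
    have car: "w + a \<cdot>\<^sub>v u \<in> carrier_vec p" for a using u w by simp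
    have "4 * s * s\<^sup>2 = (w + s \<cdot>\<^sub>v u) \<bullet> (A *\<^sub>v (w + s \<cdot>\<^sub>v u)) - (w + (- s) \<cdot>\<^sub>v u) \<bullet> (A *\<^sub>v (w + (- s) \<cdot>\<^sub>v u))"
      unfolding expand s(2) by (simp add: algebra_simps)
    also have "\<dots> \<le> c * ((w + s \<cdot>\<^sub>v u) \<bullet> (w + s \<cdot>\<^sub>v u)) + c * ((w + (- s) \<cdot>\<^sub>v u) \<bullet> (w + (- s) \<cdot>\<^sub>v u))"
      using hom[OF car, of s] hom[OF car, of "- s"] by linarith
    also have "\<dots> = 4 * c * s\<^sup>2"
      unfolding norm by (simp add: algebra_simps power2_eq_square)
    finally have "s * s\<^sup>2 \<le> c * s\<^sup>2" by simp
    then show ?thesis using c s(1) by (cases "s = 0") (auto simp: s_def w_def)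
  qed
  have dim: "dim_col A = p" using A by simp
  show "op_norm A \<le> c"
    unfolding op_norm_def dim by (rule cSUP_least[OF unit_sphere_nonempty[OF p] le])
  obtain u where u: "u \<in> unit_sphere p" using unit_sphere_nonempty[OF p] by blast
  have "0 \<le> vec_norm2 (A *\<^sub>v u)" by (simp add: vec_norm2_def scalar_prod_self_ge_0)
  also have "\<dots> \<le> op_norm A"
    unfolding op_norm_def dim by (rule cSUP_upper[OF u]) (use le in \<open>auto intro!: bdd_aboveI\<close>)
  finally show "0 \<le> op_norm A" .
qed

section \<open>Gaussian projections and quantiles\<close>

abbreviation (input) "gauss \<equiv> std_normal_distribution"

interpretation gauss: real_distribution std_normal_distribution
  by (rule real_dist_normal_dist)

lemma gauss_uminus: "distr gauss borel uminus = gauss"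
proof -
  have "distributed gauss lborel (\<lambda>x. x) std_normal_density"
    unfolding distributed_def by (auto simp: distr_id2)
  from gauss.normal_density_affine[OF this, of "-1" 0]
  have "distributed gauss lborel uminus std_normal_density" by simp
  then have "distr gauss lborel uminus = gauss" by (simp add: distributed_def)
  moreover have "distr gauss lborel uminus = distr gauss borel uminus" by (rule distr_cong) auto
  ultimately show ?thesis by simp
qed

lemma gauss_measure_uminus: "A \<in> sets borel \<Longrightarrow> measure gauss (uminus -` A) = measure gauss A"
  using measure_distr[of uminus gauss borel A] by (simp add: gauss_uminus)

lemma gauss_singleton: "measure gauss {x} = 0"
proof -
  have "emeasure gauss {x} = 0"
    by (subst emeasure_density) (auto simp: nn_integral_0_iff_AE intro!: AE_I[of _ _ "{x}"])
  then show ?thesis by (simp add: measure_def)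
qed

lemma gauss_cdf_0: "cdf gauss 0 = 1/2"
proof -
  have "uminus -` {..0::real} = {0..}" by auto
  then have "measure gauss {0..} = cdf gauss 0"
    using gauss_measure_uminus[of "{..0}"] by (simp add: cdf_def)
  moreover have "measure gauss {0..} + measure gauss {..<0} = 1"
  proof -
    have "{0..} \<union> {..<0} = (UNIV :: real set)" by auto
    then show ?thesis using gauss.prob_space
      by (subst gauss.finite_measure_Union[symmetric]) auto
  qed
  moreover have "cdf gauss 0 = measure gauss {..<0} + measure gauss {0}"
    unfolding cdf_def by (subst gauss.finite_measure_Union[symmetric]) (auto intro!: arg_cong[of _ _ "measure gauss"])
  ultimately show ?thesis using gauss_singleton[of 0] by simp
qed

lemma gauss_central_interval:
  assumes "s \<ge> 0"
  shows "measure gauss {-s..s} = 2 * cdf gauss s - 1" "measure gauss {-s<..<s} = 2 * cdf gauss s - 1"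
proof -
  have "uminus -` {..<-s} = {s<..}" by auto
  then have tail: "measure gauss {s<..} = measure gauss {..<-s}"
    using gauss_measure_uminus[of "{..<-s}"] by simp
  have "measure gauss {..s} + measure gauss {s<..} = 1"
  proof -
    have "{..s} \<union> {s<..} = UNIV" by auto
    then show ?thesis using gauss.prob_space
      by (subst gauss.finite_measure_Union[symmetric]) auto
  qed
  moreover have "measure gauss {..s} = measure gauss {..<-s} + measure gauss {-s..s}"
  proof -
    have "{..<-s} \<union> {-s..s} = {..s}" using assms by auto
    then show ?thesis by (subst gauss.finite_measure_Union[symmetric]) auto
  qed
  ultimately show 1: "measure gauss {-s..s} = 2 * cdf gauss s - 1"
    using tail by (simp add: cdf_def)
  show "measure gauss {-s<..<s} = 2 * cdf gauss s - 1"
  proof (cases "s = 0")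
    case True
    then show ?thesis by (simp add: gauss_cdf_0)
  next
    case False
    have "measure gauss ({-s<..<s} \<union> ({-s} \<union> {s})) = measure gauss {-s<..<s} + measure gauss ({-s} \<union> {s})"
      by (rule gauss.finite_measure_Union) auto
    moreover have "measure gauss ({-s} \<union> {s}) = measure gauss {-s} + measure gauss {s}"
      by (rule gauss.finite_measure_Union) (use False in auto)
    moreover have "{-s<..<s} \<union> ({-s} \<union> {s}) = {-s..s}" using assms by auto
    ultimately have "measure gauss {-s..s} = measure gauss {-s<..<s} + measure gauss {-s} + measure gauss {s}"
      by simp
    then show ?thesis using 1 by (simp add: gauss_singleton)
  qed
qed

text \<open>
  The density is decreasing on the positive half-line.
\<close>

lemma gauss_cdf_increment:
  assumes "0 \<le> a" "a \<le> b" "b \<le> r"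
  shows "std_normal_density r * (b - a) \<le> cdf gauss b - cdf gauss a"
proof -
  have "ennreal (std_normal_density r * (b - a)) = ennreal (std_normal_density r) * emeasure lborel {a<..b}"
    using assms by (simp add: ennreal_mult)
  also have "\<dots> = (\<integral>\<^sup>+x. ennreal (std_normal_density r) * indicator {a<..b} x \<partial>lborel)"
    by (rule nn_integral_cmult_indicator[symmetric]) simp
  also have "\<dots> \<le> (\<integral>\<^sup>+x. ennreal (std_normal_density x) * indicator {a<..b} x \<partial>lborel)"
  proof (rule nn_integral_mono)
    fix x :: real
    show "ennreal (std_normal_density r) * indicator {a<..b} x \<le> ennreal (std_normal_density x) * indicator {a<..b} x"
    proof (cases "x \<in> {a<..b}")
      case True
      then have "x\<^sup>2 \<le> r\<^sup>2" using assms by (intro power_mono) auto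
      then have "std_normal_density r \<le> std_normal_density x"
        by (auto simp: std_normal_density_def intro!: mult_left_mono divide_right_mono)
      then show ?thesis using True by (simp add: ennreal_leI)
    qed simp
  qed
  also have "\<dots> = emeasure gauss {a<..b}" by (subst emeasure_density) auto
  finally have "std_normal_density r * (b - a) \<le> measure gauss {a<..b}"
    by (simp add: gauss.emeasure_eq_measure measure_nonneg)
  then show ?thesis using assms(2) by (cases "a = b") (auto simp: gauss.cdf_diff_eq)
qed

text \<open>
  The equation has a solution by the intermediate value theorem, and strict monotonicity of the distribution
  function on the positive half-line makes it unique.
\<close>

lemma depth_beta_properties: "depth_beta > 0" "cdf gauss (sqrt depth_beta) = 3/4"
proof -
  have inj: "a = b" if "0 \<le> a" "a \<le> b" "cdf gauss a = cdf gauss b" for a b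
  proof (rule ccontr)
    assume "a \<noteq> b"
    then have "0 < std_normal_density b * (b - a)"
      using that by (intro mult_pos_pos normal_density_pos) auto
    with gauss_cdf_increment[of a b b] that show False by linarith
  qed
  have "eventually (\<lambda>x. 3/4 < cdf gauss x) at_top"
    using gauss.cdf_lim_at_top_prob by (rule order_tendstoD) simp
  then obtain N where N: "\<And>x. x \<ge> N \<Longrightarrow> 3/4 < cdf gauss x" by (auto simp: eventually_at_top_linorder)
  have "\<exists>x. 0 \<le> x \<and> x \<le> max 0 N \<and> cdf gauss x = 3/4"
    using N[of "max 0 N"] gauss_cdf_0 gauss_singleton by (intro IVT) (auto simp: gauss.isCont_cdf)
  then obtain x where x: "x \<ge> 0" "cdf gauss x = 3/4" by blast
  have b: "depth_beta = x\<^sup>2"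
    unfolding depth_beta_def
  proof (rule the_equality)
    fix b assume b: "b \<ge> 0 \<and> cdf gauss (sqrt b) = 3/4"
    then have "sqrt b = x"
      using x inj[of x "sqrt b"] inj[of "sqrt b" x] by (cases "x \<le> sqrt b") auto
    then show "b = x\<^sup>2" using b by auto
  qed (use x in simp)
  have "x \<noteq> 0" using x gauss_cdf_0 by auto
  then show "depth_beta > 0" "cdf gauss (sqrt depth_beta) = 3/4" using x by (auto simp: b)
qed

text \<open>
  A central interval whose mass is at most \<open>1/2 + 3/8\<close> ends before a fixed radius \<open>r\<close>, where the distribution
  function exceeds \<open>15/16\<close>; up to \<open>r\<close> the density is bounded below.
\<close>

lemma gauss_quantile_stability:
  "\<exists>K>0. \<forall>s \<eta>. 0 \<le> s \<longrightarrow> 0 \<le> \<eta> \<longrightarrow> \<eta> \<le> 3/8 \<longrightarrow> \<bar>measure gauss {-s..s} - 1/2\<bar> \<le> \<eta> \<longrightarrow>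
     \<bar>s\<^sup>2 - depth_beta\<bar> \<le> K * \<eta>"
proof -
  have "eventually (\<lambda>x. 15/16 < cdf gauss x) at_top"
    using gauss.cdf_lim_at_top_prob by (rule order_tendstoD) simp
  then obtain N where N: "\<And>x. x \<ge> N \<Longrightarrow> 15/16 < cdf gauss x" by (auto simp: eventually_at_top_linorder)
  define r where "r = max 1 (max N (sqrt depth_beta))"
  have r: "r \<ge> 1" "15/16 < cdf gauss r" "sqrt depth_beta \<le> r" using N[of r] by (auto simp: r_def)
  define k where "k = std_normal_density r"
  have k: "k > 0" unfolding k_def by (intro normal_density_pos) simp
  define b where "b = sqrt depth_beta"
  have b: "b \<ge> 0" "b \<le> r" "b\<^sup>2 = depth_beta" "cdf gauss b = 3/4"
    using depth_beta_properties r by (auto simp: b_def)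
  have "\<bar>s\<^sup>2 - depth_beta\<bar> \<le> r / k * \<eta>"
    if s: "0 \<le> s" "0 \<le> \<eta>" "\<eta> \<le> 3/8" "\<bar>measure gauss {-s..s} - 1/2\<bar> \<le> \<eta>" for s \<eta>
  proof -
    have near: "\<bar>cdf gauss s - 3/4\<bar> \<le> \<eta> / 2"
      using s(4) unfolding gauss_central_interval(1)[OF s(1)] by linarith
    have sr: "s \<le> r"
    proof (rule ccontr)
      assume "\<not> s \<le> r"
      then have "cdf gauss r \<le> cdf gauss s" by (intro gauss.cdf_nondecreasing) simp
      with near r(2) s(3) show False by linarith
    qed
    have "k * \<bar>s - b\<bar> \<le> \<bar>cdf gauss s - cdf gauss b\<bar>"
    proof (cases "b \<le> s")
      case True
      then show ?thesis using gauss_cdf_increment[OF b(1) True sr] by (simp add: k_def)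
    next
      case False
      then show ?thesis using gauss_cdf_increment[OF s(1) _ b(2)] by (simp add: k_def abs_if)
    qed
    also have "\<dots> \<le> \<eta> / 2" unfolding b(4) by (rule near)
    finally have close: "\<bar>s - b\<bar> \<le> \<eta> / 2 / k"
      by (simp only: pos_le_divide_eq[OF k] mult.commute)
    have "s\<^sup>2 - depth_beta = (s - b) * (s + b)"
      unfolding b(3)[symmetric] power2_eq_square by (simp add: algebra_simps)
    then have "\<bar>s\<^sup>2 - depth_beta\<bar> = \<bar>s - b\<bar> * (s + b)"
      using s(1) b(1) by (simp add: abs_mult)
    also have "\<dots> \<le> \<eta> / 2 / k * (2 * r)"
      using close sr b(1,2) s(1,2) k by (intro mult_mono) auto
    also have "\<dots> = r / k * \<eta>" by simp
    finally show ?thesis .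
  qed
  moreover have "r / k > 0" using k r by simp
  ultimately show ?thesis by blast
qed

text \<open>
  Coordinates with zero coefficient are dropped first, because a normal law with zero variance has
  no density.
\<close>

lemma linear_form_distributed:
  fixes w :: "nat \<Rightarrow> real"
  assumes w: "(\<Sum>j<p. (w j)\<^sup>2) > 0"
  shows "distributed (\<Pi>\<^sub>M i\<in>{..<p}. gauss) lborel (\<lambda>z. \<Sum>j<p. w j * z j)
    (normal_density 0 (sqrt (\<Sum>j<p. (w j)\<^sup>2)))"
proof -
  let ?P = "\<Pi>\<^sub>M i\<in>{..<p}. gauss"
  interpret P: prob_space ?P by (intro prob_space_PiM gauss.prob_space_axioms)
  define I where "I = {j. j < p \<and> w j \<noteq> 0}"
  have I: "finite I" "I \<subseteq> {..<p}" by (auto simp: I_def)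
  have Ine: "I \<noteq> {}"
  proof
    assume "I = {}"
    then have "(\<Sum>j<p. (w j)\<^sup>2) = 0" by (intro sum.neutral) (auto simp: I_def)
    with w show False by simp
  qed
  have pne: "{..<p} \<noteq> {}" using Ine I by auto
  have comp: "distr ?P gauss (\<lambda>z. z j) = gauss" if "j \<in> {..<p}" for j
    using that by (intro distr_PiM_component gauss.prob_space_axioms)
  have "distr ?P ?P (\<lambda>z. \<lambda>j\<in>{..<p}. z j) = distr ?P ?P (\<lambda>z. z)"
    by (rule distr_cong) (auto simp: space_PiM)
  also have "\<dots> = (\<Pi>\<^sub>M j\<in>{..<p}. distr ?P gauss (\<lambda>z. z j))"
    unfolding distr_id by (rule PiM_cong[OF refl comp[symmetric]])
  finally have "P.indep_vars (\<lambda>_. gauss) (\<lambda>j z. z j) {..<p}"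
    by (subst P.indep_vars_iff_distr_eq_PiM'[OF pne]) (auto intro: measurable_component_singleton)
  then have "P.indep_vars (\<lambda>_. gauss) (\<lambda>j z. z j) I" using I(2) by (rule P.indep_vars_subset)
  then have indep: "P.indep_vars (\<lambda>_. borel) (\<lambda>j z. w j * z j) I"
    by (rule P.indep_vars_compose2[where Y = "\<lambda>j x. w j * x"]) auto
  have normal: "distributed ?P lborel (\<lambda>z. w j * z j) (normal_density 0 \<bar>w j\<bar>)" if j: "j \<in> I" for j
  proof -
    have jp: "j \<in> {..<p}" "w j \<noteq> 0" using j by (auto simp: I_def)
    have "distr ?P lborel (\<lambda>z. z j) = distr ?P gauss (\<lambda>z. z j)" by (rule distr_cong) auto
    moreover have "(\<lambda>z. z j) \<in> measurable ?P lborel"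
      using measurable_component_singleton[OF jp(1), of "\<lambda>_. gauss"] by simp
    ultimately have "distributed ?P lborel (\<lambda>z. z j) std_normal_density"
      by (simp add: distributed_def comp[OF jp(1)])
    from P.normal_density_affine[OF this _ jp(2), of 0] show ?thesis by simp
  qed
  have "distributed ?P lborel (\<lambda>z. \<Sum>j\<in>I. w j * z j)
      (normal_density (\<Sum>j\<in>I. 0) (sqrt (\<Sum>j\<in>I. \<bar>w j\<bar>\<^sup>2)))"
    using indep normal by (intro P.sum_indep_normal I Ine) (auto simp: I_def)
  moreover have "(\<Sum>j\<in>I. \<bar>w j\<bar>\<^sup>2) = (\<Sum>j<p. (w j)\<^sup>2)"
    using I by (intro sum.mono_neutral_cong_left) (auto simp: I_def)
  moreover have "(\<lambda>z. \<Sum>j\<in>I. w j * z j) = (\<lambda>z. \<Sum>j<p. w j * z j)"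
    using I by (intro ext sum.mono_neutral_left) (auto simp: I_def)
  ultimately show ?thesis by simp
qed

lemma linear_form_normal_probability:
  fixes w :: "nat \<Rightarrow> real"
  assumes "A \<in> sets borel" "s > 0" "s\<^sup>2 = (\<Sum>j<p. (w j)\<^sup>2)"
  shows "measure (\<Pi>\<^sub>M i\<in>{..<p}. gauss) {z \<in> space (\<Pi>\<^sub>M i\<in>{..<p}. gauss). (\<Sum>j<p. w j * z j) / s \<in> A} = measure gauss A"
proof -
  let ?P = "\<Pi>\<^sub>M i\<in>{..<p}. gauss"
  interpret P: prob_space ?P by (intro prob_space_PiM gauss.prob_space_axioms)
  have pos: "(\<Sum>j<p. (w j)\<^sup>2) > 0" unfolding assms(3)[symmetric] using assms(2) by simp
  have "sqrt (\<Sum>j<p. (w j)\<^sup>2) = s" unfolding assms(3)[symmetric] using assms(2) by simp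
  with linear_form_distributed[OF pos]
  have "distributed ?P lborel (\<lambda>z. ((\<Sum>j<p. w j * z j) - 0) / s) std_normal_density"
    by (subst P.normal_standard_normal_convert[OF assms(2), symmetric]) simp
  then have d: "distr ?P lborel (\<lambda>z. (\<Sum>j<p. w j * z j) / s) = gauss"
    and m: "(\<lambda>z. (\<Sum>j<p. w j * z j) / s) \<in> measurable ?P lborel"
    by (simp_all add: distributed_def)
  have "measure gauss A = measure (distr ?P lborel (\<lambda>z. (\<Sum>j<p. w j * z j) / s)) A" by (simp only: d)
  also have "\<dots> = P.prob ((\<lambda>z. (\<Sum>j<p. w j * z j) / s) -` A \<inter> space ?P)"
    using assms(1) by (intro measure_distr m) simp
  also have "(\<lambda>z. (\<Sum>j<p. w j * z j) / s) -` A \<inter> space ?P = {z \<in> space ?P. (\<Sum>j<p. w j * z j) / s \<in> A}" by auto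
  finally show ?thesis by simp
qed

lemma cov_factor:
  assumes "psd_mat p S"
  shows "cov_factor p S \<in> carrier_mat p p" "cov_factor p S * transpose_mat (cov_factor p S) = S"
proof -
  have "\<exists>A. A \<in> carrier_mat p p \<and> A * transpose_mat A = S" using psd_mat_factor[OF assms] by blast
  from someI_ex[OF this] show "cov_factor p S \<in> carrier_mat p p"
    "cov_factor p S * transpose_mat (cov_factor p S) = S" unfolding cov_factor_def by auto
qed

lemma measurable_cov_map:
  assumes A: "A \<in> carrier_mat p p"
  shows "(\<lambda>z. A *\<^sub>v Matrix.vec p z) \<in> measurable (\<Pi>\<^sub>M i\<in>{..<p}. gauss) (borel_vec p)"
  unfolding borel_vec_def
proof (rule measurable_vimage_algebra2)
  show "(\<lambda>z. A *\<^sub>v Matrix.vec p z) \<in> space (\<Pi>\<^sub>M i\<in>{..<p}. gauss) \<rightarrow> carrier_vec p" using A by auto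
  have "(\<lambda>z. \<Sum>j<p. A $$ (i, j) * z j) \<in> borel_measurable (\<Pi>\<^sub>M i\<in>{..<p}. gauss)" for i
  proof (intro borel_measurable_sum borel_measurable_times)
    fix j assume "j \<in> {..<p}"
    then show "(\<lambda>z. z j) \<in> borel_measurable (\<Pi>\<^sub>M i\<in>{..<p}. gauss)"
      using measurable_component_singleton[of j "{..<p}" "\<lambda>_. gauss"] by simp
  qed simp
  then have "(\<lambda>z. \<lambda>i\<in>{..<p}. \<Sum>j<p. A $$ (i, j) * z j) \<in> measurable (\<Pi>\<^sub>M i\<in>{..<p}. gauss) (\<Pi>\<^sub>M i\<in>{..<p}. borel)"
    by (intro measurable_restrict)
  moreover have "(\<lambda>i\<in>{..<p}. \<Sum>j<p. A $$ (i, j) * z j) = (\<lambda>i\<in>{..<p}. (A *\<^sub>v Matrix.vec p z) $ i)" for z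
    using A by (intro restrict_ext) (auto simp: mult_mat_vec_def scalar_prod_def atLeast0LessThan)
  ultimately show "(\<lambda>z. \<lambda>i\<in>{..<p}. (A *\<^sub>v Matrix.vec p z) $ i) \<in> measurable (\<Pi>\<^sub>M i\<in>{..<p}. gauss) (\<Pi>\<^sub>M i\<in>{..<p}. borel)"
    by simp
qed

lemma prob_space_centered_normal:
  assumes "psd_mat p S"
  shows "prob_space (centered_normal p S)"
proof -
  interpret P: prob_space "\<Pi>\<^sub>M i\<in>{..<p}. gauss" by (intro prob_space_PiM gauss.prob_space_axioms)
  show ?thesis unfolding centered_normal_def
    by (rule P.prob_space_distr[OF measurable_cov_map[OF cov_factor(1)[OF assms]]])
qed

lemma sets_centered_normal [simp]: "sets (centered_normal p S) = sets (borel_vec p)"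
  by (simp add: centered_normal_def)

lemma space_centered_normal [simp]: "space (centered_normal p S) = carrier_vec p"
  by (simp add: centered_normal_def)

text \<open>
  With \<open>B\<close> the factor of \<open>S\<close>, the projection is a linear form in independent standard normals
  with coefficient vector \<open>B\<^sup>T u\<close>, whose squared norm is \<open>u \<bullet> S u\<close>.
\<close>

lemma centered_normal_projection:
  assumes S: "psd_mat p S" and u: "u \<in> carrier_vec p" and A: "A \<in> sets borel"
  shows "measure (centered_normal p S) {v \<in> carrier_vec p. u \<bullet> v \<in> A} =
    (if u \<bullet> (S *\<^sub>v u) = 0 then indicator A 0 else measure gauss {x. sqrt (u \<bullet> (S *\<^sub>v u)) * x \<in> A})"
proof -
  let ?P = "\<Pi>\<^sub>M i\<in>{..<p}. gauss"
  interpret P: prob_space ?P by (intro prob_space_PiM gauss.prob_space_axioms)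
  define B where "B = cov_factor p S"
  have B: "B \<in> carrier_mat p p" "B * transpose_mat B = S" using cov_factor[OF S] by (auto simp: B_def)
  define w where "w = transpose_mat B *\<^sub>v u"
  have w: "w \<in> carrier_vec p" using B u by (simp add: w_def)
  have q: "u \<bullet> (S *\<^sub>v u) = (\<Sum>j<p. (w $ j)\<^sup>2)"
    unfolding quadratic_form_factor[OF B u] w_def[symmetric]
    using w by (simp add: scalar_prod_carrier power2_eq_square)
  have proj: "u \<bullet> (B *\<^sub>v Matrix.vec p z) = (\<Sum>j<p. w $ j * z j)" for z
  proof -
    have "u \<bullet> (B *\<^sub>v Matrix.vec p z) = w \<bullet> Matrix.vec p z"
      unfolding w_def using B u by (subst transpose_vec_mult_scalar[of B p p]) auto
    then show ?thesis by (simp add: scalar_prod_def atLeast0LessThan)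
  qed
  have meas: "{v \<in> carrier_vec p. u \<bullet> v \<in> A} \<in> sets (borel_vec p)"
    using measurable_sets[OF measurable_scalar_prod[of u p] A] by (simp add: vimage_def Int_def conj_commute)
  have "measure (centered_normal p S) {v \<in> carrier_vec p. u \<bullet> v \<in> A}
      = P.prob ((\<lambda>z. B *\<^sub>v Matrix.vec p z) -` {v \<in> carrier_vec p. u \<bullet> v \<in> A} \<inter> space ?P)"
    unfolding centered_normal_def B_def[symmetric] by (rule measure_distr[OF measurable_cov_map[OF B(1)] meas])
  also have "(\<lambda>z. B *\<^sub>v Matrix.vec p z) -` {v \<in> carrier_vec p. u \<bullet> v \<in> A} \<inter> space ?P
      = {z \<in> space ?P. (\<Sum>j<p. w $ j * z j) \<in> A}"
    using B proj by auto
  finally have eq: "measure (centered_normal p S) {v \<in> carrier_vec p. u \<bullet> v \<in> A}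
      = P.prob {z \<in> space ?P. (\<Sum>j<p. w $ j * z j) \<in> A}" .
  show ?thesis
  proof (cases "u \<bullet> (S *\<^sub>v u) = 0")
    case True
    then have "w $ j = 0" if "j < p" for j using that unfolding q by (simp add: sum_nonneg_eq_0_iff)
    then have "{z \<in> space ?P. (\<Sum>j<p. w $ j * z j) \<in> A} = (if 0 \<in> A then space ?P else {})"
      by auto
    then show ?thesis using True by (auto simp: eq P.prob_space)
  next
    case False
    define s where "s = sqrt (u \<bullet> (S *\<^sub>v u))"
    have "u \<bullet> (S *\<^sub>v u) \<ge> 0" using S u by (simp add: psd_mat_def)
    then have s: "s > 0" "s\<^sup>2 = (\<Sum>j<p. (w $ j)\<^sup>2)" using False by (simp_all add: s_def q[symmetric])
    have "(\<lambda>x. s * x) -` A \<in> sets borel"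
      using measurable_sets[of "\<lambda>x. s * x" borel borel A] A by simp
    then have "{x. s * x \<in> A} \<in> sets borel" by (simp add: vimage_def)
    from linear_form_normal_probability[OF this s]
    have "P.prob {z \<in> space ?P. (\<Sum>j<p. w $ j * z j) \<in> A} = measure gauss {x. s * x \<in> A}"
      using s(1) by simp
    then show ?thesis using False by (simp add: eq s_def)
  qed
qed

lemma centered_normal_slab:
  assumes S: "psd_mat p S" and u: "u \<in> carrier_vec p" and r: "r \<ge> 0"
  shows "u \<bullet> (S *\<^sub>v u) > 0 \<Longrightarrow> measure (centered_normal p S) (slab p u r) =
      measure gauss {- (r / sqrt (u \<bullet> (S *\<^sub>v u))) .. r / sqrt (u \<bullet> (S *\<^sub>v u))}"
    and "u \<bullet> (S *\<^sub>v u) > 0 \<Longrightarrow> measure (centered_normal p S) (open_slab p u r) =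
      measure gauss {- (r / sqrt (u \<bullet> (S *\<^sub>v u))) .. r / sqrt (u \<bullet> (S *\<^sub>v u))}"
    and "u \<bullet> (S *\<^sub>v u) = 0 \<Longrightarrow> measure (centered_normal p S) (slab p u r) = 1"
    and "u \<bullet> (S *\<^sub>v u) = 0 \<Longrightarrow> measure (centered_normal p S) (open_slab p u r) = (if r = 0 then 0 else 1)"
proof -
  let ?q = "sqrt (u \<bullet> (S *\<^sub>v u))"
  have slab: "slab p u r = {v \<in> carrier_vec p. u \<bullet> v \<in> {-r..r}}"
    and open_slab: "open_slab p u r = {v \<in> carrier_vec p. u \<bullet> v \<in> {-r<..<r}}"
    by (auto simp: slab_def open_slab_def)
  show "u \<bullet> (S *\<^sub>v u) = 0 \<Longrightarrow> measure (centered_normal p S) (slab p u r) = 1"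
    and "u \<bullet> (S *\<^sub>v u) = 0 \<Longrightarrow> measure (centered_normal p S) (open_slab p u r) = (if r = 0 then 0 else 1)"
    unfolding slab open_slab using r by (subst centered_normal_projection[OF S u]; simp)+
  assume pos: "u \<bullet> (S *\<^sub>v u) > 0"
  then have q: "?q > 0" by simp
  have "{x. ?q * x \<in> {-r..r}} = {- (r / ?q) .. r / ?q}" "{x. ?q * x \<in> {-r<..<r}} = {- (r / ?q) <..< r / ?q}"
    using q by (auto simp: field_simps)
  moreover have "r / ?q \<ge> 0" using r q by simp
  ultimately show "measure (centered_normal p S) (slab p u r) = measure gauss {- (r / ?q) .. r / ?q}"
    "measure (centered_normal p S) (open_slab p u r) = measure gauss {- (r / ?q) .. r / ?q}"
    unfolding slab open_slab using pos
    by (simp_all add: centered_normal_projection[OF S u] gauss_central_interval del: greaterThanLessThan_iff atLeastAtMost_iff)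
qed

section \<open>The deepest matrix\<close>

lemma contaminated:
  assumes S: "psd_mat p S" and Q: "prob_space Q" "sets Q = sets (borel_vec p)" and eps: "0 \<le> \<epsilon>" "\<epsilon> \<le> 1"
  shows "sets (contaminated p \<epsilon> S Q) = sets (borel_vec p)"
    and "prob_space (contaminated p \<epsilon> S Q)"
    and "A \<in> sets (borel_vec p) \<Longrightarrow> measure (contaminated p \<epsilon> S Q) A
      = (1 - \<epsilon>) * measure (centered_normal p S) A + \<epsilon> * measure Q A"
proof -
  interpret N: prob_space "centered_normal p S" by (rule prob_space_centered_normal[OF S])
  interpret Q: prob_space Q by fact
  have em: "emeasure (contaminated p \<epsilon> S Q) A
      = ennreal ((1 - \<epsilon>) * measure (centered_normal p S) A + \<epsilon> * measure Q A)"
    if "A \<in> sets (borel_vec p)" for A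
    unfolding contaminated_def using that eps Q(2)
    by (subst emeasure_mixture) (simp_all add: N.emeasure_eq_measure Q.emeasure_eq_measure ennreal_mult ennreal_plus)
  show "sets (contaminated p \<epsilon> S Q) = sets (borel_vec p)" by (simp add: contaminated_def)
  have "space (contaminated p \<epsilon> S Q) = carrier_vec p" by (simp add: contaminated_def)
  moreover have "space Q = carrier_vec p" using sets_eq_imp_space_eq[OF Q(2)] by simp
  moreover have "carrier_vec p \<in> sets (borel_vec p)" using sets.top[of "borel_vec p"] by simp
  ultimately have "emeasure (contaminated p \<epsilon> S Q) (space (contaminated p \<epsilon> S Q)) = 1"
    using em[of "carrier_vec p"] N.prob_space Q.prob_space by simp
  then show "prob_space (contaminated p \<epsilon> S Q)" by (rule prob_spaceI)
  show "A \<in> sets (borel_vec p) \<Longrightarrow> measure (contaminated p \<epsilon> S Q) A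
      = (1 - \<epsilon>) * measure (centered_normal p S) A + \<epsilon> * measure Q A"
    using eps by (intro measure_eq_emeasure_eq_ennreal[OF _ em]) auto
qed

definition direction_depth ::
    "nat \<Rightarrow> real mat \<Rightarrow> (nat \<Rightarrow> real Matrix.vec) \<Rightarrow> real Matrix.vec \<Rightarrow> real" where
  "direction_depth n G X u =
     min ((1 / real n) * (\<Sum>i<n. of_bool (\<bar>u \<bullet> X i\<bar>\<^sup>2 \<le> u \<bullet> (G *\<^sub>v u))))
         ((1 / real n) * (\<Sum>i<n. of_bool (\<bar>u \<bullet> X i\<bar>\<^sup>2 \<ge> u \<bullet> (G *\<^sub>v u))))"

text \<open>
  All values are of the form \<open>k / n\<close>, so the minimum is over a finite set.
\<close>

lemma matrix_depth_ge_iff: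
  assumes p: "p > 0"
  shows "d \<le> matrix_depth n p G X \<longleftrightarrow> (\<forall>u\<in>unit_sphere p. d \<le> direction_depth n G X u)"
proof -
  have count: "(\<Sum>i<n. of_bool (P i) :: real) \<in> real ` {..n}" for P
  proof -
    have "(\<Sum>i<n. of_bool (P i) :: real) = real (card {i. i < n \<and> P i})"
      by (simp add: Int_def lessThan_def)
    moreover have "card {i. i < n \<and> P i} \<le> n"
      using card_mono[of "{..<n}" "{i. i < n \<and> P i}"] by auto
    ultimately show ?thesis by auto
  qed
  have "direction_depth n G X ` unit_sphere p
      \<subseteq> (\<lambda>(a, b). min (1 / real n * a) (1 / real n * b)) ` (real ` {..n} \<times> real ` {..n})"
  proof (rule image_subsetI)
    fix u
    have "((\<Sum>i<n. of_bool (\<bar>u \<bullet> X i\<bar>\<^sup>2 \<le> u \<bullet> (G *\<^sub>v u))), (\<Sum>i<n. of_bool (\<bar>u \<bullet> X i\<bar>\<^sup>2 \<ge> u \<bullet> (G *\<^sub>v u))))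
        \<in> real ` {..n} \<times> real ` {..n}" by (intro SigmaI count)
    then show "direction_depth n G X u
        \<in> (\<lambda>(a, b). min (1 / real n * a) (1 / real n * b)) ` (real ` {..n} \<times> real ` {..n})"
      by (rule image_eqI[rotated]) (simp only: direction_depth_def split_conv)
  qed
  then have "finite (direction_depth n G X ` unit_sphere p)"
    by (rule finite_subset) auto
  then show ?thesis
    unfolding matrix_depth_def direction_depth_def[symmetric]
    using unit_sphere_nonempty[OF p] by (subst Min_ge_iff) auto
qed

lemma direction_depth_slabs:
  assumes n: "n > 0" and q: "0 \<le> u \<bullet> (G *\<^sub>v u)" and X: "\<And>i. i < n \<Longrightarrow> X i \<in> carrier_vec p"
  shows "direction_depth n G X u = min
    ((\<Sum>i<n. indicator (slab p u (sqrt (u \<bullet> (G *\<^sub>v u)))) (X i)) / real n)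
    (1 - (\<Sum>i<n. indicator (open_slab p u (sqrt (u \<bullet> (G *\<^sub>v u)))) (X i)) / real n)"
proof -
  let ?g = "u \<bullet> (G *\<^sub>v u)"
  have le: "y\<^sup>2 \<le> ?g \<longleftrightarrow> \<bar>y\<bar> \<le> sqrt ?g" and ge: "?g \<le> y\<^sup>2 \<longleftrightarrow> \<not> \<bar>y\<bar> < sqrt ?g" for y :: real
    by (simp_all flip: real_sqrt_abs add: not_less)
  have "(\<Sum>i<n. of_bool (\<bar>u \<bullet> X i\<bar>\<^sup>2 \<le> ?g)) = (\<Sum>i<n. indicator (slab p u (sqrt ?g)) (X i) :: real)"
    using X by (intro sum.cong) (auto simp: slab_def le indicator_def)
  moreover have "(\<Sum>i<n. of_bool (\<bar>u \<bullet> X i\<bar>\<^sup>2 \<ge> ?g)) = (\<Sum>i<n. 1 - indicator (open_slab p u (sqrt ?g)) (X i) :: real)"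
  proof (rule sum.cong[OF refl])
    fix i assume "i \<in> {..<n}"
    then show "of_bool (?g \<le> \<bar>u \<bullet> X i\<bar>\<^sup>2) = (1 - indicator (open_slab p u (sqrt ?g)) (X i) :: real)"
      using X[of i] by (auto simp: open_slab_def ge indicator_def)
  qed
  ultimately show ?thesis
    using n by (simp add: direction_depth_def sum_subtractf diff_divide_distrib)
qed

text \<open>
  The comparison with \<open>\<beta> S\<close>. The depth of the maximizer in direction \<open>u\<close> bounds the mass of the
  closed slab from below and that of the open slab from above; outside the degenerate directions the
  Gaussian law charges both equally, which pins this mass to \<open>1/2\<close> up to \<open>\<eta>\<close>.
\<close>

lemma depth_maximizer_quadratic_form:
  assumes p: "p > 0" and n: "n > 0" and S: "S \<in> cov_class p M" and M: "M > 0"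
    and Q: "prob_space Q" "sets Q = sets (borel_vec p)" and eps: "0 \<le> \<epsilon>" "\<epsilon> < 1/5"
    and X: "\<And>i. i < n \<Longrightarrow> X i \<in> carrier_vec p"
    and G: "is_arg_max (\<lambda>G. matrix_depth n p G X) (psd_mat p) G"
    and \<Delta>: "\<Delta> \<le> 1/20"
    and dev: "\<And>u r. u \<in> carrier_vec p \<Longrightarrow>
      \<bar>(\<Sum>i<n. indicator (slab p u r) (X i)) / real n - measure (contaminated p \<epsilon> S Q) (slab p u r)\<bar> \<le> \<Delta>"
    and dev_open: "\<And>u r. u \<in> carrier_vec p \<Longrightarrow>
      \<bar>(\<Sum>i<n. indicator (open_slab p u r) (X i)) / real n - measure (contaminated p \<epsilon> S Q) (open_slab p u r)\<bar> \<le> \<Delta>"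
    and K: "K > 0" "\<And>s \<eta>. 0 \<le> s \<Longrightarrow> 0 \<le> \<eta> \<Longrightarrow> \<eta> \<le> 3/8 \<Longrightarrow> \<bar>measure gauss {-s..s} - 1/2\<bar> \<le> \<eta> \<Longrightarrow>
     \<bar>s\<^sup>2 - depth_beta\<bar> \<le> K * \<eta>"
    and u: "u \<in> unit_sphere p"
  shows "\<bar>u \<bullet> (G *\<^sub>v u) - depth_beta * (u \<bullet> (S *\<^sub>v u))\<bar> \<le> M * (K * (5/4 * (\<epsilon> + 2 * \<Delta>)))"
proof -
  have psdS: "psd_mat p S" using S by (simp add: cov_class_def)
  have Sc: "S \<in> carrier_mat p p" using psdS by (simp add: psd_mat_def)
  have psdG: "psd_mat p G" using G by (simp add: is_arg_max_def)
  define \<beta> where "\<beta> = depth_beta"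
  have \<beta>: "\<beta> > 0" "cdf gauss (sqrt \<beta>) = 3/4" using depth_beta_properties by (auto simp: \<beta>_def)
  have \<Delta>0: "0 \<le> \<Delta>"
  proof -
    have "\<bar>(\<Sum>i<n. indicator (slab p u 0) (X i)) / real n - measure (contaminated p \<epsilon> S Q) (slab p u 0)\<bar> \<le> \<Delta>"
      using u by (intro dev) (simp add: unit_sphere_iff)
    then show ?thesis by linarith
  qed
  interpret Q: prob_space Q by fact
  note mixture = contaminated(3)[OF psdS Q eps(1)]
  have mix: "measure (contaminated p \<epsilon> S Q) A = (1 - \<epsilon>) * measure (centered_normal p S) A + \<epsilon> * measure Q A"
    if "A \<in> sets (borel_vec p)" for A using mixture[OF _ that] eps by simp
  have lower: "(1 - \<epsilon>) * measure (centered_normal p S) A \<le> measure (contaminated p \<epsilon> S Q) A"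
    if "A \<in> sets (borel_vec p)" for A using mix[OF that] eps by simp
  have upper: "measure (contaminated p \<epsilon> S Q) A \<le> (1 - \<epsilon>) * measure (centered_normal p S) A + \<epsilon>"
    if "A \<in> sets (borel_vec p)" for A
    using mix[OF that] mult_left_mono[OF Q.prob_le_1[of A] eps(1)] by simp
  define B where "B = \<beta> \<cdot>\<^sub>m S"
  have qB: "v \<bullet> (B *\<^sub>v v) = \<beta> * (v \<bullet> (S *\<^sub>v v))" if v: "v \<in> carrier_vec p" for v
  proof -
    have "B *\<^sub>v v = \<beta> \<cdot>\<^sub>v (S *\<^sub>v v)" unfolding B_def using Sc v by (intro eq_vecI) auto
    then show ?thesis using Sc v by simp
  qed
  have psdB: "psd_mat p B"
    unfolding psd_mat_def
  proof (intro conjI ballI)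
    show "B \<in> carrier_mat p p" using Sc by (simp add: B_def)
    show "transpose_mat B = B"
      using Sc psd_mat_symmetric[OF psdS] by (intro eq_matI) (auto simp: B_def)
    show "0 \<le> v \<bullet> (B *\<^sub>v v)" if "v \<in> carrier_vec p" for v
      using qB[OF that] \<beta>(1) psdS that by (simp add: psd_mat_def)
  qed
  have "(1 - \<epsilon>) / 2 - \<Delta> \<le> matrix_depth n p B X"
    unfolding matrix_depth_ge_iff[OF p]
  proof
    fix v assume "v \<in> unit_sphere p"
    then have v: "v \<in> carrier_vec p" by (simp add: unit_sphere_iff)
    let ?q = "v \<bullet> (S *\<^sub>v v)"
    have q0: "0 \<le> ?q" using psdS v by (simp add: psd_mat_def)
    define r where "r = sqrt (\<beta> * ?q)"
    have r0: "r \<ge> 0" using q0 \<beta>(1) by (simp add: r_def)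
    have half: "1/2 \<le> measure (centered_normal p S) (slab p v r)"
      "measure (centered_normal p S) (open_slab p v r) \<le> 1/2"
    proof -
      have "1/2 \<le> measure (centered_normal p S) (slab p v r)
        \<and> measure (centered_normal p S) (open_slab p v r) \<le> 1/2"
      proof (cases "?q = 0")
        case True
        then show ?thesis using centered_normal_slab(3,4)[OF psdS v r0] by (simp add: r_def)
      next
        case False
        with q0 have pos: "?q > 0" by simp
        have "r / sqrt ?q = sqrt \<beta>" using pos by (simp add: r_def real_sqrt_mult)
        then show ?thesis using centered_normal_slab(1,2)[OF psdS v r0 pos] \<beta>
          by (simp add: gauss_central_interval)
      qed
      then show "1/2 \<le> measure (centered_normal p S) (slab p v r)"
        "measure (centered_normal p S) (open_slab p v r) \<le> 1/2" by auto
    qed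
    have "(1 - \<epsilon>) * (1/2) \<le> (1 - \<epsilon>) * measure (centered_normal p S) (slab p v r)"
      using eps half(1) by (intro mult_left_mono) auto
    then have 1: "(1 - \<epsilon>) / 2 - \<Delta> \<le> (\<Sum>i<n. indicator (slab p v r) (X i)) / real n"
      using dev[OF v, of r] lower[OF sets_slab(1), of v r] by linarith
    have "(1 - \<epsilon>) * measure (centered_normal p S) (open_slab p v r) \<le> (1 - \<epsilon>) * (1/2)"
      using eps half(2) by (intro mult_left_mono) auto
    then have "measure (contaminated p \<epsilon> S Q) (open_slab p v r) \<le> (1 - \<epsilon>) * (1/2) + \<epsilon>"
      by (intro order_trans[OF upper[OF sets_slab(2)]] add_right_mono)
    moreover have "(1 - \<epsilon>) * (1/2) + \<epsilon> = 1 - (1 - \<epsilon>) / 2" by (simp add: field_simps)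
    ultimately have 2: "(1 - \<epsilon>) / 2 - \<Delta> \<le> 1 - (\<Sum>i<n. indicator (open_slab p v r) (X i)) / real n"
      using dev_open[OF v, of r] by linarith
    have "direction_depth n B X v = min
      ((\<Sum>i<n. indicator (slab p v r) (X i)) / real n)
      (1 - (\<Sum>i<n. indicator (open_slab p v r) (X i)) / real n)"
      using direction_depth_slabs[OF n _ X, of v B] qB[OF v] q0 \<beta>(1) by (simp add: r_def)
    then show "(1 - \<epsilon>) / 2 - \<Delta> \<le> direction_depth n B X v" using 1 2 by simp
  qed
  also have "\<dots> \<le> matrix_depth n p G X"
    using G psdB by (auto simp: is_arg_max_def not_less)
  finally have dG: "(1 - \<epsilon>) / 2 - \<Delta> \<le> direction_depth n G X u"
    using u unfolding matrix_depth_ge_iff[OF p] by blast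
  have uc: "u \<in> carrier_vec p" and uu: "u \<bullet> u = 1" using u by (auto simp: unit_sphere_iff)
  define q where "q = u \<bullet> (S *\<^sub>v u)"
  define g where "g = u \<bullet> (G *\<^sub>v u)"
  define r where "r = sqrt g"
  have q0: "0 \<le> q" and g0: "0 \<le> g" using psdS psdG uc by (auto simp: psd_mat_def q_def g_def)
  have r0: "r \<ge> 0" and r2: "r\<^sup>2 = g" using g0 by (auto simp: r_def)
  define \<eta> where "\<eta> = 5/4 * (\<epsilon> + 2 * \<Delta>)"
  have \<eta>: "0 \<le> \<eta>" "\<eta> \<le> 3/8" "\<epsilon> + 2 * \<Delta> \<le> (1 - \<epsilon>) * \<eta>"
  proof -
    show e: "0 \<le> \<eta>" "\<eta> \<le> 3/8" using eps \<Delta> \<Delta>0 by (auto simp: \<eta>_def)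
    \<comment> \<open>The factor \<open>5/4\<close> in \<open>\<eta>\<close> is an upper bound for \<open>1 / (1 - \<epsilon>)\<close>.\<close>
    have "4/5 * \<eta> \<le> (1 - \<epsilon>) * \<eta>" using eps e by (intro mult_right_mono) auto
    then show "\<epsilon> + 2 * \<Delta> \<le> (1 - \<epsilon>) * \<eta>" by (simp add: \<eta>_def)
  qed
  have "direction_depth n G X u = min
      ((\<Sum>i<n. indicator (slab p u r) (X i)) / real n)
      (1 - (\<Sum>i<n. indicator (open_slab p u r) (X i)) / real n)"
    using direction_depth_slabs[OF n _ X, of u G] g0 by (simp add: r_def g_def)
  then have d1: "(1 - \<epsilon>) / 2 - \<Delta> \<le> (\<Sum>i<n. indicator (slab p u r) (X i)) / real n"
    and d2: "(1 - \<epsilon>) / 2 - \<Delta> \<le> 1 - (\<Sum>i<n. indicator (open_slab p u r) (X i)) / real n"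
    using dG by simp_all
  have ge: "1/2 - \<eta> \<le> measure (centered_normal p S) (slab p u r)"
  proof -
    have "(1 - \<epsilon>) / 2 - (\<epsilon> + 2 * \<Delta>) \<le> (1 - \<epsilon>) * measure (centered_normal p S) (slab p u r)"
      using d1 dev[OF uc, of r] upper[OF sets_slab(1), of u r] by linarith
    moreover have "(1 - \<epsilon>) * (1/2 - \<eta>) = (1 - \<epsilon>) / 2 - (1 - \<epsilon>) * \<eta>"
      by (simp add: right_diff_distrib)
    ultimately have "(1 - \<epsilon>) * (1/2 - \<eta>) \<le> (1 - \<epsilon>) * measure (centered_normal p S) (slab p u r)"
      using \<eta>(3) by linarith
    then show ?thesis using eps by (simp only: mult_le_cancel_left_pos[of "1 - \<epsilon>"])
  qed
  have le: "measure (centered_normal p S) (open_slab p u r) \<le> 1/2 + \<eta>"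
  proof -
    have "(1 - \<epsilon>) * measure (centered_normal p S) (open_slab p u r) \<le> (1 - \<epsilon>) / 2 + (\<epsilon> + 2 * \<Delta>)"
    proof -
      have "1 - (1 - \<epsilon>) / 2 = (1 - \<epsilon>) / 2 + \<epsilon>" by (simp add: field_simps)
      then show ?thesis
        using d2 dev_open[OF uc, of r] lower[OF sets_slab(2), of u r] by linarith
    qed
    moreover have "(1 - \<epsilon>) * (1/2 + \<eta>) = (1 - \<epsilon>) / 2 + (1 - \<epsilon>) * \<eta>"
      by (simp add: distrib_left)
    ultimately have "(1 - \<epsilon>) * measure (centered_normal p S) (open_slab p u r) \<le> (1 - \<epsilon>) * (1/2 + \<eta>)"
      using \<eta>(3) by linarith
    then show ?thesis using eps by (simp only: mult_le_cancel_left_pos[of "1 - \<epsilon>"])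
  qed
  have "\<bar>g - \<beta> * q\<bar> \<le> M * (K * \<eta>)"
  proof (cases "q = 0")
    case True
    \<comment> \<open>The projection is concentrated at zero, so an open slab of positive radius would have mass one.\<close>
    have "r = 0"
    proof (rule ccontr)
      assume "r \<noteq> 0"
      then have "measure (centered_normal p S) (open_slab p u r) = 1"
        using centered_normal_slab(4)[OF psdS uc r0] True by (simp add: q_def)
      with le \<eta>(2) show False by simp
    qed
    then have "g = 0" using r2 by simp
    then show ?thesis using True M K(1) \<eta>(1) by simp
  next
    case False
    with q0 have pos: "q > 0" by simp
    define s where "s = r / sqrt q"
    have s: "0 \<le> s" "s\<^sup>2 = g / q" using r0 pos by (simp_all add: s_def power_divide r2)
    have "measure (centered_normal p S) (slab p u r) = measure gauss {-s..s}"
      "measure (centered_normal p S) (open_slab p u r) = measure gauss {-s..s}"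
      using centered_normal_slab(1,2)[OF psdS uc r0] pos by (simp_all add: s_def q_def)
    with ge le have "\<bar>measure gauss {-s..s} - 1/2\<bar> \<le> \<eta>" by linarith
    then have "\<bar>g / q - \<beta>\<bar> \<le> K * \<eta>" using K(2)[OF s(1) \<eta>(1,2)] by (simp add: s(2) \<beta>_def)
    then have "q * \<bar>g / q - \<beta>\<bar> \<le> q * (K * \<eta>)" using pos by (intro mult_left_mono) auto
    also have "q * \<bar>g / q - \<beta>\<bar> = \<bar>q * (g / q - \<beta>)\<bar>" using pos by (simp add: abs_mult)
    also have "q * (g / q - \<beta>) = g - \<beta> * q" using pos by (simp add: right_diff_distrib)
    also have "q * (K * \<eta>) \<le> M * (K * \<eta>)"
      using cov_class_quadratic_form_le[OF S M uc] uu K(1) \<eta>(1) by (intro mult_right_mono) (auto simp: q_def)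
    finally show ?thesis .
  qed
  then show ?thesis by (simp only: g_def q_def \<beta>_def \<eta>_def)
qed

lemma depth_estimator_op_norm:
  assumes p: "p > 0" and S: "psd_mat p S" and G: "psd_mat p G" and b: "b > 0"
    and bound: "\<And>u. u \<in> unit_sphere p \<Longrightarrow> \<bar>u \<bullet> (G *\<^sub>v u) - b * (u \<bullet> (S *\<^sub>v u))\<bar> \<le> c"
  shows "(op_norm ((1 / b) \<cdot>\<^sub>m G - S))\<^sup>2 \<le> (c / b)\<^sup>2"
proof -
  have Sc: "S \<in> carrier_mat p p" and Gc: "G \<in> carrier_mat p p" using S G by (auto simp: psd_mat_def)
  define A where "A = (1 / b) \<cdot>\<^sub>m G - S"
  have A: "A \<in> carrier_mat p p" unfolding A_def using Sc by (intro minus_carrier_mat)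
  have At: "transpose_mat A = A"
    using Sc Gc psd_mat_symmetric[OF S] psd_mat_symmetric[OF G] by (intro eq_matI) (auto simp: A_def)
  have "\<bar>u \<bullet> (A *\<^sub>v u)\<bar> \<le> c / b" if u: "u \<in> unit_sphere p" for u
  proof -
    have uc: "u \<in> carrier_vec p" using u by (simp add: unit_sphere_iff)
    have "A *\<^sub>v u = (1 / b) \<cdot>\<^sub>v (G *\<^sub>v u) - S *\<^sub>v u"
    proof -
      have "A *\<^sub>v u = ((1 / b) \<cdot>\<^sub>m G) *\<^sub>v u - S *\<^sub>v u"
        unfolding A_def using Sc Gc uc by (intro minus_mult_distrib_mat_vec[of _ p p]) auto
      moreover have "((1 / b) \<cdot>\<^sub>m G) *\<^sub>v u = (1 / b) \<cdot>\<^sub>v (G *\<^sub>v u)"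
        using Gc uc by (intro eq_vecI) auto
      ultimately show ?thesis by simp
    qed
    then have "u \<bullet> (A *\<^sub>v u) = (1 / b) * (u \<bullet> (G *\<^sub>v u)) - u \<bullet> (S *\<^sub>v u)"
      using Sc Gc uc by (simp add: scalar_prod_minus_distrib[of _ p])
    also have "\<dots> = (u \<bullet> (G *\<^sub>v u) - b * (u \<bullet> (S *\<^sub>v u))) / b"
      using b by (simp add: diff_divide_distrib)
    finally show ?thesis using bound[OF u] b by (simp add: divide_right_mono)
  qed
  from op_norm_le_quadratic_form_bound[OF A At p this]
  show ?thesis unfolding A_def[symmetric] by (intro power_mono)
qed

theorem theorem3p1:
  fixes M :: real
  assumes "M > 0"
  shows "\<exists>C > 0. \<exists>C1 > 0. \<forall>(n::nat) (p::nat) (\<epsilon>::real) (\<delta>::real)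
           (Ghat :: (nat \<Rightarrow> real Matrix.vec) \<Rightarrow> real mat) (Q :: real Matrix.vec measure) (S :: real mat).
      n > 0 \<longrightarrow> p > 0 \<longrightarrow>
      0 \<le> \<epsilon> \<longrightarrow> \<epsilon> < 1 / 5 \<longrightarrow>
      (\<forall>X \<in> space (\<Pi>\<^sub>M i\<in>{..<n}. borel_vec p).
         is_arg_max (\<lambda>G. matrix_depth n p G X) (psd_mat p) (Ghat X)) \<longrightarrow>
      0 < \<delta> \<longrightarrow> \<delta> < 1 / 2 \<longrightarrow>
      C1 * ((real p + ln (1 / \<delta>)) / real n) < 1 \<longrightarrow>
      prob_space Q \<longrightarrow> sets Q = sets (borel_vec p) \<longrightarrow>
      S \<in> cov_class p M \<longrightarrow> S \<noteq> 0\<^sub>m p p \<longrightarrow>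
      (\<exists>E \<in> sets (sample_law n p \<epsilon> S Q).
         measure (sample_law n p \<epsilon> S Q) E \<ge> 1 - 2 * \<delta> \<and>
         (\<forall>X \<in> E. (op_norm ((1 / depth_beta) \<cdot>\<^sub>m Ghat X - S))\<^sup>2
            \<le> C * (max (real p / real n) (\<epsilon>\<^sup>2) + ln (1 / \<delta>) / real n)))"
proof -
  obtain K where K: "K > 0" "\<And>s \<eta>. 0 \<le> s \<Longrightarrow> 0 \<le> \<eta> \<Longrightarrow> \<eta> \<le> 3/8 \<Longrightarrow> \<bar>measure gauss {-s..s} - 1/2\<bar> \<le> \<eta> \<Longrightarrow>
     \<bar>s\<^sup>2 - depth_beta\<bar> \<le> K * \<eta>"
    using gauss_quantile_stability by blast
  \<comment> \<open>The constant in \<open>\<Delta>\<^sup>2 \<le> B * (p + L) / n\<close>: squaring the threshold of the deviation bound gives \<open>12800 * W / n\<close>,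
    and \<open>W \<le> 83 * (p + L)\<close>. The sample size condition with \<open>400 * B\<close> then yields \<open>\<Delta> \<le> 1/20\<close>.\<close>
  define B :: real where "B = 12800 * 83"
  define C where "C = (M * K * (5/4) / depth_beta)\<^sup>2 * (2 + 8 * B)"
  have \<beta>: "depth_beta > 0" by (rule depth_beta_properties(1))
  have C: "C > 0" and B: "400 * B > 0" using assms K(1) \<beta> by (simp_all add: C_def B_def)
  show ?thesis
  proof (rule exI[of _ C], rule conjI[OF C], rule exI[of _ "400 * B"], rule conjI[OF B], intro allI impI)
    fix n p :: nat and \<epsilon> \<delta> :: real and Ghat :: "(nat \<Rightarrow> real Matrix.vec) \<Rightarrow> real mat"
      and Q :: "real Matrix.vec measure" and S :: "real mat"
    assume n: "n > 0" and p: "p > 0" and eps: "0 \<le> \<epsilon>" "\<epsilon> < 1 / 5"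
      and Ghat: "\<forall>X \<in> space (\<Pi>\<^sub>M i\<in>{..<n}. borel_vec p).
         is_arg_max (\<lambda>G. matrix_depth n p G X) (psd_mat p) (Ghat X)"
      and \<delta>: "0 < \<delta>" "\<delta> < 1 / 2"
      and size: "400 * B * ((real p + ln (1 / \<delta>)) / real n) < 1"
      and Q: "prob_space Q" "sets Q = sets (borel_vec p)"
      and S: "S \<in> cov_class p M" "S \<noteq> 0\<^sub>m p p"
    have psdS: "psd_mat p S" using S by (simp add: cov_class_def)
    define L where "L = ln (1 / \<delta>)"
    \<comment> \<open>Chosen so that the failure probability \<open>24 * exp (- x)\<close> is \<open>2 * \<delta>\<close>.\<close>
    define x where "x = ln 12 + L"
    have L: "L > 0" using \<delta> by (simp add: L_def)
    have expx: "exp (- x) = \<delta> / 12"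
      using \<delta> by (simp add: x_def L_def exp_add exp_minus ln_div exp_diff)
    have ln12: "ln 2 \<le> ln (12 :: real)" "ln (12 :: real) \<le> 11"
      using ln_le_minus_one[of "12 :: real"] by simp_all
    have x: "x \<ge> ln 2" using ln12(1) L unfolding x_def by linarith
    let ?P = "contaminated p \<epsilon> S Q"
    have P: "sets ?P = sets (borel_vec p)" "prob_space ?P"
      using contaminated(1,2)[OF psdS Q eps(1)] eps by auto
    define W where "W = 18 * real (2 * (p + 1)) + x"
    define c where "c = 20 * sqrt (32 * real n * W)"
    obtain E where E: "E \<in> sets (\<Pi>\<^sub>M i\<in>{..<n}. ?P)" "measure (\<Pi>\<^sub>M i\<in>{..<n}. ?P) E \<ge> 1 - 24 * exp (- x)"
      and dev: "\<And>X u r. X \<in> E \<Longrightarrow> u \<in> carrier_vec p \<Longrightarrow>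
         \<bar>(\<Sum>i<n. indicator (slab p u r) (X i)) - real n * measure ?P (slab p u r)\<bar> \<le> c"
      and dev_open: "\<And>X u r. X \<in> E \<Longrightarrow> u \<in> carrier_vec p \<Longrightarrow>
         \<bar>(\<Sum>i<n. indicator (open_slab p u r) (X i)) - real n * measure ?P (open_slab p u r)\<bar> \<le> c"
      using slab_deviation[OF P(2,1) n x] unfolding c_def W_def by blast
    define \<Delta> where "\<Delta> = c / real n"
    have W: "0 \<le> W" "W \<le> 83 * (real p + L)"
      using ln12 L p by (auto simp: W_def x_def)
    have \<Delta>2: "\<Delta>\<^sup>2 \<le> B * (real p / real n + L / real n)"
    proof -
      have "\<Delta>\<^sup>2 = 12800 * W / real n"
        using n W(1) by (simp add: \<Delta>_def c_def power_divide power_mult_distrib power2_eq_square[of "real n"])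
      also have "\<dots> \<le> 12800 * (83 * (real p + L)) / real n"
        using W(2) by (intro divide_right_mono mult_left_mono) auto
      also have "\<dots> = B * (real p / real n + L / real n)" by (simp add: B_def add_divide_distrib)
      finally show ?thesis .
    qed
    have \<Delta>: "0 \<le> \<Delta>" "\<Delta> \<le> 1/20"
    proof -
      show "0 \<le> \<Delta>" using W by (simp add: \<Delta>_def c_def)
      have "400 * (B * (real p / real n + L / real n)) < 1"
        using size by (simp add: L_def add_divide_distrib)
      with \<Delta>2 have "\<Delta>\<^sup>2 \<le> (1/20)\<^sup>2" by (simp add: power2_eq_square)
      then show "\<Delta> \<le> 1/20" by (rule power2_le_imp_le) simp
    qed
    have scaled: "\<bar>a / real n - b\<bar> \<le> \<Delta>" if "\<bar>a - real n * b\<bar> \<le> c" for a b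
    proof -
      have "a / real n - b = (a - real n * b) / real n" using n by (simp add: diff_divide_distrib)
      then have "\<bar>a / real n - b\<bar> = \<bar>a - real n * b\<bar> / real n" by simp
      then show ?thesis using that unfolding \<Delta>_def by (simp only: divide_right_mono of_nat_0_le_iff)
    qed
    have "(op_norm ((1 / depth_beta) \<cdot>\<^sub>m Ghat X - S))\<^sup>2
            \<le> C * (max (real p / real n) (\<epsilon>\<^sup>2) + ln (1 / \<delta>) / real n)" if X: "X \<in> E" for X
    proof -
      have "X \<in> space (\<Pi>\<^sub>M i\<in>{..<n}. ?P)" using X sets.sets_into_space[OF E(1)] by blast
      moreover have "space ?P = carrier_vec p" using sets_eq_imp_space_eq[OF P(1)] by simp
      ultimately have Xi: "X \<in> PiE {..<n} (\<lambda>_. carrier_vec p)" by (simp add: space_PiM)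
      then have arg: "is_arg_max (\<lambda>G. matrix_depth n p G X) (psd_mat p) (Ghat X)"
        using Ghat by (simp add: space_PiM)
      have "(op_norm ((1 / depth_beta) \<cdot>\<^sub>m Ghat X - S))\<^sup>2
          \<le> (M * (K * (5/4 * (\<epsilon> + 2 * \<Delta>))) / depth_beta)\<^sup>2"
      proof (rule depth_estimator_op_norm[OF p psdS _ \<beta>])
        show "psd_mat p (Ghat X)" using arg by (simp add: is_arg_max_def)
        show "\<bar>u \<bullet> (Ghat X *\<^sub>v u) - depth_beta * (u \<bullet> (S *\<^sub>v u))\<bar> \<le> M * (K * (5/4 * (\<epsilon> + 2 * \<Delta>)))"
          if "u \<in> unit_sphere p" for u
          using Xi by (intro depth_maximizer_quadratic_form[OF p n S(1) assms Q eps _ arg \<Delta>(2) _ _ K that]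
              scaled dev[OF X] dev_open[OF X]) auto
      qed
      also have "\<dots> = (M * K * (5/4) / depth_beta)\<^sup>2 * (\<epsilon> + 2 * \<Delta>)\<^sup>2"
        unfolding power_mult_distrib[symmetric] by (rule arg_cong[of _ _ "\<lambda>y. y\<^sup>2"]) simp
      also have "\<dots> \<le> (M * K * (5/4) / depth_beta)\<^sup>2 *
          ((2 + 8 * B) * (max (real p / real n) (\<epsilon>\<^sup>2) + L / real n))"
      proof (rule mult_left_mono)
        have "0 \<le> (\<epsilon> - 2 * \<Delta>)\<^sup>2" by simp
        then have "(\<epsilon> + 2 * \<Delta>)\<^sup>2 \<le> 2 * \<epsilon>\<^sup>2 + 8 * \<Delta>\<^sup>2" by (simp add: power2_eq_square algebra_simps)
        also have "\<dots> \<le> 2 * \<epsilon>\<^sup>2 + 8 * (B * (real p / real n + L / real n))" using \<Delta>2 by simp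
        also have "\<dots> \<le> 2 * (max (real p / real n) (\<epsilon>\<^sup>2) + L / real n)
            + 8 * (B * (max (real p / real n) (\<epsilon>\<^sup>2) + L / real n))"
        proof -
          have "0 \<le> L / real n" using L by simp
          then have "\<epsilon>\<^sup>2 \<le> max (real p / real n) (\<epsilon>\<^sup>2) + L / real n"
            "real p / real n + L / real n \<le> max (real p / real n) (\<epsilon>\<^sup>2) + L / real n" by linarith+
          then show ?thesis by (intro add_mono mult_left_mono) (auto simp: B_def)
        qed
        also have "\<dots> = (2 + 8 * B) * (max (real p / real n) (\<epsilon>\<^sup>2) + L / real n)"
          by (simp only: distrib_right mult.assoc)
        finally show "(\<epsilon> + 2 * \<Delta>)\<^sup>2 \<le> (2 + 8 * B) * (max (real p / real n) (\<epsilon>\<^sup>2) + L / real n)" .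
      qed simp
      finally show ?thesis by (simp only: C_def L_def mult.assoc)
    qed
    moreover have "1 - 2 * \<delta> \<le> measure (\<Pi>\<^sub>M i\<in>{..<n}. ?P) E" using E(2) by (simp add: expx)
    ultimately show "\<exists>E \<in> sets (sample_law n p \<epsilon> S Q).
         measure (sample_law n p \<epsilon> S Q) E \<ge> 1 - 2 * \<delta> \<and>
         (\<forall>X \<in> E. (op_norm ((1 / depth_beta) \<cdot>\<^sub>m Ghat X - S))\<^sup>2
            \<le> C * (max (real p / real n) (\<epsilon>\<^sup>2) + ln (1 / \<delta>) / real n))"
      unfolding sample_law_def using E(1) by blast
  qed
qed

end
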